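(* Suppose that $\Gamma$ is a sofic (respectively $\mathbb{K}$-linear sofic, for a field $\mathbb{K}$; hyperlinear; weakly sofic) group and that $\Gamma\curvearrowright_{\alpha}X$ is a sofic action on the set (respectively graph) $X$. Suppose that $\mathcal{L}$ is a set-theoretic (respectively graph-theoretic) halo of groups satisfying conditions (a) and (b) of the context. If $AL_f(X)$ is a sofic (respectively $\mathbb{K}$-linear sofic; hyperlinear; weakly sofic) group, then so is $\mathcal{AL}(\Gamma,X)$. In particular, this holds if $L(Y)$ is finitely generated and residually finite for every finite subset (respectively finite induced subgraph) $Y\subseteq X$.
   Context: Haloes. A halo of groups over a set $X$ is a family of groups $\mathcal{L}_X=\{L(Y):Y\subseteq X\}$ such that (i) $L(Z)\leq L(Y)$ for all $Z\subseteq Y\subseteq X$; (ii) $L(\emptyset)$ is trivial and $L(X)=\langle L(Y):Y\subseteq X\text{ finite}\rangle$; (iii) $L(Y\cap Z)=L(Y)\cap L(Z)$ for all $Y,Z\subseteq X$. For a graph $X$, subsets of the vertex set are identified with induced subgraphs. A set-theoretic (respectively graph-theoretic) halo of groups is a covariant functor $\mathcal{L}$, written $X\mapsto L(X)$ and $\pi\mapsto\hat\pi$, from the category of sets with injective functions (respectively graphs with inclusions of induced subgraphs, i.e. injective vertex maps preserving adjacency and non-adjacency) to groups with monomorphisms, such that for every set (graph) $X$ the family $\{\hat\iota(L(Y)):Y\subseteq X\}$ ($\iota:Y\hookrightarrow X$ the inclusion) is a halo of groups over $X$; $L(Y)$ is identified with its image in $L(X)$. An action $\Gamma\curvearrowright_\alpha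 X$ (by graph automorphisms in the graph case) induces $\hat\alpha:\Gamma\to\operatorname{Aut}(L(X))$, $\hat\alpha(g)=\widehat{\alpha(g)}$. Automorphic enrichment. For $Y\subseteq X$ let $AL_f(X)=\{\beta\in\operatorname{Aut}(L(X)):\exists Y\subseteq X\text{ finite with }\beta(L(Y))=L(Y)\text{ and }\beta|_{L(X\setminus Y)}=\mathrm{id}\}$ and $AL_{f,X}(Y)=\{\beta\in AL_f(X):\beta(L(Y))=L(Y)\text{ and }\beta|_{L(X\setminus Y)}=\mathrm{id}\}$. $\Gamma$ acts on $AL_f(X)$ by $g\cdot\beta=\hat\alpha(g)\beta\hat\alpha(g)^{-1}$, and $\mathcal{AL}(\Gamma,X)=AL_f(X)\rtimes\Gamma$. Conditions on $\mathcal{L}$, required for every set (graph) $X$: (a) $L(Y\cup Z)=\langle L(Y)\cup L(Z)\rangle$ for all $Y,Z\subseteq X$; (b) if $Y\subseteq X$ is finite, then every $\beta\in\operatorname{Aut}(L(Y))$ extends to some $\tilde\beta\in AL_{f,X}(Y)$. Metric approximation. For a group $\Gamma$, a group $G$ with bounded bi-invariant metric $d$, a function $\varphi:\Gamma\to G$, finite $F\subseteq\Gamma$ and $\epsilon,c>0$: $\varphi$ is $(F,\epsilon)$-multiplicative if $d(\varphi(gh),\varphi(g)\varphi(h))<\epsilon$ for all $g,h\in F$ with $gh\in F$; $(F,c)$-separating if $d(\varphi(g),e_G)>c$ for all $e\neq g\in F$; unital if $\varphi(e_\Gamma)=e_G$. Given a family $\mathcal{G}$ of groups with bi-invariant metrics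 of uniformly bounded diameter, $\Gamma$ is $\mathcal{G}$-approximable if there is $c>0$ such that for all finite $F\subseteq\Gamma$ and $\epsilon>0$ there is a unital, $(F,\epsilon)$-multiplicative, $(F,c)$-separating function from $\Gamma$ to some member of $\mathcal{G}$. Then $\Gamma$ is: sofic if $\mathcal{G}=\{(\operatorname{Sym}(n),d_n):n\in\mathbb{N}\}$ with $d_n$ the normalized Hamming metric; $\mathbb{K}$-linear sofic if $\mathcal{G}=\{GL_n(\mathbb{K}):n\in\mathbb{N}\}$ with metric $\frac1n\operatorname{rk}(M-N)$; hyperlinear if $\mathcal{G}=\{U(n):n\in\mathbb{N}\}$ (unitary groups) with metric $\sqrt{\frac1n\operatorname{Tr}((A-B)(A-B)^* )}$; weakly sofic if $\mathcal{G}$ is the family of all finite groups equipped with bi-invariant metrics of diameter one. The normalized Hamming metric on $\operatorname{Sym}(A)$, $A$ finite, is $d_A(\sigma,\tau)=1-\frac{1}{|A|}|\{a\in A:\sigma(a)=\tau(a)\}|$ (written $d_n$ when $A=\{1,\ldots,n\}$). Sofic actions on sets and graphs. Given $\Gamma\curvearrowright_\alpha X$ on a set, finite $F\subseteq\Gamma$, $E\subseteq X$, and $\epsilon>0$, a function $\varphi:\Gamma\to\operatorname{Sym}(A)$ ($A$ finite) is an $(F,E,\epsilon)$-orbit approximation of $\alpha$ if there exist a finite set $B$, $S\subseteq A$ with $|S|>(1-\epsilon)|A|$, and injective functions $(\pi_s:E\hookrightarrow B)_{s\in S}$ such that for all $g\in F$, $x\in E$, $s\in S$, if $\varphi(g)\cdot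 s\in S$ and $\alpha(g)^{-1}\cdot x\in E$ then $\pi_{\varphi(g)\cdot s}(x)=\pi_s(\alpha(g)^{-1}\cdot x)$. The action is sofic if for all such $F,E,\epsilon$ there exist a finite set $A$ and a unital $(F,\epsilon)$-multiplicative (with respect to $d_A$) $(F,E,\epsilon)$-orbit approximation $\varphi:\Gamma\to\operatorname{Sym}(A)$. For actions on graphs by automorphisms the definition is the same, with $E$ a finite induced subgraph, $B$ a finite graph, and the $\pi_s$ inclusions of induced subgraphs. *)

theory Defs
  imports
    "HOL-Algebra.Group_Action"
    "HOL-Algebra.Generated_Groups"
    "HOL-Analysis.Abstract_Metric_Spaces"
    "Jordan_Normal_Form.DL_Rank"
    "Jordan_Normal_Form.Schur_Decomposition"
begin

section \<open>Metric approximation of groups\<close>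

type_synonym 'h metric = "'h \<Rightarrow> 'h \<Rightarrow> real"

definition unital :: "('a, 'm) monoid_scheme \<Rightarrow> ('h, 'n) monoid_scheme \<Rightarrow> ('a \<Rightarrow> 'h) \<Rightarrow> bool" where
  "unital \<Gamma> G \<phi> \<longleftrightarrow> \<phi> \<one>\<^bsub>\<Gamma>\<^esub> = \<one>\<^bsub>G\<^esub>"

definition almost_multiplicative ::
  "('a, 'm) monoid_scheme \<Rightarrow> ('h, 'n) monoid_scheme \<Rightarrow> 'h metric \<Rightarrow> 'a set \<Rightarrow> real \<Rightarrow> ('a \<Rightarrow> 'h) \<Rightarrow> bool"
  where
  "almost_multiplicative \<Gamma> G d F \<epsilon> \<phi> \<longleftrightarrow>
     (\<forall>g\<in>F. \<forall>h\<in>F. g \<otimes>\<^bsub>\<Gamma>\<^esub> h \<in> F \<longrightarrow> d (\<phi> (g \<otimes>\<^bsub>\<Gamma>\<^esub> h)) (\<phi> g \<otimes>\<^bsub>G\<^esub> \<phi> h) < \<epsilon>)"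

definition separating ::
  "('a, 'm) monoid_scheme \<Rightarrow> ('h, 'n) monoid_scheme \<Rightarrow> 'h metric \<Rightarrow> 'a set \<Rightarrow> real \<Rightarrow> ('a \<Rightarrow> 'h) \<Rightarrow> bool"
  where
  "separating \<Gamma> G d F c \<phi> \<longleftrightarrow> (\<forall>g\<in>F. g \<noteq> \<one>\<^bsub>\<Gamma>\<^esub> \<longrightarrow> d (\<phi> g) \<one>\<^bsub>G\<^esub> > c)"

definition approximable :: "('h monoid \<times> 'h metric) set \<Rightarrow> ('a, 'm) monoid_scheme \<Rightarrow> bool" where
  "approximable \<G> \<Gamma> \<longleftrightarrow> group \<Gamma> \<and>
     (\<exists>c>0. \<forall>F \<epsilon>. F \<subseteq> carrier \<Gamma> \<and> finite F \<and> \<epsilon> > 0 \<longrightarrow>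
        (\<exists>(G, d)\<in>\<G>. \<exists>\<phi>\<in>carrier \<Gamma> \<rightarrow> carrier G.
           unital \<Gamma> G \<phi> \<and> almost_multiplicative \<Gamma> G d F \<epsilon> \<phi> \<and> separating \<Gamma> G d F c \<phi>))"

definition hamming :: "'s set \<Rightarrow> ('s \<Rightarrow> 's) metric" where
  "hamming A \<sigma> \<tau> = 1 - real (card {a \<in> A. \<sigma> a = \<tau> a}) / real (card A)"

text \<open>All families below are indexed by \<open>n \<ge> 1\<close>: the normalised metrics are meaningless in
  dimension \<open>0\<close>. The symmetric group on a set \<open>A\<close> is \<^term>\<open>BijGroup A\<close>.\<close>

definition sofic :: "('a, 'm) monoid_scheme \<Rightarrow> bool" where
  "sofic \<Gamma> \<longleftrightarrow> approximable {(BijGroup {1..n}, hamming {1..n}) | n :: nat. n \<ge> 1} \<Gamma>"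

definition GL :: "'k :: field itself \<Rightarrow> nat \<Rightarrow> 'k mat monoid" where
  "GL ty n = units_of (ring_mat ty n ())"

definition rank_dist :: "nat \<Rightarrow> 'k :: field mat metric" where
  "rank_dist n M N = real (vec_space.rank n (M - N)) / real n"

definition linear_sofic :: "'k :: field itself \<Rightarrow> ('a, 'm) monoid_scheme \<Rightarrow> bool" where
  "linear_sofic ty \<Gamma> \<longleftrightarrow> approximable {(GL ty n, rank_dist n) | n. n \<ge> 1} \<Gamma>"

definition unitary_group :: "nat \<Rightarrow> complex mat monoid" where
  "unitary_group n =
     \<lparr>carrier = {A \<in> carrier_mat n n. A * mat_adjoint A = 1\<^sub>m n \<and> mat_adjoint A * A = 1\<^sub>m n},
      monoid.mult = (*), one = 1\<^sub>m n\<rparr>"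

definition mat_trace :: "'k :: comm_monoid_add mat \<Rightarrow> 'k" where
  "mat_trace A = (\<Sum>i<dim_row A. A $$ (i, i))"

text \<open>The trace below is a nonnegative real number, so taking its real part loses nothing.\<close>

definition hilbert_schmidt_dist :: "nat \<Rightarrow> complex mat metric" where
  "hilbert_schmidt_dist n A B = sqrt (Re (mat_trace ((A - B) * mat_adjoint (A - B))) / real n)"

definition hyperlinear :: "('a, 'm) monoid_scheme \<Rightarrow> bool" where
  "hyperlinear \<Gamma> \<longleftrightarrow> approximable {(unitary_group n, hilbert_schmidt_dist n) | n. n \<ge> 1} \<Gamma>"

definition bi_invariant :: "('h, 'n) monoid_scheme \<Rightarrow> 'h metric \<Rightarrow> bool" where
  "bi_invariant G d \<longleftrightarrow>
     (\<forall>a\<in>carrier G. \<forall>x\<in>carrier G. \<forall>y\<in>carrier G.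
        d (a \<otimes>\<^bsub>G\<^esub> x) (a \<otimes>\<^bsub>G\<^esub> y) = d x y \<and> d (x \<otimes>\<^bsub>G\<^esub> a) (y \<otimes>\<^bsub>G\<^esub> a) = d x y)"

text \<open>Every finite group has an isomorphic copy with carrier a set of natural numbers.\<close>

definition weakly_sofic :: "('a, 'm) monoid_scheme \<Rightarrow> bool" where
  "weakly_sofic \<Gamma> \<longleftrightarrow>
     approximable {(G :: nat monoid, d). group G \<and> finite (carrier G) \<and>
        Metric_space (carrier G) d \<and> bi_invariant G d \<and>
        (SUP (x, y)\<in>carrier G \<times> carrier G. d x y) = 1} \<Gamma>"

definition finitely_generated :: "('a, 'm) monoid_scheme \<Rightarrow> bool" where
  "finitely_generated G \<longleftrightarrow> (\<exists>S\<subseteq>carrier G. finite S \<and> generate G S = carrier G)"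

definition residually_finite :: "('a, 'm) monoid_scheme \<Rightarrow> bool" where
  "residually_finite G \<longleftrightarrow>
     (\<forall>g\<in>carrier G. g \<noteq> \<one>\<^bsub>G\<^esub> \<longrightarrow> (\<exists>N. N \<lhd> G \<and> finite (rcosets\<^bsub>G\<^esub> N) \<and> g \<notin> N))"


section \<open>The categories of sets and of graphs\<close>

text \<open>Simple undirected graphs, possibly infinite.\<close>

record 'x graph =
  verts :: "'x set"
  edges :: "('x \<times> 'x) set"

definition simple_graph :: "'x graph \<Rightarrow> bool" where
  "simple_graph X \<longleftrightarrow> edges X \<subseteq> verts X \<times> verts X \<and> sym (edges X) \<and> irrefl (edges X)"

definition induced_subgraph :: "'x graph \<Rightarrow> 'x set \<Rightarrow> 'x graph" where
  "induced_subgraph X Y = \<lparr>verts = verts X \<inter> Y, edges = edges X \<inter> (Y \<times> Y)\<rparr>"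

definition injections :: "'x set \<Rightarrow> 'y set \<Rightarrow> ('x \<Rightarrow> 'y) set" where
  "injections X Y = {\<pi>. inj_on \<pi> X \<and> \<pi> \<in> X \<rightarrow> Y}"

definition graph_embeddings :: "'x graph \<Rightarrow> 'y graph \<Rightarrow> ('x \<Rightarrow> 'y) set" where
  "graph_embeddings X Y = {\<pi> \<in> injections (verts X) (verts Y).
     \<forall>u\<in>verts X. \<forall>v\<in>verts X. (\<pi> u, \<pi> v) \<in> edges Y \<longleftrightarrow> (u, v) \<in> edges X}"

text \<open>A record describing a category of structured subsets of \<open>'x\<close>: its objects, their underlying
  sets, its morphisms (functions, of which only the restriction to the source is relevant), and the
  subobject of a given object carried by a given subset. It lets haloes over sets and over graphs
  be treated simultaneously. For \<open>'x\<close> infinite, the categories below contain a copy of every finite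
  set, respectively graph; a functor on all sets or graphs restricts to them.\<close>

record ('o, 'x) concrete_category =
  objs :: "'o set"
  points :: "'o \<Rightarrow> 'x set"
  embs :: "'o \<Rightarrow> 'o \<Rightarrow> ('x \<Rightarrow> 'x) set"
  subobj :: "'o \<Rightarrow> 'x set \<Rightarrow> 'o"

definition Sets :: "('x set, 'x) concrete_category" where
  "Sets = \<lparr>objs = UNIV, points = (\<lambda>X. X), embs = injections, subobj = (\<inter>)\<rparr>"

definition Graphs :: "('x graph, 'x) concrete_category" where
  "Graphs = \<lparr>objs = {X. simple_graph X}, points = verts, embs = graph_embeddings,
     subobj = induced_subgraph\<rparr>"


section \<open>Haloes of groups\<close>

text \<open>A halo over \<open>X\<close> is presented as a family of subgroups of one group \<open>G\<close>, which plays the role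
  of \<open>L(X)\<close>.\<close>

definition halo_over :: "'x set \<Rightarrow> ('g, 'm) monoid_scheme \<Rightarrow> ('x set \<Rightarrow> 'g set) \<Rightarrow> bool" where
  "halo_over X G H \<longleftrightarrow> group G \<and> H X = carrier G \<and>
     (\<forall>Y\<subseteq>X. subgroup (H Y) G) \<and>
     (\<forall>Y Z. Z \<subseteq> Y \<and> Y \<subseteq> X \<longrightarrow> H Z \<subseteq> H Y) \<and>
     H {} = {\<one>\<^bsub>G\<^esub>} \<and>
     H X = generate G (\<Union>{H Y | Y. Y \<subseteq> X \<and> finite Y}) \<and>
     (\<forall>Y Z. Y \<subseteq> X \<and> Z \<subseteq> X \<longrightarrow> H (Y \<inter> Z) = H Y \<inter> H Z)"

text \<open>A functor to groups and monomorphisms consists of \<open>L\<close> on objects and \<open>Lm\<close> on morphisms;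
  \<^term>\<open>Lm X Y \<pi>\<close> is the homomorphism induced by \<open>\<pi> : X \<rightarrow> Y\<close>.\<close>

definition group_functor ::
  "('o, 'x) concrete_category \<Rightarrow> ('o \<Rightarrow> 'g monoid) \<Rightarrow> ('o \<Rightarrow> 'o \<Rightarrow> ('x \<Rightarrow> 'x) \<Rightarrow> 'g \<Rightarrow> 'g) \<Rightarrow> bool"
  where
  "group_functor C L Lm \<longleftrightarrow>
     (\<forall>X\<in>objs C. group (L X)) \<and>
     (\<forall>X\<in>objs C. \<forall>Y\<in>objs C. \<forall>\<pi>\<in>embs C X Y. Lm X Y \<pi> \<in> mon (L X) (L Y)) \<and>
     (\<forall>X\<in>objs C. \<forall>Y\<in>objs C. \<forall>\<pi>\<in>embs C X Y. \<forall>\<rho>\<in>embs C X Y.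
        (\<forall>x\<in>points C X. \<pi> x = \<rho> x) \<longrightarrow> (\<forall>a\<in>carrier (L X). Lm X Y \<pi> a = Lm X Y \<rho> a)) \<and>
     (\<forall>X\<in>objs C. \<forall>a\<in>carrier (L X). Lm X X id a = a) \<and>
     (\<forall>X\<in>objs C. \<forall>Y\<in>objs C. \<forall>Z\<in>objs C. \<forall>\<pi>\<in>embs C X Y. \<forall>\<rho>\<in>embs C Y Z. \<forall>a\<in>carrier (L X).
        Lm X Z (\<rho> \<circ> \<pi>) a = Lm Y Z \<rho> (Lm X Y \<pi> a))"

text \<open>The copy of \<open>L(Y)\<close> inside \<open>L(X)\<close>, for \<open>Y \<subseteq> X\<close>.\<close>

definition sub_image ::
  "('o, 'x) concrete_category \<Rightarrow> ('o \<Rightarrow> 'g monoid) \<Rightarrow> ('o \<Rightarrow> 'o \<Rightarrow> ('x \<Rightarrow> 'x) \<Rightarrow> 'g \<Rightarrow> 'g) \<Rightarrow>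
     'o \<Rightarrow> 'x set \<Rightarrow> 'g set" where
  "sub_image C L Lm X Y = Lm (subobj C X Y) X id ` carrier (L (subobj C X Y))"

definition halo_functor ::
  "('o, 'x) concrete_category \<Rightarrow> ('o \<Rightarrow> 'g monoid) \<Rightarrow> ('o \<Rightarrow> 'o \<Rightarrow> ('x \<Rightarrow> 'x) \<Rightarrow> 'g \<Rightarrow> 'g) \<Rightarrow> bool"
  where
  "halo_functor C L Lm \<longleftrightarrow> group_functor C L Lm \<and>
     (\<forall>X\<in>objs C. halo_over (points C X) (L X) (sub_image C L Lm X))"


section \<open>The automorphic enrichment\<close>

text \<open>\<^term>\<open>auto G\<close> consists of the automorphisms of \<open>G\<close>, extended by \<^term>\<open>undefined\<close> outside the
  carrier.\<close>

definition supported_in ::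
  "('o, 'x) concrete_category \<Rightarrow> ('o \<Rightarrow> 'g monoid) \<Rightarrow> ('o \<Rightarrow> 'o \<Rightarrow> ('x \<Rightarrow> 'x) \<Rightarrow> 'g \<Rightarrow> 'g) \<Rightarrow>
     'o \<Rightarrow> 'x set \<Rightarrow> ('g \<Rightarrow> 'g) \<Rightarrow> bool" where
  "supported_in C L Lm X Y \<beta> \<longleftrightarrow>
     \<beta> ` sub_image C L Lm X Y = sub_image C L Lm X Y \<and>
     (\<forall>a\<in>sub_image C L Lm X (points C X - Y). \<beta> a = a)"

definition ALf ::
  "('o, 'x) concrete_category \<Rightarrow> ('o \<Rightarrow> 'g monoid) \<Rightarrow> ('o \<Rightarrow> 'o \<Rightarrow> ('x \<Rightarrow> 'x) \<Rightarrow> 'g \<Rightarrow> 'g) \<Rightarrow>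
     'o \<Rightarrow> ('g \<Rightarrow> 'g) set" where
  "ALf C L Lm X = {\<beta> \<in> auto (L X). \<exists>Y\<subseteq>points C X. finite Y \<and> supported_in C L Lm X Y \<beta>}"

definition ALf_at ::
  "('o, 'x) concrete_category \<Rightarrow> ('o \<Rightarrow> 'g monoid) \<Rightarrow> ('o \<Rightarrow> 'o \<Rightarrow> ('x \<Rightarrow> 'x) \<Rightarrow> 'g \<Rightarrow> 'g) \<Rightarrow>
     'o \<Rightarrow> 'x set \<Rightarrow> ('g \<Rightarrow> 'g) set" where
  "ALf_at C L Lm X Y = {\<beta> \<in> ALf C L Lm X. supported_in C L Lm X Y \<beta>}"

definition ALf_group ::
  "('o, 'x) concrete_category \<Rightarrow> ('o \<Rightarrow> 'g monoid) \<Rightarrow> ('o \<Rightarrow> 'o \<Rightarrow> ('x \<Rightarrow> 'x) \<Rightarrow> 'g \<Rightarrow> 'g) \<Rightarrow>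
     'o \<Rightarrow> ('g \<Rightarrow> 'g) monoid" where
  "ALf_group C L Lm X = (AutoGroup (L X))\<lparr>carrier := ALf C L Lm X\<rparr>"

text \<open>Conditions (a) and (b). In (b), \<open>\<beta>\<close> is an automorphism of \<open>L(Y)\<close> itself, and \<open>\<gamma>\<close> extends it
  along the inclusion \<open>L(Y) \<rightarrow> L(X)\<close>.\<close>

definition halo_joins ::
  "('o, 'x) concrete_category \<Rightarrow> ('o \<Rightarrow> 'g monoid) \<Rightarrow> ('o \<Rightarrow> 'o \<Rightarrow> ('x \<Rightarrow> 'x) \<Rightarrow> 'g \<Rightarrow> 'g) \<Rightarrow> bool"
  where
  "halo_joins C L Lm \<longleftrightarrow>
     (\<forall>X\<in>objs C. \<forall>Y Z. Y \<subseteq> points C X \<and> Z \<subseteq> points C X \<longrightarrow>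
        sub_image C L Lm X (Y \<union> Z) = generate (L X) (sub_image C L Lm X Y \<union> sub_image C L Lm X Z))"

definition halo_extends_autos ::
  "('o, 'x) concrete_category \<Rightarrow> ('o \<Rightarrow> 'g monoid) \<Rightarrow> ('o \<Rightarrow> 'o \<Rightarrow> ('x \<Rightarrow> 'x) \<Rightarrow> 'g \<Rightarrow> 'g) \<Rightarrow> bool"
  where
  "halo_extends_autos C L Lm \<longleftrightarrow>
     (\<forall>X\<in>objs C. \<forall>Y. Y \<subseteq> points C X \<and> finite Y \<longrightarrow>
        (\<forall>\<beta>\<in>auto (L (subobj C X Y)). \<exists>\<gamma>\<in>ALf_at C L Lm X Y.
           \<forall>a\<in>carrier (L (subobj C X Y)).
             \<gamma> (Lm (subobj C X Y) X id a) = Lm (subobj C X Y) X id (\<beta> a)))"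

text \<open>An action by automorphisms. As each \<^term>\<open>\<alpha> g\<close> is a bijection, membership in \<^const>\<open>embs\<close> is
  automatic for sets and says that it is a graph automorphism for graphs.\<close>

definition acts_on ::
  "('o, 'x) concrete_category \<Rightarrow> 'a monoid \<Rightarrow> 'o \<Rightarrow> ('a \<Rightarrow> 'x \<Rightarrow> 'x) \<Rightarrow> bool" where
  "acts_on C \<Gamma> X \<alpha> \<longleftrightarrow> group_action \<Gamma> (points C X) \<alpha> \<and> (\<forall>g\<in>carrier \<Gamma>. \<alpha> g \<in> embs C X X)"

definition induced_auto ::
  "('o \<Rightarrow> 'g monoid) \<Rightarrow> ('o \<Rightarrow> 'o \<Rightarrow> ('x \<Rightarrow> 'x) \<Rightarrow> 'g \<Rightarrow> 'g) \<Rightarrow>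
     'o \<Rightarrow> ('a \<Rightarrow> 'x \<Rightarrow> 'x) \<Rightarrow> 'a \<Rightarrow> 'g \<Rightarrow> 'g" where
  "induced_auto L Lm X \<alpha> g = restrict (Lm X X (\<alpha> g)) (carrier (L X))"

definition semidirect_product ::
  "('n, 'p) monoid_scheme \<Rightarrow> ('a, 'q) monoid_scheme \<Rightarrow> ('a \<Rightarrow> 'n \<Rightarrow> 'n) \<Rightarrow> ('n \<times> 'a) monoid" where
  "semidirect_product N \<Gamma> \<theta> =
     \<lparr>carrier = carrier N \<times> carrier \<Gamma>,
      monoid.mult = (\<lambda>(m, g) (n, h). (m \<otimes>\<^bsub>N\<^esub> \<theta> g n, g \<otimes>\<^bsub>\<Gamma>\<^esub> h)),
      one = (\<one>\<^bsub>N\<^esub>, \<one>\<^bsub>\<Gamma>\<^esub>)\<rparr>"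

definition AL_group ::
  "('o, 'x) concrete_category \<Rightarrow> ('o \<Rightarrow> 'g monoid) \<Rightarrow> ('o \<Rightarrow> 'o \<Rightarrow> ('x \<Rightarrow> 'x) \<Rightarrow> 'g \<Rightarrow> 'g) \<Rightarrow>
     'a monoid \<Rightarrow> 'o \<Rightarrow> ('a \<Rightarrow> 'x \<Rightarrow> 'x) \<Rightarrow> (('g \<Rightarrow> 'g) \<times> 'a) monoid" where
  "AL_group C L Lm \<Gamma> X \<alpha> =
     semidirect_product (ALf_group C L Lm X) \<Gamma>
       (\<lambda>g \<beta>. induced_auto L Lm X \<alpha> g \<otimes>\<^bsub>AutoGroup (L X)\<^esub> \<beta>
          \<otimes>\<^bsub>AutoGroup (L X)\<^esub> inv\<^bsub>AutoGroup (L X)\<^esub> induced_auto L Lm X \<alpha> g)"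


section \<open>Sofic actions\<close>

definition orbit_compatible ::
  "'a monoid \<Rightarrow> ('a \<Rightarrow> 'x \<Rightarrow> 'x) \<Rightarrow> 'a set \<Rightarrow> 'x set \<Rightarrow> ('a \<Rightarrow> 's \<Rightarrow> 's) \<Rightarrow> 's set \<Rightarrow>
     ('s \<Rightarrow> 'x \<Rightarrow> 'b) \<Rightarrow> bool" where
  "orbit_compatible \<Gamma> \<alpha> F E \<phi> S \<pi> \<longleftrightarrow>
     (\<forall>g\<in>F. \<forall>x\<in>E. \<forall>s\<in>S. \<phi> g s \<in> S \<and> \<alpha> (inv\<^bsub>\<Gamma>\<^esub> g) x \<in> E \<longrightarrow>
        \<pi> (\<phi> g s) x = \<pi> s (\<alpha> (inv\<^bsub>\<Gamma>\<^esub> g) x))"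

text \<open>The auxiliary finite sets \<open>A\<close> and finite sets or graphs \<open>B\<close> only matter up to isomorphism, so
  they are taken inside \<^typ>\<open>nat\<close>.\<close>

definition set_orbit_approx ::
  "'a monoid \<Rightarrow> ('a \<Rightarrow> 'x \<Rightarrow> 'x) \<Rightarrow> 'a set \<Rightarrow> 'x set \<Rightarrow> real \<Rightarrow> nat set \<Rightarrow> ('a \<Rightarrow> nat \<Rightarrow> nat) \<Rightarrow> bool"
  where
  "set_orbit_approx \<Gamma> \<alpha> F E \<epsilon> A \<phi> \<longleftrightarrow>
     (\<exists>(B :: nat set) S \<pi>. finite B \<and> S \<subseteq> A \<and> real (card S) > (1 - \<epsilon>) * real (card A) \<and>
        (\<forall>s\<in>S. \<pi> s \<in> injections E B) \<and> orbit_compatible \<Gamma> \<alpha> F E \<phi> S \<pi>)"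

definition graph_orbit_approx ::
  "'a monoid \<Rightarrow> 'x graph \<Rightarrow> ('a \<Rightarrow> 'x \<Rightarrow> 'x) \<Rightarrow> 'a set \<Rightarrow> 'x set \<Rightarrow> real \<Rightarrow> nat set \<Rightarrow>
     ('a \<Rightarrow> nat \<Rightarrow> nat) \<Rightarrow> bool"
  where
  "graph_orbit_approx \<Gamma> X \<alpha> F E \<epsilon> A \<phi> \<longleftrightarrow>
     (\<exists>(B :: nat graph) S \<pi>. simple_graph B \<and> finite (verts B) \<and>
        S \<subseteq> A \<and> real (card S) > (1 - \<epsilon>) * real (card A) \<and>
        (\<forall>s\<in>S. \<pi> s \<in> graph_embeddings (induced_subgraph X E) B) \<and>
        orbit_compatible \<Gamma> \<alpha> F E \<phi> S \<pi>)"

definition sofic_set_action :: "'a monoid \<Rightarrow> 'x set \<Rightarrow> ('a \<Rightarrow> 'x \<Rightarrow> 'x) \<Rightarrow> bool" where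
  "sofic_set_action \<Gamma> X \<alpha> \<longleftrightarrow> acts_on Sets \<Gamma> X \<alpha> \<and>
     (\<forall>F E \<epsilon>. F \<subseteq> carrier \<Gamma> \<and> finite F \<and> E \<subseteq> X \<and> finite E \<and> \<epsilon> > 0 \<longrightarrow>
        (\<exists>A. finite A \<and> (\<exists>\<phi>\<in>carrier \<Gamma> \<rightarrow> carrier (BijGroup A).
           unital \<Gamma> (BijGroup A) \<phi> \<and>
           almost_multiplicative \<Gamma> (BijGroup A) (hamming A) F \<epsilon> \<phi> \<and>
           set_orbit_approx \<Gamma> \<alpha> F E \<epsilon> A \<phi>)))"

definition sofic_graph_action :: "'a monoid \<Rightarrow> 'x graph \<Rightarrow> ('a \<Rightarrow> 'x \<Rightarrow> 'x) \<Rightarrow> bool" where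
  "sofic_graph_action \<Gamma> X \<alpha> \<longleftrightarrow> acts_on Graphs \<Gamma> X \<alpha> \<and>
     (\<forall>F E \<epsilon>. F \<subseteq> carrier \<Gamma> \<and> finite F \<and> E \<subseteq> verts X \<and> finite E \<and> \<epsilon> > 0 \<longrightarrow>
        (\<exists>A. finite A \<and> (\<exists>\<phi>\<in>carrier \<Gamma> \<rightarrow> carrier (BijGroup A).
           unital \<Gamma> (BijGroup A) \<phi> \<and>
           almost_multiplicative \<Gamma> (BijGroup A) (hamming A) F \<epsilon> \<phi> \<and>
           graph_orbit_approx \<Gamma> X \<alpha> F E \<epsilon> A \<phi>)))"

end

theory Submission
  imports Defs
begin

text \<open>Condition (b), applied to the swap of two vertices \<open>u\<close>, \<open>w\<close> (always an automorphism of the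
  subgraph on \<open>{u, w}\<close>), produces an element of \<open>AL\<^sub>f(X)\<close> that carries \<open>L({u})\<close> to \<open>L({w})\<close>
  canonically. Hence every finitely supported permutation \<open>p\<close> of \<open>X\<close> is realised in \<open>AL\<^sub>f(X)\<close> by a
  ``monomial'' automorphism, which maps each \<open>L({v})\<close> canonically to \<open>L({p v})\<close>. If \<open>X\<close> is infinite,
  the target \<open>B\<close> of an orbit approximation embeds into \<open>X\<close> as a set (its edges are irrelevant), and the
  maps \<open>\<pi>\<^sub>s\<close> extend to finitely supported permutations, realised by \<open>P\<^sub>s\<close>. The orbit condition says that
  \<open>P\<^bsub>\<phi>(g)s\<^esub> \<alpha>(g)\<close> and \<open>P\<^sub>s\<close> agree on the support of \<open>\<beta>\<close> for most \<open>s\<close>, so they conjugate \<open>\<beta>\<close> to the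
  same automorphism. If \<open>X\<close> is finite, the permutations of \<open>X\<close> themselves serve as index set. An approximation
  \<open>\<psi>\<close> of \<open>AL\<^sub>f(X)\<close> then gives block monomial approximations
  \<open>(\<beta>, g) \<mapsto> (\<psi>(P\<^bsub>\<phi>(g)s\<^esub> \<beta> P\<^bsub>\<phi>(g)s\<^esub>\<^sup>-\<^sup>1))\<^sub>s \<phi>(g)\<close> of the semidirect product, and adding copies of an
  approximation of \<open>\<Gamma>\<close> separates the elements with \<open>g \<noteq> 1\<close>.

  If all \<open>L(Y)\<close> with \<open>Y\<close> finite are finitely generated and residually finite, then the groups of
  automorphisms supported in \<open>Y\<close> are residually finite (Baumslag), and finite groups lie in all four classes.\<close>

section \<open>Approximation of semidirect products by block monomial maps\<close>

text \<open>The conjugators \<open>P\<^sub>s\<close> lie in AL_f(X) itself, so a single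
  approximation \<psi>, accurate on the finitely many conjugates of the given elements, serves all
  blocks, and no group over B has to be approximated. That two conjugations can be compared at all
  rests on generation: (a) together with axioms (ii) and (iii) makes each L(Y) the group generated
  by the L({v}) with v in Y. Hence a monomial automorphism is determined by its permutation, and one
  whose permutation fixes Y pointwise commutes with everything supported in Y. The split by the size
  of X is forced, since B may have more points than a finite X; there, left translation of Sym(X) on
  itself gives exact equations. The four classes enter only through \<open>wreath_closed\<close> and
  \<open>jointly_embeddable\<close>. The separation constant has to be independent of F and
  \<epsilon>: starting from the smaller constant c of the two groups, putting both approximations
  into one target may halve it, and only half of the blocks are known to be far from 1, which leaves
  c / 4.\<close>

text \<open>Think of \<open>\<omega> f \<tau>\<close> as the block monomial matrix with the block \<open>f j\<close> in position \<open>(\<tau> j, j)\<close>. The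
  square root in the continuity clause is forced by the Hilbert--Schmidt distance.\<close>

definition wreath_embeds ::
  "'i set \<Rightarrow> ('h, 'm) monoid_scheme \<Rightarrow> 'h metric \<Rightarrow> ('w, 'n) monoid_scheme \<Rightarrow> 'w metric \<Rightarrow>
     (('i \<Rightarrow> 'h) \<Rightarrow> ('i \<Rightarrow> 'i) \<Rightarrow> 'w) \<Rightarrow> bool"
  where
  "wreath_embeds J G d W D \<omega> \<longleftrightarrow>
     (\<forall>f\<in>J \<rightarrow> carrier G. \<forall>\<tau>. bij_betw \<tau> J J \<longrightarrow>
        \<omega> f \<tau> \<in> carrier W \<and>
        ((\<forall>j\<in>J. f j = \<one>\<^bsub>G\<^esub> \<and> \<tau> j = j) \<longrightarrow> \<omega> f \<tau> = \<one>\<^bsub>W\<^esub>) \<and>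
        (\<forall>f'\<in>J \<rightarrow> carrier G. \<forall>\<tau>'. bij_betw \<tau>' J J \<longrightarrow>
           \<omega> f \<tau> \<otimes>\<^bsub>W\<^esub> \<omega> f' \<tau>' = \<omega> (\<lambda>j. f (\<tau>' j) \<otimes>\<^bsub>G\<^esub> f' j) (\<tau> \<circ> \<tau>') \<and>
           (\<forall>T\<subseteq>J. \<forall>\<eta>\<ge>0. (\<forall>j\<in>J - T. \<tau> j = \<tau>' j \<and> d (f j) (f' j) \<le> \<eta>) \<longrightarrow>
              D (\<omega> f \<tau>) (\<omega> f' \<tau>') \<le> \<eta> + 2 * sqrt (real (card T) / real (card J)))) \<and>
        (\<forall>T\<subseteq>J. \<forall>c>0. card J \<le> 2 * card T \<and> (\<forall>j\<in>T. \<tau> j = j \<and> d (f j) \<one>\<^bsub>G\<^esub> > c) \<longrightarrow>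
           D (\<omega> f \<tau>) \<one>\<^bsub>W\<^esub> > c / 2) \<and>
        ((\<forall>j\<in>J. \<tau> j \<noteq> j) \<longrightarrow> D (\<omega> f \<tau>) \<one>\<^bsub>W\<^esub> > 1 / 4))"

lemma wreath_embedsD:
  assumes "wreath_embeds J G d W D \<omega>" "f \<in> J \<rightarrow> carrier G" "bij_betw \<tau> J J"
  shows "\<omega> f \<tau> \<in> carrier W"
    and "(\<And>j. j \<in> J \<Longrightarrow> f j = \<one>\<^bsub>G\<^esub>) \<Longrightarrow> (\<And>j. j \<in> J \<Longrightarrow> \<tau> j = j) \<Longrightarrow> \<omega> f \<tau> = \<one>\<^bsub>W\<^esub>"
    and "f' \<in> J \<rightarrow> carrier G \<Longrightarrow> bij_betw \<tau>' J J \<Longrightarrow>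
      \<omega> f \<tau> \<otimes>\<^bsub>W\<^esub> \<omega> f' \<tau>' = \<omega> (\<lambda>j. f (\<tau>' j) \<otimes>\<^bsub>G\<^esub> f' j) (\<tau> \<circ> \<tau>')"
    and "f' \<in> J \<rightarrow> carrier G \<Longrightarrow> bij_betw \<tau>' J J \<Longrightarrow> T \<subseteq> J \<Longrightarrow> \<eta> \<ge> 0 \<Longrightarrow>
      (\<And>j. j \<in> J - T \<Longrightarrow> \<tau> j = \<tau>' j \<and> d (f j) (f' j) \<le> \<eta>) \<Longrightarrow>
      D (\<omega> f \<tau>) (\<omega> f' \<tau>') \<le> \<eta> + 2 * sqrt (real (card T) / real (card J))"
    and "T \<subseteq> J \<Longrightarrow> c > 0 \<Longrightarrow> card J \<le> 2 * card T \<Longrightarrow>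
      (\<And>j. j \<in> T \<Longrightarrow> \<tau> j = j \<and> d (f j) \<one>\<^bsub>G\<^esub> > c) \<Longrightarrow> D (\<omega> f \<tau>) \<one>\<^bsub>W\<^esub> > c / 2"
    and "(\<And>j. j \<in> J \<Longrightarrow> \<tau> j \<noteq> j) \<Longrightarrow> D (\<omega> f \<tau>) \<one>\<^bsub>W\<^esub> > 1 / 4"
  using assms unfolding wreath_embeds_def by simp_all

text \<open>The type of the index sets is an explicit parameter because a definition cannot quantify
  over types; each application supplies its own.\<close>

definition wreath_closed :: "'i itself \<Rightarrow> ('h monoid \<times> 'h metric) set \<Rightarrow> bool" where
  "wreath_closed ty \<G> \<longleftrightarrow>
     (\<forall>(G, d)\<in>\<G>. \<forall>J :: 'i set. finite J \<and> J \<noteq> {} \<longrightarrow>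
        (\<exists>(W, D)\<in>\<G>. \<exists>\<omega>. wreath_embeds J G d W D \<omega>))"

lemma wreath_closedE:
  fixes J :: "'i set"
  assumes "wreath_closed TYPE('i) \<G>" "(G, d) \<in> \<G>" "finite J" "J \<noteq> {}"
  obtains W D \<omega> where "(W, D) \<in> \<G>" "wreath_embeds J G d W D \<omega>"
proof -
  from assms have "\<exists>(W, D)\<in>\<G>. \<exists>\<omega>. wreath_embeds J G d W D \<omega>"
    unfolding wreath_closed_def by blast
  then show thesis using that by blast
qed

text \<open>Tailored to the weakest case: a member is carried into a larger one by the family with x
  in every block, and the clause of \<open>wreath_embeds\<close> on blocks far from 1 retains only
  half of the separation. Values at 1 are listed separately because \<open>hom\<close> asks for
  multiplicativity alone.\<close>

definition jointly_embeddable :: "('h monoid \<times> 'h metric) set \<Rightarrow> bool" where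
  "jointly_embeddable \<G> \<longleftrightarrow>
     (\<forall>(G, d)\<in>\<G>. \<forall>(G', d')\<in>\<G>. \<exists>(K, e)\<in>\<G>. \<exists>i\<in>hom G K. \<exists>i'\<in>hom G' K.
        i \<one>\<^bsub>G\<^esub> = \<one>\<^bsub>K\<^esub> \<and> i' \<one>\<^bsub>G'\<^esub> = \<one>\<^bsub>K\<^esub> \<and>
        (\<forall>x\<in>carrier G. \<forall>y\<in>carrier G. \<forall>\<eta>\<ge>0. d x y \<le> \<eta> \<longrightarrow> e (i x) (i y) \<le> \<eta>) \<and>
        (\<forall>x\<in>carrier G'. \<forall>y\<in>carrier G'. \<forall>\<eta>\<ge>0. d' x y \<le> \<eta> \<longrightarrow> e (i' x) (i' y) \<le> \<eta>) \<and>
        (\<forall>x\<in>carrier G. \<forall>c>0. d x \<one>\<^bsub>G\<^esub> > c \<longrightarrow> e (i x) \<one>\<^bsub>K\<^esub> > c / 2) \<and>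
        (\<forall>x\<in>carrier G'. \<forall>c>0. d' x \<one>\<^bsub>G'\<^esub> > c \<longrightarrow> e (i' x) \<one>\<^bsub>K\<^esub> > c / 2))"

text \<open>Most conjugations by \<open>p (\<phi> g s)\<close> undo the action of \<open>g\<close> up to the conjugation by \<open>p s\<close>.\<close>

definition sofically_inner ::
  "'i itself \<Rightarrow> ('n, 'p) monoid_scheme \<Rightarrow> ('a, 'q) monoid_scheme \<Rightarrow> ('a \<Rightarrow> 'n \<Rightarrow> 'n) \<Rightarrow> bool" where
  "sofically_inner ty N \<Gamma> \<theta> \<longleftrightarrow>
     (\<forall>F E \<epsilon>. F \<subseteq> carrier \<Gamma> \<and> finite F \<and> E \<subseteq> carrier N \<and> finite E \<and> \<epsilon> > 0 \<longrightarrow>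
        (\<exists>(A :: 'i set) \<phi> S p. finite A \<and> A \<noteq> {} \<and>
           (\<forall>g\<in>carrier \<Gamma>. bij_betw (\<phi> g) A A) \<and> (\<forall>s\<in>A. \<phi> \<one>\<^bsub>\<Gamma>\<^esub> s = s) \<and>
           (\<forall>g\<in>F. \<forall>h\<in>F. g \<otimes>\<^bsub>\<Gamma>\<^esub> h \<in> F \<longrightarrow>
              real (card {s \<in> A. \<phi> (g \<otimes>\<^bsub>\<Gamma>\<^esub> h) s \<noteq> \<phi> g (\<phi> h s)}) \<le> \<epsilon> * real (card A)) \<and>
           S \<subseteq> A \<and> real (card (A - S)) \<le> \<epsilon> * real (card A) \<and>
           (\<forall>s\<in>A. p s \<in> carrier N) \<and>
           (\<forall>g\<in>F. \<forall>x\<in>E. \<forall>s\<in>S. \<phi> g s \<in> S \<longrightarrow>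
              p (\<phi> g s) \<otimes>\<^bsub>N\<^esub> \<theta> g x \<otimes>\<^bsub>N\<^esub> inv\<^bsub>N\<^esub> p (\<phi> g s) = p s \<otimes>\<^bsub>N\<^esub> x \<otimes>\<^bsub>N\<^esub> inv\<^bsub>N\<^esub> p s)))"

text \<open>With t = \<phi>(gh)s, the block of the product (x, g)(y, h) at s is \<psi>(C t (x
  \<theta>(g)(y))), where C s is conjugation by p(s). Where \<open>sofically_inner\<close> applies,
  C t turns \<theta>(g)(y) into C (\<phi>(h)s) y. The block is then nearly the product of the block
  of (x, g) at \<phi>(h)s and the block of (y, h) at s, as block monomial multiplication requires.
  The remaining s form a small set, paid for by the continuity clause.\<close>

lemma approximable_semidirect_product:
  fixes N :: "('n, 'p) monoid_scheme" and \<Gamma> :: "('a, 'q) monoid_scheme"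
    and \<theta> :: "'a \<Rightarrow> 'n \<Rightarrow> 'n" and \<G> :: "('h monoid \<times> 'h metric) set"
  assumes appN: "approximable \<G> N" and app\<Gamma>: "approximable \<G> \<Gamma>"
    and SD: "group (semidirect_product N \<Gamma> \<theta>)"
    and \<theta>: "\<And>g x. g \<in> carrier \<Gamma> \<Longrightarrow> x \<in> carrier N \<Longrightarrow> \<theta> g x \<in> carrier N"
    and inner: "sofically_inner TYPE('i) N \<Gamma> \<theta>"
    and groups: "\<And>G d. (G, d) \<in> \<G> \<Longrightarrow> group G"
    and wreath: "wreath_closed TYPE('i \<times> bool) \<G>" and joint: "jointly_embeddable \<G>"
  shows "approximable \<G> (semidirect_product N \<Gamma> \<theta>)"
proof -
  interpret N: group N using appN by (simp add: approximable_def)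
  interpret \<Gamma>: group \<Gamma> using app\<Gamma> by (simp add: approximable_def)
  let ?SD = "semidirect_product N \<Gamma> \<theta>"
  obtain c1 where c1: "c1 > 0" and c1': "\<And>F \<epsilon>. F \<subseteq> carrier N \<Longrightarrow> finite F \<Longrightarrow> \<epsilon> > 0 \<Longrightarrow>
     (\<exists>(G, d)\<in>\<G>. \<exists>\<phi>\<in>carrier N \<rightarrow> carrier G.
           unital N G \<phi> \<and> almost_multiplicative N G d F \<epsilon> \<phi> \<and> separating N G d F c1 \<phi>)"
    using appN by (auto simp: approximable_def)
  obtain c2 where c2: "c2 > 0" and c2': "\<And>F \<epsilon>. F \<subseteq> carrier \<Gamma> \<Longrightarrow> finite F \<Longrightarrow> \<epsilon> > 0 \<Longrightarrow>
     (\<exists>(G, d)\<in>\<G>. \<exists>\<phi>\<in>carrier \<Gamma> \<rightarrow> carrier G.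
           unital \<Gamma> G \<phi> \<and> almost_multiplicative \<Gamma> G d F \<epsilon> \<phi> \<and> separating \<Gamma> G d F c2 \<phi>)"
    using app\<Gamma> by (auto simp: approximable_def)
  define c where "c = min c1 c2"
  have c: "c > 0" "c \<le> c1" "c \<le> c2" using c1 c2 by (auto simp: c_def)
  have "\<exists>(G, d)\<in>\<G>. \<exists>\<Theta>\<in>carrier ?SD \<rightarrow> carrier G.
           unital ?SD G \<Theta> \<and> almost_multiplicative ?SD G d F \<epsilon> \<Theta> \<and> separating ?SD G d F (c / 4) \<Theta>"
    if F: "F \<subseteq> carrier ?SD" "finite F" "\<epsilon> > 0" for F \<epsilon>
  proof -
    define F\<^sub>\<Gamma> where "F\<^sub>\<Gamma> = snd ` F"
    define E where "E = fst ` F"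
    \<comment> \<open>Three exceptional subsets of A, each of relative size at most \<delta>, make
      up at most 3\<delta>/2 of J, which has twice as many elements. The square root of this must
      stay below \<epsilon>/4; the continuity clause doubles it, and the blocks contribute the other
      \<epsilon>/2.\<close>
    define \<delta> where "\<delta> = \<epsilon>\<^sup>2 / 100"
    have F\<^sub>\<Gamma>: "F\<^sub>\<Gamma> \<subseteq> carrier \<Gamma>" "finite F\<^sub>\<Gamma>" and E: "E \<subseteq> carrier N" "finite E"
      using F by (auto simp: F\<^sub>\<Gamma>_def E_def semidirect_product_def)
    have \<delta>: "\<delta> > 0" using F by (simp add: \<delta>_def)
    from inner[unfolded sofically_inner_def, THEN spec, THEN spec, THEN spec, of F\<^sub>\<Gamma> E \<delta>] F\<^sub>\<Gamma> E \<delta>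
    obtain A :: "'i set" and \<phi> S p where A: "finite A" "A \<noteq> {}"
      and \<phi>: "\<And>g. g \<in> carrier \<Gamma> \<Longrightarrow> bij_betw (\<phi> g) A A" "\<And>s. s \<in> A \<Longrightarrow> \<phi> \<one>\<^bsub>\<Gamma>\<^esub> s = s"
      and mult: "\<And>g h. g \<in> F\<^sub>\<Gamma> \<Longrightarrow> h \<in> F\<^sub>\<Gamma> \<Longrightarrow> g \<otimes>\<^bsub>\<Gamma>\<^esub> h \<in> F\<^sub>\<Gamma> \<Longrightarrow>
              real (card {s \<in> A. \<phi> (g \<otimes>\<^bsub>\<Gamma>\<^esub> h) s \<noteq> \<phi> g (\<phi> h s)}) \<le> \<delta> * real (card A)"
      and S: "S \<subseteq> A" "real (card (A - S)) \<le> \<delta> * real (card A)"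
      and p: "\<And>s. s \<in> A \<Longrightarrow> p s \<in> carrier N"
      and equi: "\<And>g x s. g \<in> F\<^sub>\<Gamma> \<Longrightarrow> x \<in> E \<Longrightarrow> s \<in> S \<Longrightarrow> \<phi> g s \<in> S \<Longrightarrow>
              p (\<phi> g s) \<otimes>\<^bsub>N\<^esub> \<theta> g x \<otimes>\<^bsub>N\<^esub> inv\<^bsub>N\<^esub> p (\<phi> g s) = p s \<otimes>\<^bsub>N\<^esub> x \<otimes>\<^bsub>N\<^esub> inv\<^bsub>N\<^esub> p s"
      apply (elim impE exE conjE)
       apply blast
      subgoal for A \<phi> S p by (rule that[of A \<phi> S p]) simp_all
      done
    define C where "C s x = p s \<otimes>\<^bsub>N\<^esub> x \<otimes>\<^bsub>N\<^esub> inv\<^bsub>N\<^esub> p s" for s x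
    have C_closed: "C s x \<in> carrier N" if "s \<in> A" "x \<in> carrier N" for s x
      using that p by (simp add: C_def)
    have C_mult: "C s (x \<otimes>\<^bsub>N\<^esub> y) = C s x \<otimes>\<^bsub>N\<^esub> C s y"
      if "s \<in> A" "x \<in> carrier N" "y \<in> carrier N" for s x y
    proof -
      have "inv\<^bsub>N\<^esub> p s \<otimes>\<^bsub>N\<^esub> (p s \<otimes>\<^bsub>N\<^esub> z) = z" if "z \<in> carrier N" for z
        using that \<open>s \<in> A\<close> p by (simp flip: N.m_assoc)
      then show ?thesis using that p by (simp add: C_def N.m_assoc)
    qed
    have C_one: "C s \<one>\<^bsub>N\<^esub> = \<one>\<^bsub>N\<^esub>" if "s \<in> A" for s
      using that p by (simp add: C_def)
    have C_ne: "C s x \<noteq> \<one>\<^bsub>N\<^esub>" if "s \<in> A" "x \<in> carrier N" "x \<noteq> \<one>\<^bsub>N\<^esub>" for s x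
    proof
      assume "C s x = \<one>\<^bsub>N\<^esub>"
      then have "p s \<otimes>\<^bsub>N\<^esub> x = p s" 
        using that p unfolding C_def by (metis N.inv_equality N.inv_inv N.inv_closed N.m_closed)
      then show False using that p by simp
    qed
    define F\<^sub>N where "F\<^sub>N = (\<lambda>(s, x). C s x) ` (A \<times> E)"
    have F\<^sub>N: "F\<^sub>N \<subseteq> carrier N" "finite F\<^sub>N"
      using A E C_closed by (auto simp: F\<^sub>N_def)
    \<comment> \<open>\<psi> is chosen after A and p because it has to be accurate on every
      conjugate C s x with s in A and x in E; these are finitely many since A is finite.\<close>
    obtain G2 d2 \<psi> where G2: "(G2, d2) \<in> \<G>" and \<psi>: "\<psi> \<in> carrier N \<rightarrow> carrier G2"
      "unital N G2 \<psi>" "almost_multiplicative N G2 d2 F\<^sub>N (\<epsilon>/2) \<psi>" "separating N G2 d2 F\<^sub>N c1 \<psi>"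
      using c1'[of F\<^sub>N "\<epsilon>/2"] F\<^sub>N F by auto
    obtain G1 d1 \<sigma> where G1: "(G1, d1) \<in> \<G>" and \<sigma>: "\<sigma> \<in> carrier \<Gamma> \<rightarrow> carrier G1"
      "unital \<Gamma> G1 \<sigma>" "almost_multiplicative \<Gamma> G1 d1 F\<^sub>\<Gamma> (\<epsilon>/2) \<sigma>" "separating \<Gamma> G1 d1 F\<^sub>\<Gamma> c2 \<sigma>"
      using c2'[of F\<^sub>\<Gamma> "\<epsilon>/2"] F\<^sub>\<Gamma> F by auto
    from joint[unfolded jointly_embeddable_def, rule_format, OF G1] G2
    obtain G d i1 i2 where G: "(G, d) \<in> \<G>" and i1: "i1 \<in> hom G1 G" "i1 \<one>\<^bsub>G1\<^esub> = \<one>\<^bsub>G\<^esub>"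
      and i2: "i2 \<in> hom G2 G" "i2 \<one>\<^bsub>G2\<^esub> = \<one>\<^bsub>G\<^esub>"
      and le1: "\<And>x y \<eta>. x \<in> carrier G1 \<Longrightarrow> y \<in> carrier G1 \<Longrightarrow> \<eta> \<ge> 0 \<Longrightarrow> d1 x y \<le> \<eta> \<Longrightarrow> d (i1 x) (i1 y) \<le> \<eta>"
      and le2: "\<And>x y \<eta>. x \<in> carrier G2 \<Longrightarrow> y \<in> carrier G2 \<Longrightarrow> \<eta> \<ge> 0 \<Longrightarrow> d2 x y \<le> \<eta> \<Longrightarrow> d (i2 x) (i2 y) \<le> \<eta>"
      and gt1: "\<And>x c. x \<in> carrier G1 \<Longrightarrow> c > 0 \<Longrightarrow> d1 x \<one>\<^bsub>G1\<^esub> > c \<Longrightarrow> d (i1 x) \<one>\<^bsub>G\<^esub> > c / 2"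
      and gt2: "\<And>x c. x \<in> carrier G2 \<Longrightarrow> c > 0 \<Longrightarrow> d2 x \<one>\<^bsub>G2\<^esub> > c \<Longrightarrow> d (i2 x) \<one>\<^bsub>G\<^esub> > c / 2"
      by (fastforce split: prod.splits)
    define J where "J = A \<times> (UNIV :: bool set)"
    have J: "finite J" "J \<noteq> {}" "card J = 2 * card A"
      using A by (auto simp: J_def card_cartesian_product)
    from wreath_closedE[OF wreath G J(1,2)]
    obtain W D \<omega> where W: "(W, D) \<in> \<G>" and \<omega>: "wreath_embeds J G d W D \<omega>"
      .
    \<comment> \<open>The copies of A labelled \<open>False\<close> carry the approximation of N and
      are permuted by \<phi>; those labelled \<open>True\<close> carry the approximation of \<Gamma>
      and stay put, so that g \<noteq> 1 is seen even where \<phi>(g) has fixed points.\<close>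
    define \<tau> where "\<tau> g j = (if snd j then j else (\<phi> g (fst j), False))" for g j
    \<comment> \<open>The conjugator belongs to the target \<phi>(g)s of the block, not to its
      source s.\<close>
    define f where "f z j = (if snd j then i1 (\<sigma> (snd z)) else i2 (\<psi> (C (\<phi> (snd z) (fst j)) (fst z))))" for z j
    have \<phi>_in: "\<phi> g s \<in> A" if "g \<in> carrier \<Gamma>" "s \<in> A" for g s
      using \<phi>(1)[OF that(1)] that(2) by (auto simp: bij_betw_def)
    have \<tau>_bij: "bij_betw (\<tau> g) J J" if "g \<in> carrier \<Gamma>" for g
    proof -
      have "inj_on (\<phi> g) A" "\<phi> g ` A = A" using \<phi>(1)[OF that] by (auto simp: bij_betw_def)
      have "inj_on (\<tau> g) J" using \<open>inj_on (\<phi> g) A\<close>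
        by (auto simp: inj_on_def \<tau>_def J_def split: if_splits)
      moreover have "\<tau> g ` J \<subseteq> J" using \<phi>_in[OF that] by (auto simp: \<tau>_def J_def)
      ultimately show ?thesis using J(1)
        by (simp add: bij_betw_def endo_inj_surj)
    qed
    have f_in: "f z \<in> J \<rightarrow> carrier G" if "z \<in> carrier ?SD" for z
    proof -
      have z: "fst z \<in> carrier N" "snd z \<in> carrier \<Gamma>" using that by (auto simp: semidirect_product_def)
      have "\<And>s. s \<in> A \<Longrightarrow> C (\<phi> (snd z) s) (fst z) \<in> carrier N" using z C_closed \<phi>_in by auto
      then show ?thesis using \<psi>(1) \<sigma>(1) i1(1) i2(1) z
        by (auto simp: f_def J_def hom_def Pi_iff)
    qed
    define \<Theta> where "\<Theta> z = \<omega> (f z) (\<tau> (snd z))" for z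
    have snd_in: "snd z \<in> carrier \<Gamma>" and fst_in: "fst z \<in> carrier N" if "z \<in> carrier ?SD" for z
      using that by (auto simp: semidirect_product_def)
    note \<omega>' = wreath_embedsD[OF \<omega> f_in \<tau>_bij]
    have "\<Theta> \<in> carrier ?SD \<rightarrow> carrier W"
      using \<omega>'(1) snd_in by (auto simp: \<Theta>_def)
    moreover have "unital ?SD W \<Theta>"
    proof -
      have 1: "\<one>\<^bsub>?SD\<^esub> \<in> carrier ?SD" using SD by (simp add: group.is_monoid)
      have 2: "\<one>\<^bsub>?SD\<^esub> = (\<one>\<^bsub>N\<^esub>, \<one>\<^bsub>\<Gamma>\<^esub>)" by (simp add: semidirect_product_def)
      have "\<forall>j\<in>J. f \<one>\<^bsub>?SD\<^esub> j = \<one>\<^bsub>G\<^esub> \<and> \<tau> \<one>\<^bsub>\<Gamma>\<^esub> j = j"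
        using \<psi>(2) \<sigma>(2) i1(2) i2(2) \<phi>(2) C_one 
        by (auto simp: 2 f_def \<tau>_def J_def unital_def)
      with \<omega>'(2)[OF 1 \<Gamma>.one_closed] show ?thesis
        unfolding unital_def \<Theta>_def 2 snd_conv by auto
    qed
    moreover have "almost_multiplicative ?SD W D F \<epsilon> \<Theta>"
      unfolding almost_multiplicative_def
    proof (intro ballI impI)
      fix z w assume zw: "z \<in> F" "w \<in> F" "z \<otimes>\<^bsub>?SD\<^esub> w \<in> F"
      obtain x g where z: "z = (x, g)" by force
      obtain y h where w: "w = (y, h)" by force
      have zwe: "z \<otimes>\<^bsub>?SD\<^esub> w = (x \<otimes>\<^bsub>N\<^esub> \<theta> g y, g \<otimes>\<^bsub>\<Gamma>\<^esub> h)"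
        by (simp add: z w semidirect_product_def)
      have carr: "z \<in> carrier ?SD" "w \<in> carrier ?SD" "z \<otimes>\<^bsub>?SD\<^esub> w \<in> carrier ?SD" using zw F by auto
      have gh: "g \<in> F\<^sub>\<Gamma>" "h \<in> F\<^sub>\<Gamma>" "g \<otimes>\<^bsub>\<Gamma>\<^esub> h \<in> F\<^sub>\<Gamma>" "g \<in> carrier \<Gamma>" "h \<in> carrier \<Gamma>"
        using zw zwe F\<^sub>\<Gamma> unfolding F\<^sub>\<Gamma>_def z w by force+
      have xy: "x \<in> E" "y \<in> E" "x \<otimes>\<^bsub>N\<^esub> \<theta> g y \<in> E" "x \<in> carrier N" "y \<in> carrier N"
        using zw zwe E unfolding E_def z w by force+
      define T1 where "T1 = {s \<in> A. \<phi> (g \<otimes>\<^bsub>\<Gamma>\<^esub> h) s \<noteq> \<phi> g (\<phi> h s)}"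
      define T2 where "T2 = {s \<in> A. \<phi> h s \<notin> S}"
      define T3 where "T3 = {s \<in> A. \<phi> (g \<otimes>\<^bsub>\<Gamma>\<^esub> h) s \<notin> S}"
      \<comment> \<open>\<open>T2\<close> and \<open>T3\<close> are both preimages of A - S under a
        permutation of A.\<close>
      have T2': "card {s \<in> A. \<phi> k s \<notin> S} \<le> \<delta> * card A" if "k \<in> carrier \<Gamma>" for k
      proof -
        have "inj_on (\<phi> k) {s \<in> A. \<phi> k s \<notin> S}" "\<phi> k ` {s \<in> A. \<phi> k s \<notin> S} \<subseteq> A - S"
          using \<phi>(1)[OF that] by (auto simp: bij_betw_def inj_on_def)
        then have "card {s \<in> A. \<phi> k s \<notin> S} \<le> card (A - S)"
          using A by (meson card_inj_on_le finite_Diff)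
        then show ?thesis using S(2) by linarith
      qed
      have cT: "real (card T1) \<le> \<delta> * card A" "real (card T2) \<le> \<delta> * card A" "real (card T3) \<le> \<delta> * card A"
        unfolding T1_def T2_def T3_def using mult gh T2' by auto
      define T where "T = (T1 \<union> T2 \<union> T3) \<times> {False}"
      have T: "T \<subseteq> J" by (auto simp: T_def J_def T1_def T2_def T3_def)
      have "card T \<le> card T1 + card T2 + card T3"
        unfolding T_def card_cartesian_product
        using card_Un_le[of "T1 \<union> T2" T3] card_Un_le[of T1 T2] by simp
      then have "real (card T) \<le> 3 * \<delta> * card A"
        using cT by linarith
      moreover have "card A > 0" using A by (simp add: card_gt_0_iff)
      ultimately have "real (card T) / real (card J) \<le> 3 / 2 * \<delta>"
        unfolding J(3) by (simp add: field_simps)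
      also have "\<dots> < (\<epsilon>/4)\<^sup>2" using F by (simp add: \<delta>_def power2_eq_square)
      finally have sq: "sqrt (real (card T) / real (card J)) < \<epsilon> / 4"
        using F by (intro real_less_lsqrt) auto
      have near: "\<tau> (g \<otimes>\<^bsub>\<Gamma>\<^esub> h) j = (\<tau> g \<circ> \<tau> h) j \<and>
          d (f (z \<otimes>\<^bsub>?SD\<^esub> w) j) (f z (\<tau> h j) \<otimes>\<^bsub>G\<^esub> f w j) \<le> \<epsilon> / 2" if j: "j \<in> J - T" for j
      proof (cases "snd j")
        case True
        have "i1 (\<sigma> g) \<otimes>\<^bsub>G\<^esub> i1 (\<sigma> h) = i1 (\<sigma> g \<otimes>\<^bsub>G1\<^esub> \<sigma> h)"
          using i1(1) gh \<sigma>(1) by (auto simp: hom_def Pi_iff)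
        moreover have "d (i1 (\<sigma> (g \<otimes>\<^bsub>\<Gamma>\<^esub> h))) (i1 (\<sigma> g \<otimes>\<^bsub>G1\<^esub> \<sigma> h)) \<le> \<epsilon> / 2"
        proof (rule le1)
          show "\<sigma> g \<otimes>\<^bsub>G1\<^esub> \<sigma> h \<in> carrier G1" 
            using \<sigma>(1) gh groups[OF G1] by (simp add: Pi_iff group.is_monoid monoid.m_closed)
          show "d1 (\<sigma> (g \<otimes>\<^bsub>\<Gamma>\<^esub> h)) (\<sigma> g \<otimes>\<^bsub>G1\<^esub> \<sigma> h) \<le> \<epsilon> / 2"
            using \<sigma>(3) gh unfolding almost_multiplicative_def by force
        qed (use \<sigma>(1) gh F in auto)
        ultimately show ?thesis using True by (simp add: \<tau>_def f_def zwe) (simp add: z w)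
      next
        case False
        then obtain s where s: "j = (s, False)" "s \<in> A" using j by (auto simp: J_def)
        then have sT: "s \<notin> T1" "s \<notin> T2" "s \<notin> T3" using j by (auto simp: T_def)
        let ?t = "\<phi> (g \<otimes>\<^bsub>\<Gamma>\<^esub> h) s"
        have t: "?t = \<phi> g (\<phi> h s)" "\<phi> h s \<in> S" "?t \<in> S" "?t \<in> A" "\<phi> h s \<in> A"
          using sT s \<phi>_in gh by (auto simp: T1_def T2_def T3_def)
        \<comment> \<open>\<open>equi\<close> is applied at the point \<phi>(h)s, which \<phi>(g)
          carries to t; this is why \<open>T1\<close>, \<open>T2\<close> and \<open>T3\<close> had
          to be removed.\<close>
        have e: "C ?t (\<theta> g y) = C (\<phi> h s) y"
          using equi[of g y "\<phi> h s"] t gh xy by (simp add: C_def)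
        have "d (i2 (\<psi> (C ?t (x \<otimes>\<^bsub>N\<^esub> \<theta> g y)))) (i2 (\<psi> (C ?t x) \<otimes>\<^bsub>G2\<^esub> \<psi> (C (\<phi> h s) y))) \<le> \<epsilon> / 2"
        proof (rule le2)
          have m: "C ?t (x \<otimes>\<^bsub>N\<^esub> \<theta> g y) = C ?t x \<otimes>\<^bsub>N\<^esub> C (\<phi> h s) y"
            using C_mult \<theta> e t xy gh by simp
          have "C ?t x \<in> F\<^sub>N" "C (\<phi> h s) y \<in> F\<^sub>N" "C ?t (x \<otimes>\<^bsub>N\<^esub> \<theta> g y) \<in> F\<^sub>N"
            using t xy by (auto simp: F\<^sub>N_def)
          then show "d2 (\<psi> (C ?t (x \<otimes>\<^bsub>N\<^esub> \<theta> g y))) (\<psi> (C ?t x) \<otimes>\<^bsub>G2\<^esub> \<psi> (C (\<phi> h s) y)) \<le> \<epsilon> / 2"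
            using \<psi>(3) unfolding m almost_multiplicative_def by force
          show "\<psi> (C ?t x) \<otimes>\<^bsub>G2\<^esub> \<psi> (C (\<phi> h s) y) \<in> carrier G2" 
            using \<psi>(1) C_closed t xy groups[OF G2] by (simp add: Pi_iff group.is_monoid monoid.m_closed)
          show "\<psi> (C ?t (x \<otimes>\<^bsub>N\<^esub> \<theta> g y)) \<in> carrier G2"
            using \<psi>(1) C_closed t \<theta> xy gh by (simp add: Pi_iff)
        qed (use F in auto)
        moreover have "i2 (\<psi> (C ?t x) \<otimes>\<^bsub>G2\<^esub> \<psi> (C (\<phi> h s) y)) = i2 (\<psi> (C ?t x)) \<otimes>\<^bsub>G\<^esub> i2 (\<psi> (C (\<phi> h s) y))"
          using i2(1) \<psi>(1) C_closed t xy by (auto simp: hom_def Pi_iff)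
        ultimately show ?thesis using t by (simp add: \<tau>_def f_def zwe s) (simp add: z w)
      qed
      have cz: "g = snd z" "h = snd w" by (simp_all add: z w)
      have comp: "f z \<circ> \<tau> h \<in> J \<rightarrow> carrier G"
        using f_in[OF carr(1)] bij_betw_imp_funcset[OF \<tau>_bij[OF gh(5)]] by (auto simp: Pi_iff)
      have "(\<lambda>j. f z (\<tau> h j) \<otimes>\<^bsub>G\<^esub> f w j) \<in> J \<rightarrow> carrier G" 
        using comp f_in[OF carr(2)] groups[OF G] by (auto simp: Pi_iff group.is_monoid monoid.m_closed)
      moreover have "bij_betw (\<tau> g \<circ> \<tau> h) J J" using \<tau>_bij gh bij_betw_trans by blast
      ultimately have "D (\<omega> (f (z \<otimes>\<^bsub>?SD\<^esub> w)) (\<tau> (g \<otimes>\<^bsub>\<Gamma>\<^esub> h))) 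
          (\<omega> (\<lambda>j. f z (\<tau> h j) \<otimes>\<^bsub>G\<^esub> f w j) (\<tau> g \<circ> \<tau> h)) \<le> \<epsilon> / 2 + 2 * sqrt (real (card T) / real (card J))"
        using T F(3) near by (intro \<omega>'(4)[OF carr(3)] \<Gamma>.m_closed gh) auto
      also have "\<dots> < \<epsilon>" using sq by simp
      also have "\<omega> (\<lambda>j. f z (\<tau> h j) \<otimes>\<^bsub>G\<^esub> f w j) (\<tau> g \<circ> \<tau> h) = \<Theta> z \<otimes>\<^bsub>W\<^esub> \<Theta> w"
        unfolding \<Theta>_def cz[symmetric] by (rule \<omega>'(3)[symmetric]) (use carr gh f_in \<tau>_bij in auto)
      also have "\<omega> (f (z \<otimes>\<^bsub>?SD\<^esub> w)) (\<tau> (g \<otimes>\<^bsub>\<Gamma>\<^esub> h)) = \<Theta> (z \<otimes>\<^bsub>?SD\<^esub> w)"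
        by (simp add: \<Theta>_def zwe)
      finally show "D (\<Theta> (z \<otimes>\<^bsub>?SD\<^esub> w)) (\<Theta> z \<otimes>\<^bsub>W\<^esub> \<Theta> w) < \<epsilon>" .
    qed
    moreover have "separating ?SD W D F (c / 4) \<Theta>"
      unfolding separating_def
    proof (intro ballI impI)
      fix z assume z: "z \<in> F" "z \<noteq> \<one>\<^bsub>?SD\<^esub>"
      have zc: "z \<in> carrier ?SD" "fst z \<in> carrier N" "snd z \<in> carrier \<Gamma>" using z F snd_in[of z] fst_in[of z] by blast+
      have zF: "fst z \<in> E" "snd z \<in> F\<^sub>\<Gamma>" using z by (auto simp: E_def F\<^sub>\<Gamma>_def)
      have one: "\<one>\<^bsub>?SD\<^esub> = (\<one>\<^bsub>N\<^esub>, \<one>\<^bsub>\<Gamma>\<^esub>)" by (simp add: semidirect_product_def)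
      \<comment> \<open>T is one of the two halves of J: the \<open>True\<close> half if g \<noteq>
        1, and the \<open>False\<close> half if g = 1, where \<tau> fixes every block because
        \<phi>(1) does.\<close>
      have "\<exists>T\<subseteq>J. card J \<le> 2 * card T \<and> (\<forall>j\<in>T. \<tau> (snd z) j = j \<and> d (f z j) \<one>\<^bsub>G\<^esub> > c / 2)"
      proof (cases "snd z = \<one>\<^bsub>\<Gamma>\<^esub>")
        case False
        then have "d1 (\<sigma> (snd z)) \<one>\<^bsub>G1\<^esub> > c" using \<sigma>(4) zF c by (force simp: separating_def)
        then have "d (i1 (\<sigma> (snd z))) \<one>\<^bsub>G\<^esub> > c / 2" using gt1 c zc \<sigma>(1) by auto
        then show ?thesis using J(3)
          by (intro exI[of _ "A \<times> {True}"]) (auto simp: J_def \<tau>_def f_def card_cartesian_product)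
      next
        case True
        then have "fst z \<noteq> \<one>\<^bsub>N\<^esub>" using z(2) one by (metis prod.collapse)
        have "d (i2 (\<psi> (C s (fst z)))) \<one>\<^bsub>G\<^esub> > c / 2" if "s \<in> A" for s
        proof (rule gt2)
          show "\<psi> (C s (fst z)) \<in> carrier G2" using \<psi>(1) C_closed that zc by auto
          have "C s (fst z) \<in> F\<^sub>N" using that zF by (auto simp: F\<^sub>N_def)
          then show "c < d2 (\<psi> (C s (fst z))) \<one>\<^bsub>G2\<^esub>"
            using \<psi>(4) C_ne[OF that zc(2) \<open>fst z \<noteq> \<one>\<^bsub>N\<^esub>\<close>] c by (force simp: separating_def)
        qed (use c in auto)
        then show ?thesis using J(3) True \<phi>(2)
          by (intro exI[of _ "A \<times> {False}"]) (auto simp: J_def \<tau>_def f_def card_cartesian_product)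
      qed
      then obtain T where "T \<subseteq> J" "card J \<le> 2 * card T" 
        "\<forall>j\<in>T. \<tau> (snd z) j = j \<and> d (f z j) \<one>\<^bsub>G\<^esub> > c / 2" by blast
      then have "D (\<omega> (f z) (\<tau> (snd z))) \<one>\<^bsub>W\<^esub> > (c / 2) / 2"
        using c(1) by (intro \<omega>'(5)[OF zc(1,3), of T]) auto
      then show "c / 4 < D (\<Theta> z) \<one>\<^bsub>W\<^esub>" by (simp add: \<Theta>_def)
    qed
    ultimately show ?thesis using W by blast
  qed
  then show ?thesis using SD c unfolding approximable_def
    by (intro conjI exI[of _ "c / 4"]) auto
qed

text \<open>All blocks are 1, so only the permutations \<tau> matter. On F they multiply exactly,
  which the continuity clause with empty T and \<eta> = 0 turns into distance at most 0; being free
  of fixed points, they keep distance 1/4 from 1 in every class.\<close>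

lemma approximable_locally_residually_finite:
  fixes N :: "('n, 'p) monoid_scheme" and \<G> :: "('h monoid \<times> 'h metric) set"
  assumes N: "group N" and wreath: "wreath_closed TYPE('i) \<G>" and ne: "(G, d) \<in> \<G>" "group G"
    and fin: "\<And>F. F \<subseteq> carrier N \<Longrightarrow> finite F \<Longrightarrow> \<exists>(J :: 'i set) \<tau>. finite J \<and> J \<noteq> {} \<and>
       (\<forall>g\<in>carrier N. bij_betw (\<tau> g) J J) \<and> (\<forall>j\<in>J. \<tau> \<one>\<^bsub>N\<^esub> j = j) \<and>
       (\<forall>g\<in>F. \<forall>h\<in>F. \<forall>j\<in>J. g \<otimes>\<^bsub>N\<^esub> h \<in> F \<longrightarrow> \<tau> (g \<otimes>\<^bsub>N\<^esub> h) j = \<tau> g (\<tau> h j)) \<and>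
       (\<forall>g\<in>F. \<forall>j\<in>J. g \<noteq> \<one>\<^bsub>N\<^esub> \<longrightarrow> \<tau> g j \<noteq> j)"
    and zero: "d \<one>\<^bsub>G\<^esub> \<one>\<^bsub>G\<^esub> \<le> 0"
  shows "approximable \<G> N"
proof -
  have "\<exists>(W, D)\<in>\<G>. \<exists>\<Theta>\<in>carrier N \<rightarrow> carrier W.
           unital N W \<Theta> \<and> almost_multiplicative N W D F \<epsilon> \<Theta> \<and> separating N W D F (1 / 4) \<Theta>"
    if F: "F \<subseteq> carrier N" "finite F" "\<epsilon> > 0" for F \<epsilon>
  proof -
    from fin[OF F(1,2)] obtain J :: "'i set" and \<tau> where J: "finite J" "J \<noteq> {}"
      and bij: "\<And>g. g \<in> carrier N \<Longrightarrow> bij_betw (\<tau> g) J J" and one: "\<And>j. j \<in> J \<Longrightarrow> \<tau> \<one>\<^bsub>N\<^esub> j = j"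
      and mult: "\<And>g h j. g \<in> F \<Longrightarrow> h \<in> F \<Longrightarrow> j \<in> J \<Longrightarrow> g \<otimes>\<^bsub>N\<^esub> h \<in> F \<Longrightarrow> \<tau> (g \<otimes>\<^bsub>N\<^esub> h) j = \<tau> g (\<tau> h j)"
      and free: "\<And>g j. g \<in> F \<Longrightarrow> j \<in> J \<Longrightarrow> g \<noteq> \<one>\<^bsub>N\<^esub> \<Longrightarrow> \<tau> g j \<noteq> j"
      apply (elim exE conjE)
      subgoal for J \<tau> by (rule that[of J \<tau>]) simp_all
      done
    from wreath_closedE[OF wreath ne(1) J]
    obtain W D \<omega> where W: "(W, D) \<in> \<G>" and \<omega>: "wreath_embeds J G d W D \<omega>"
      .
    let ?f = "\<lambda>_ :: 'i. \<one>\<^bsub>G\<^esub>"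
    have f1: "?f \<in> J \<rightarrow> carrier G" using ne(2) by (simp add: group.is_monoid)
    have ff: "(\<lambda>j. ?f j \<otimes>\<^bsub>G\<^esub> ?f j) = ?f" using ne(2) by (simp add: group.is_monoid)
    note \<omega>' = wreath_embedsD[OF \<omega> f1 bij]
    define \<Theta> where "\<Theta> g = \<omega> ?f (\<tau> g)" for g
    have "\<Theta> \<in> carrier N \<rightarrow> carrier W" using \<omega>'(1) by (auto simp: \<Theta>_def)
    moreover have "unital N W \<Theta>"
      using \<omega>'(2)[of "\<one>\<^bsub>N\<^esub>"] one N by (simp add: unital_def \<Theta>_def group.is_monoid)
    moreover have "separating N W D F (1 / 4) \<Theta>"
      unfolding separating_def \<Theta>_def
    proof (intro ballI impI)
      fix g assume "g \<in> F" "g \<noteq> \<one>\<^bsub>N\<^esub>"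
      then show "1 / 4 < D (\<omega> ?f (\<tau> g)) \<one>\<^bsub>W\<^esub>" using \<omega>'(6) free F(1) by blast
    qed
    moreover have "almost_multiplicative N W D F \<epsilon> \<Theta>"
      unfolding almost_multiplicative_def
    proof (intro ballI impI)
      fix g h assume gh: "g \<in> F" "h \<in> F" "g \<otimes>\<^bsub>N\<^esub> h \<in> F"
      then have c: "g \<in> carrier N" "h \<in> carrier N" "g \<otimes>\<^bsub>N\<^esub> h \<in> carrier N" using F by auto
      have b: "bij_betw (\<tau> g \<circ> \<tau> h) J J" using bij c bij_betw_trans by blast
      have near: "\<forall>j\<in>J - {}. \<tau> (g \<otimes>\<^bsub>N\<^esub> h) j = (\<tau> g \<circ> \<tau> h) j \<and> d \<one>\<^bsub>G\<^esub> \<one>\<^bsub>G\<^esub> \<le> 0"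
        using mult gh zero by auto
      have le: "D (\<omega> ?f (\<tau> (g \<otimes>\<^bsub>N\<^esub> h))) (\<omega> ?f (\<tau> g \<circ> \<tau> h)) \<le> 0 + 2 * sqrt (real (card ({} :: 'i set)) / real (card J))"
        by (rule \<omega>'(4)) (use near f1 b c in auto)
      have eq: "\<Theta> g \<otimes>\<^bsub>W\<^esub> \<Theta> h = \<omega> ?f (\<tau> g \<circ> \<tau> h)"
        using \<omega>'(3)[OF c(1) f1 bij[OF c(2)]] unfolding \<Theta>_def ff .
      have "D (\<Theta> (g \<otimes>\<^bsub>N\<^esub> h)) (\<Theta> g \<otimes>\<^bsub>W\<^esub> \<Theta> h) \<le> 0 + 2 * sqrt (real (card ({} :: 'i set)) / real (card J))"
        by (subst eq, subst \<Theta>_def, rule le)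
      then show "D (\<Theta> (g \<otimes>\<^bsub>N\<^esub> h)) (\<Theta> g \<otimes>\<^bsub>W\<^esub> \<Theta> h) < \<epsilon>"
        by (rule le_less_trans) (use F(3) in simp)
    qed
    ultimately show ?thesis using W by blast
  qed
  then show ?thesis using N unfolding approximable_def
    by (intro conjI exI[of _ "1 / 4"]) auto
qed

section \<open>Symmetric groups\<close>

lemma average_le:
  fixes \<delta> :: "'i \<Rightarrow> real"
  assumes J: "finite J" "J \<noteq> {}" and T: "T \<subseteq> J" and "\<eta> \<ge> 0"
    and le: "\<And>j. j \<in> J - T \<Longrightarrow> \<delta> j \<le> \<eta>" and M: "\<And>j. j \<in> J \<Longrightarrow> \<delta> j \<le> M" and "M \<ge> 0"
  shows "(\<Sum>j\<in>J. \<delta> j) / real (card J) \<le> \<eta> + M * (real (card T) / real (card J))"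
proof -
  have cJ: "real (card J) > 0" using J by (simp add: card_gt_0_iff)
  have "(\<Sum>j\<in>J. \<delta> j) \<le> (\<Sum>j\<in>J. \<eta> + (if j \<in> T then M else 0))"
    using le M T \<open>M \<ge> 0\<close> \<open>\<eta> \<ge> 0\<close> by (intro sum_mono) (auto intro: add_increasing)
  also have "\<dots> = \<eta> * card J + M * card T"
    using J T by (simp add: sum.distrib sum.If_cases Int_absorb1 mult.commute)
  finally show ?thesis using cJ by (simp add: field_simps)
qed

lemma less_average:
  fixes \<delta> :: "'i \<Rightarrow> real"
  assumes J: "finite J" "J \<noteq> {}" and T: "T \<subseteq> J" "card J \<le> 2 * card T" and "c > 0"
    and gt: "\<And>j. j \<in> T \<Longrightarrow> \<delta> j > c" and nn: "\<And>j. j \<in> J \<Longrightarrow> \<delta> j \<ge> 0"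
  shows "(\<Sum>j\<in>J. \<delta> j) / real (card J) > c / 2"
proof -
  have cJ: "card J > 0" using J by (simp add: card_gt_0_iff)
  then have "T \<noteq> {}" using T by auto
  have "c * card J \<le> 2 * (c * card T)" using T(2) \<open>c > 0\<close> by (simp flip: of_nat_mult)
  also have "c * card T = (\<Sum>j\<in>T. c)" by simp
  also have "\<dots> < (\<Sum>j\<in>T. \<delta> j)"
    using \<open>T \<noteq> {}\<close> gt finite_subset[OF T(1) J(1)] by (intro sum_strict_mono) auto
  also have "\<dots> \<le> (\<Sum>j\<in>J. \<delta> j)" using J T nn by (intro sum_mono2) auto
  finally show ?thesis using cJ by (simp add: field_simps)
qed

text \<open>Fits a linear error term into the square-root clause of \<open>wreath_embeds\<close>; t
  is a proportion of blocks.\<close>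

lemma le_two_sqrt: "0 \<le> t \<Longrightarrow> t \<le> 1 \<Longrightarrow> t \<le> 2 * sqrt t" for t :: real
  using real_le_rsqrt[of t t] mult_left_le[of t t] real_sqrt_ge_zero[of t]
  by (simp add: power2_eq_square)

text \<open>Serves the Hamming distance and the metrics on finite groups, where a displaced block
  counts exactly 1 and the others contribute their own distance. The rank distance is no such
  average, since the contributions of displaced blocks can overlap, and the Hilbert--Schmidt
  distance averages squares.\<close>

lemma wreath_embeds_averageI:
  assumes J: "finite J" "J \<noteq> {}" and "group G"
    and d: "\<And>x y. x \<in> carrier G \<Longrightarrow> y \<in> carrier G \<Longrightarrow> 0 \<le> d x y \<and> d x y \<le> 1"
    and closed: "\<And>f \<tau>. f \<in> J \<rightarrow> carrier G \<Longrightarrow> bij_betw \<tau> J J \<Longrightarrow> \<omega> f \<tau> \<in> carrier W"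
    and one: "\<And>f \<tau>. f \<in> J \<rightarrow> carrier G \<Longrightarrow> bij_betw \<tau> J J \<Longrightarrow>
        \<forall>j\<in>J. f j = \<one>\<^bsub>G\<^esub> \<and> \<tau> j = j \<Longrightarrow> \<omega> f \<tau> = \<one>\<^bsub>W\<^esub>"
    and mult: "\<And>f \<tau> f' \<tau>'. f \<in> J \<rightarrow> carrier G \<Longrightarrow> bij_betw \<tau> J J \<Longrightarrow> f' \<in> J \<rightarrow> carrier G \<Longrightarrow>
        bij_betw \<tau>' J J \<Longrightarrow> \<omega> f \<tau> \<otimes>\<^bsub>W\<^esub> \<omega> f' \<tau>' = \<omega> (\<lambda>j. f (\<tau>' j) \<otimes>\<^bsub>G\<^esub> f' j) (\<tau> \<circ> \<tau>')"
    and D: "\<And>f \<tau> f' \<tau>'. f \<in> J \<rightarrow> carrier G \<Longrightarrow> bij_betw \<tau> J J \<Longrightarrow> f' \<in> J \<rightarrow> carrier G \<Longrightarrow>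
        bij_betw \<tau>' J J \<Longrightarrow> D (\<omega> f \<tau>) (\<omega> f' \<tau>') =
          (\<Sum>j\<in>J. if \<tau> j = \<tau>' j then d (f j) (f' j) else 1) / real (card J)"
  shows "wreath_embeds J G d W D \<omega>"
  unfolding wreath_embeds_def
proof (intro ballI allI impI conjI)
  fix f :: "'a \<Rightarrow> 'b" and \<tau> :: "'a \<Rightarrow> 'a" assume f: "f \<in> J \<rightarrow> carrier G" and \<tau>: "bij_betw \<tau> J J"
  then show "\<omega> f \<tau> \<in> carrier W" by (rule closed)
  show "\<omega> f \<tau> = \<one>\<^bsub>W\<^esub>" if "\<forall>j\<in>J. f j = \<one>\<^bsub>G\<^esub> \<and> \<tau> j = j" using one f \<tau> that by blast
  have cJ: "card J > 0" using J by (simp add: card_gt_0_iff)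
  have 1: "(\<lambda>_. \<one>\<^bsub>G\<^esub>) \<in> J \<rightarrow> carrier G" using \<open>group G\<close> by (simp add: group.is_monoid)
  have D1: "D (\<omega> f \<tau>) \<one>\<^bsub>W\<^esub> = (\<Sum>j\<in>J. if \<tau> j = j then d (f j) \<one>\<^bsub>G\<^esub> else 1) / real (card J)"
    using D[OF f \<tau> 1 bij_betw_id] one[OF 1 bij_betw_id] by simp
  show "c / 2 < D (\<omega> f \<tau>) \<one>\<^bsub>W\<^esub>"
    if "T \<subseteq> J" "c > 0" "card J \<le> 2 * card T \<and> (\<forall>j\<in>T. \<tau> j = j \<and> c < d (f j) \<one>\<^bsub>G\<^esub>)" for T c
    unfolding D1 using that J d f 1 by (intro less_average[of J T]) (auto simp: Pi_iff)
  show "1 / 4 < D (\<omega> f \<tau>) \<one>\<^bsub>W\<^esub>" if "\<forall>j\<in>J. \<tau> j \<noteq> j"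
    unfolding D1 using that cJ by (simp cong: if_cong sum.cong)
  fix f' :: "'a \<Rightarrow> 'b" and \<tau>' :: "'a \<Rightarrow> 'a" assume f': "f' \<in> J \<rightarrow> carrier G" and \<tau>': "bij_betw \<tau>' J J"
  show "\<omega> f \<tau> \<otimes>\<^bsub>W\<^esub> \<omega> f' \<tau>' = \<omega> (\<lambda>j. f (\<tau>' j) \<otimes>\<^bsub>G\<^esub> f' j) (\<tau> \<circ> \<tau>')"
    by (rule mult[OF f \<tau> f' \<tau>'])
  show "D (\<omega> f \<tau>) (\<omega> f' \<tau>') \<le> \<eta> + 2 * sqrt (real (card T) / real (card J))"
    if T: "T \<subseteq> J" and "0 \<le> \<eta>" "\<forall>j\<in>J - T. \<tau> j = \<tau>' j \<and> d (f j) (f' j) \<le> \<eta>" for T \<eta>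
  proof -
    have "D (\<omega> f \<tau>) (\<omega> f' \<tau>') \<le> \<eta> + 1 * (real (card T) / real (card J))"
      unfolding D[OF f \<tau> f' \<tau>'] using that J d f f' by (intro average_le) (auto simp: Pi_iff)
    moreover have "real (card T) / real (card J) \<le> 1"
      using T J card_mono by (simp add: cJ)
    ultimately show ?thesis using le_two_sqrt[of "real (card T) / real (card J)"] by simp
  qed
qed

text \<open>Repeating x in m diagonal blocks carries dimension n into dimension nm, and dimension m
  reaches nm in the same way. In the block estimates T is then empty for the upper bound and all of
  J for the lower one.\<close>

lemma jointly_embeddable_indexed:
  fixes Q :: "nat \<Rightarrow> 'h monoid" and d :: "nat \<Rightarrow> 'h metric"
  assumes groups: "\<And>n. n \<ge> 1 \<Longrightarrow> group (Q n)"
    and wreath: "\<And>n (J :: nat set). n \<ge> 1 \<Longrightarrow> finite J \<Longrightarrow> J \<noteq> {} \<Longrightarrow>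
      \<exists>\<omega>. wreath_embeds J (Q n) (d n) (Q (n * card J)) (d (n * card J)) \<omega>"
  shows "jointly_embeddable {(Q n, d n) | n. n \<ge> 1}"
proof -
  have amplify: "\<exists>i\<in>hom (Q n) (Q (n * m)). i \<one>\<^bsub>Q n\<^esub> = \<one>\<^bsub>Q (n * m)\<^esub> \<and>
      (\<forall>x\<in>carrier (Q n). \<forall>y\<in>carrier (Q n). \<forall>\<eta>\<ge>0. d n x y \<le> \<eta> \<longrightarrow> d (n * m) (i x) (i y) \<le> \<eta>) \<and>
      (\<forall>x\<in>carrier (Q n). \<forall>c>0. d n x \<one>\<^bsub>Q n\<^esub> > c \<longrightarrow> d (n * m) (i x) \<one>\<^bsub>Q (n * m)\<^esub> > c / 2)"
    if nm: "n \<ge> 1" "m \<ge> 1" for n m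
  proof -
    let ?J = "{..<m}"
    have "?J \<noteq> {}" using \<open>m \<ge> 1\<close> by (auto simp: lessThan_empty_iff)
    then obtain \<omega> where "wreath_embeds ?J (Q n) (d n) (Q (n * card ?J)) (d (n * card ?J)) \<omega>"
      using wreath[OF nm(1) finite_lessThan] by blast
    then have \<omega>: "wreath_embeds ?J (Q n) (d n) (Q (n * m)) (d (n * m)) \<omega>" by simp
    have const: "(\<lambda>_. x) \<in> ?J \<rightarrow> carrier (Q n)" if "x \<in> carrier (Q n)" for x using that by simp
    note \<omega>' = wreath_embedsD[OF \<omega> const bij_betw_id]
    have one: "\<one>\<^bsub>Q n\<^esub> \<in> carrier (Q n)" using groups[OF nm(1)] by (simp add: group.is_monoid)
    show ?thesis
    proof (intro bexI[of _ "\<lambda>x. \<omega> (\<lambda>_. x) id"] conjI ballI allI impI)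
      show "\<omega> (\<lambda>_. \<one>\<^bsub>Q n\<^esub>) id = \<one>\<^bsub>Q (n * m)\<^esub>" using \<omega>'(2)[OF one] by simp
      show "(\<lambda>x. \<omega> (\<lambda>_. x) id) \<in> hom (Q n) (Q (n * m))"
      proof (rule homI)
        fix x y assume "x \<in> carrier (Q n)" "y \<in> carrier (Q n)"
        then show "\<omega> (\<lambda>_. x \<otimes>\<^bsub>Q n\<^esub> y) id = \<omega> (\<lambda>_. x) id \<otimes>\<^bsub>Q (n * m)\<^esub> \<omega> (\<lambda>_. y) id"
          using \<omega>'(3)[of x "\<lambda>_. y" id] by simp
      qed (use \<omega>'(1) in simp)
      show "d (n * m) (\<omega> (\<lambda>_. x) id) (\<omega> (\<lambda>_. y) id) \<le> \<eta>"
        if "x \<in> carrier (Q n)" "y \<in> carrier (Q n)" "\<eta> \<ge> 0" "d n x y \<le> \<eta>" for x y \<eta>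
        using \<omega>'(4)[of x "\<lambda>_. y" id "{}" \<eta>] that by simp
      show "d (n * m) (\<omega> (\<lambda>_. x) id) \<one>\<^bsub>Q (n * m)\<^esub> > c / 2"
        if "x \<in> carrier (Q n)" "c > 0" "d n x \<one>\<^bsub>Q n\<^esub> > c" for x c
        using \<omega>'(5)[of x ?J c] that by simp
    qed
  qed
  show ?thesis
    unfolding jointly_embeddable_def
  proof (clarify, goal_cases)
    case (1 G d1 G' d2 n m)
    obtain i where i: "i \<in> hom (Q n) (Q (n * m))" "i \<one>\<^bsub>Q n\<^esub> = \<one>\<^bsub>Q (n * m)\<^esub>"
      "\<forall>x\<in>carrier (Q n). \<forall>y\<in>carrier (Q n). \<forall>\<eta>\<ge>0. d n x y \<le> \<eta> \<longrightarrow> d (n * m) (i x) (i y) \<le> \<eta>"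
      "\<forall>x\<in>carrier (Q n). \<forall>c>0. d n x \<one>\<^bsub>Q n\<^esub> > c \<longrightarrow> d (n * m) (i x) \<one>\<^bsub>Q (n * m)\<^esub> > c / 2"
      using amplify[of n m] 1 by auto
    obtain i' where i': "i' \<in> hom (Q m) (Q (n * m))" "i' \<one>\<^bsub>Q m\<^esub> = \<one>\<^bsub>Q (n * m)\<^esub>"
      "\<forall>x\<in>carrier (Q m). \<forall>y\<in>carrier (Q m). \<forall>\<eta>\<ge>0. d m x y \<le> \<eta> \<longrightarrow> d (n * m) (i' x) (i' y) \<le> \<eta>"
      "\<forall>x\<in>carrier (Q m). \<forall>c>0. d m x \<one>\<^bsub>Q m\<^esub> > c \<longrightarrow> d (n * m) (i' x) \<one>\<^bsub>Q (n * m)\<^esub> > c / 2"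
      using amplify[of m n] 1 by (auto simp: mult.commute)
    have "n * m \<ge> 1" using 1 by simp
    then have "(Q (n * m), d (n * m)) \<in> {(Q n, d n) | n. n \<ge> 1}" by blast
    then show ?case
      by (rule bexI[rotated], unfold prod.case)
        (intro bexI[of _ i] bexI[of _ i'] conjI i i')
  qed
qed

lemma wreath_closed_indexed:
  fixes Q :: "nat \<Rightarrow> 'h monoid" and d :: "nat \<Rightarrow> 'h metric"
  assumes wreath: "\<And>n (J :: 'i set). n \<ge> 1 \<Longrightarrow> finite J \<Longrightarrow> J \<noteq> {} \<Longrightarrow>
      \<exists>\<omega>. wreath_embeds J (Q n) (d n) (Q (n * card J)) (d (n * card J)) \<omega>"
  shows "wreath_closed TYPE('i) {(Q n, d n) | n. n \<ge> 1}"
  unfolding wreath_closed_def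
proof (clarify, goal_cases)
  case (1 G e n J)
  obtain \<omega> where "wreath_embeds J (Q n) (d n) (Q (n * card J)) (d (n * card J)) \<omega>"
    using wreath[of n J] 1 by blast
  moreover have "(Q (n * card J), d (n * card J)) \<in> {(Q n, d n) | n. n \<ge> 1}"
    using 1 by (intro CollectI exI[of _ "n * card J"]) (auto simp: Suc_le_eq card_gt_0_iff)
  ultimately show ?case by blast
qed

section \<open>Block permutations and the Hamming distance\<close>

lemma hamming_conjugate:
  assumes e: "bij_betw e M N" and fg: "f \<in> M \<rightarrow> M" "g \<in> M \<rightarrow> M"
  shows "hamming N (\<lambda>y\<in>N. e (f (inv_into M e y))) (\<lambda>y\<in>N. e (g (inv_into M e y))) = hamming M f g"
proof -
  have inj: "inj_on e M" and im: "e ` M = N" using e by (auto simp: bij_betw_def)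
  have "{y \<in> N. (\<lambda>y\<in>N. e (f (inv_into M e y))) y = (\<lambda>y\<in>N. e (g (inv_into M e y))) y} = e ` {x \<in> M. f x = g x}"
    using inj fg by (auto simp: im[symmetric] Pi_iff inj_on_eq_iff)
  moreover have "card (e ` {x \<in> M. f x = g x}) = card {x \<in> M. f x = g x}"
    using inj by (intro card_image) (auto simp: inj_on_def)
  ultimately show ?thesis using bij_betw_same_card[OF e] by (simp add: hamming_def)
qed

lemma hamming_bounds:
  assumes "finite A"
  shows "0 \<le> hamming A f g \<and> hamming A f g \<le> 1"
proof -
  have "card {a \<in> A. f a = g a} \<le> card A" using assms by (intro card_mono) auto
  then show ?thesis using assms by (auto simp: hamming_def divide_le_eq_1)
qed

text \<open>This is the imprimitive action on J \<times> {1..n}, where (j, i) goes to (\<tau> j, f j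
  i), relabelled through \<open>e\<close>. Two such permutations can agree at (j, i) only if \<tau>
  j = \<sigma> j, so the points of agreement are counted block by block.\<close>

lemma BijGroup_wreath_embeds:
  fixes J :: "'i set"
  assumes n: "n \<ge> 1" and J: "finite J" "J \<noteq> {}"
  shows "\<exists>\<omega>. wreath_embeds J (BijGroup {1..n}) (hamming {1..n})
     (BijGroup {1..n * card J}) (hamming {1..n * card J}) \<omega>"
proof -
  let ?A = "{1..n}" and ?N = "{1..n * card J}"
  define M where "M = J \<times> {1..n}"
  have cM: "card M = n * card J" by (simp add: M_def card_cartesian_product)
  obtain e where e: "bij_betw e M ?N"
    using finite_same_card_bij[of M ?N] J cM by (auto simp: M_def)
  define w where "w f \<tau> x = (\<tau> (fst x), f (fst x) (snd x))" for f :: "'i \<Rightarrow> nat \<Rightarrow> nat" and \<tau> :: "'i \<Rightarrow> 'i" and x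
  define \<omega> where "\<omega> f \<tau> = (\<lambda>y\<in>?N. e (w f \<tau> (inv_into M e y)))" for f \<tau>
  have inj: "inj_on e M" and im: "e ` M = ?N" using e by (auto simp: bij_betw_def)
  have carr: "carrier (BijGroup A) = Bij A" for A :: "nat set" by (simp add: BijGroup_def)
  have fM: "finite M" using J by (simp add: M_def)
  have w_in: "w f \<tau> \<in> M \<rightarrow> M" if "f \<in> J \<rightarrow> Bij ?A" "bij_betw \<tau> J J" for f \<tau>
  proof
    fix x assume "x \<in> M"
    then have x: "fst x \<in> J" "snd x \<in> ?A" by (auto simp: M_def)
    have "\<tau> (fst x) \<in> J" using bij_betw_imp_funcset[OF that(2)] x(1) by (rule funcset_mem)
    moreover have "f (fst x) (snd x) \<in> ?A"
      using Bij_imp_funcset[OF funcset_mem[OF that(1) x(1)]] x(2) by (rule funcset_mem)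
    ultimately show "w f \<tau> x \<in> M" by (simp add: w_def M_def)
  qed
  have w_bij: "bij_betw (w f \<tau>) M M" if "f \<in> J \<rightarrow> Bij ?A" "bij_betw \<tau> J J" for f \<tau>
  proof -
    have "inj_on (w f \<tau>) M"
    proof (rule inj_onI)
      fix x y assume "x \<in> M" "y \<in> M" and eq: "w f \<tau> x = w f \<tau> y"
      then have xy: "fst x \<in> J" "fst y \<in> J" "snd x \<in> ?A" "snd y \<in> ?A" by (auto simp: M_def)
      have fst_eq: "fst x = fst y"
        using eq xy inj_onD[OF bij_betw_imp_inj_on[OF that(2)]] by (simp add: w_def)
      have "inj_on (f (fst x)) ?A"
        using funcset_mem[OF that(1) xy(1)] by (simp add: Bij_def bij_betw_def)
      then have "snd x = snd y" using eq xy fst_eq by (auto simp: w_def dest: inj_onD)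
      with fst_eq show "x = y" by (rule prod_eqI)
    qed
    then show ?thesis using w_in[OF that] fM by (simp add: bij_betw_def endo_inj_surj image_subset_iff_funcset)
  qed
  have \<omega>_e: "\<omega> f \<tau> (e x) = e (w f \<tau> x)" if "x \<in> M" for f \<tau> x
    using that inj im by (auto simp: \<omega>_def)
  have \<omega>_Bij: "\<omega> f \<tau> \<in> Bij ?N" if "f \<in> J \<rightarrow> Bij ?A" "bij_betw \<tau> J J" for f \<tau>
  proof -
    have "bij_betw (e \<circ> w f \<tau> \<circ> inv_into M e) ?N ?N"
      using bij_betw_trans[OF bij_betw_trans[OF bij_betw_inv_into[OF e] w_bij[OF that]] e]
      by (simp add: comp_assoc)
    also have "bij_betw (e \<circ> w f \<tau> \<circ> inv_into M e) ?N ?N = bij_betw (\<omega> f \<tau>) ?N ?N"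
      by (rule bij_betw_cong) (simp add: \<omega>_def)
    finally show ?thesis by (simp add: Bij_def \<omega>_def)
  qed
  have "wreath_embeds J (BijGroup ?A) (hamming ?A) (BijGroup ?N) (hamming ?N) \<omega>"
  proof (rule wreath_embeds_averageI)
    show "group (BijGroup ?A)" by (rule group_BijGroup)
    show "0 \<le> hamming ?A x y \<and> hamming ?A x y \<le> 1" for x y by (rule hamming_bounds) simp
    fix f \<tau> assume f: "f \<in> J \<rightarrow> carrier (BijGroup ?A)" and \<tau>: "bij_betw \<tau> J J"
    note f' = f[unfolded carr]
    show "\<omega> f \<tau> \<in> carrier (BijGroup ?N)" using \<omega>_Bij[OF f' \<tau>] by (simp add: carr)
    show "\<omega> f \<tau> = \<one>\<^bsub>BijGroup ?N\<^esub>" if "\<forall>j\<in>J. f j = \<one>\<^bsub>BijGroup ?A\<^esub> \<and> \<tau> j = j"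
    proof -
      have "w f \<tau> x = x" if "x \<in> M" for x
        using that \<open>\<forall>j\<in>J. _\<close> by (auto simp: w_def M_def BijGroup_def)
      then have "e (w f \<tau> (inv_into M e y)) = y" if "y \<in> ?N" for y
        using that im by (metis f_inv_into_f inv_into_into)
      then show ?thesis by (auto simp: \<omega>_def BijGroup_def intro!: restrict_ext)
    qed
    fix g \<sigma> assume g: "g \<in> J \<rightarrow> carrier (BijGroup ?A)" and \<sigma>: "bij_betw \<sigma> J J"
    note g' = g[unfolded carr]
    show "\<omega> f \<tau> \<otimes>\<^bsub>BijGroup ?N\<^esub> \<omega> g \<sigma> = \<omega> (\<lambda>j. f (\<sigma> j) \<otimes>\<^bsub>BijGroup ?A\<^esub> g j) (\<tau> \<circ> \<sigma>)"
    proof -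
      have "\<omega> f \<tau> \<otimes>\<^bsub>BijGroup ?N\<^esub> \<omega> g \<sigma> = compose ?N (\<omega> f \<tau>) (\<omega> g \<sigma>)"
        using \<omega>_Bij[OF f' \<tau>] \<omega>_Bij[OF g' \<sigma>] by (simp add: BijGroup_def)
      also have "\<dots> = \<omega> (\<lambda>j. f (\<sigma> j) \<otimes>\<^bsub>BijGroup ?A\<^esub> g j) (\<tau> \<circ> \<sigma>)"
      proof (rule extensionalityI[of _ ?N])
        fix y assume "y \<in> ?N"
        then obtain x where x: "x \<in> M" "y = e x" using im by blast
        have "fst x \<in> J" "snd x \<in> ?A" using x by (auto simp: M_def)
        moreover from this have "\<sigma> (fst x) \<in> J" using \<sigma> by (auto simp: bij_betw_def)
        ultimately have "(f (\<sigma> (fst x)) \<otimes>\<^bsub>BijGroup ?A\<^esub> g (fst x)) (snd x) = f (\<sigma> (fst x)) (g (fst x) (snd x))"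
          using f' g' by (simp add: BijGroup_def Pi_iff compose_def)
        moreover have "w g \<sigma> x \<in> M" using w_in[OF g' \<sigma>] x by auto
        ultimately show "compose ?N (\<omega> f \<tau>) (\<omega> g \<sigma>) y = \<omega> (\<lambda>j. f (\<sigma> j) \<otimes>\<^bsub>BijGroup ?A\<^esub> g j) (\<tau> \<circ> \<sigma>) y"
          using x im \<open>y \<in> ?N\<close> by (simp add: compose_def \<omega>_e) (simp add: w_def)
      qed (auto simp: \<omega>_def compose_def)
      finally show ?thesis .
    qed
    have 1: "hamming ?N (\<omega> f \<tau>) (\<omega> g \<sigma>) = hamming M (w f \<tau>) (w g \<sigma>)"
      using hamming_conjugate[OF e w_in[OF f' \<tau>] w_in[OF g' \<sigma>]] by (simp only: \<omega>_def)
    have "{x \<in> M. w f \<tau> x = w g \<sigma> x} = (SIGMA j:J. {i \<in> ?A. \<tau> j = \<sigma> j \<and> f j i = g j i})"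
      by (auto simp: M_def w_def)
    then have 2: "hamming M (w f \<tau>) (w g \<sigma>) =
        1 - (\<Sum>j\<in>J. real (card {i \<in> ?A. \<tau> j = \<sigma> j \<and> f j i = g j i})) / (n * card J)"
      using J by (simp add: hamming_def cM card_SigmaI)
    have "hamming ?N (\<omega> f \<tau>) (\<omega> g \<sigma>) = (\<Sum>j\<in>J. 1 - real (card {i \<in> ?A. \<tau> j = \<sigma> j \<and> f j i = g j i}) / n) / card J"
      unfolding 1 2 using n J by (simp add: sum_subtractf diff_divide_distrib sum_divide_distrib)
    also have "\<dots> = (\<Sum>j\<in>J. if \<tau> j = \<sigma> j then hamming ?A (f j) (g j) else 1) / card J"
      by (intro arg_cong2[of _ _ _ _ "(/)"] sum.cong) (auto simp: hamming_def)
    finally show "hamming ?N (\<omega> f \<tau>) (\<omega> g \<sigma>) =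
        (\<Sum>j\<in>J. if \<tau> j = \<sigma> j then hamming ?A (f j) (g j) else 1) / real (card J)" .
  qed (use J in auto)
  then show ?thesis by blast
qed

section \<open>Finite groups with bi-invariant metrics\<close>

definition finite_metric_groups :: "(nat monoid \<times> nat metric) set" where
  "finite_metric_groups = {(G :: nat monoid, d). group G \<and> finite (carrier G) \<and>
        Metric_space (carrier G) d \<and> bi_invariant G d \<and>
        (SUP (x, y)\<in>carrier G \<times> carrier G. d x y) = 1}"

text \<open>On a finite set the supremum is a maximum, so diameter one splits into a bound and a
  pair that attains it.\<close>

lemma SUP_eq_1_iff:
  fixes d :: "'h metric"
  assumes "finite A" "A \<noteq> {}"
  shows "(SUP (x, y)\<in>A \<times> A. d x y) = 1 \<longleftrightarrow> (\<forall>x\<in>A. \<forall>y\<in>A. d x y \<le> 1) \<and> (\<exists>x\<in>A. \<exists>y\<in>A. d x y = 1)"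
proof -
  let ?B = "(\<lambda>(x, y). d x y) ` (A \<times> A)"
  have B: "finite ?B" "?B \<noteq> {}" using assms by auto
  have "Sup ?B = Max ?B" using B by (rule cSup_eq_Max)
  then have "Sup ?B = 1 \<longleftrightarrow> 1 \<in> ?B \<and> (\<forall>b\<in>?B. b \<le> 1)"
    using Max_eq_iff[OF B, of 1] by simp
  also have "1 \<in> ?B \<longleftrightarrow> (\<exists>x\<in>A. \<exists>y\<in>A. d x y = 1)"
    by (auto simp: image_iff)
  also have "(\<forall>b\<in>?B. b \<le> 1) \<longleftrightarrow> (\<forall>x\<in>A. \<forall>y\<in>A. d x y \<le> 1)" by simp
  finally show ?thesis by blast
qed

lemma finite_metric_groups_iff:
  "(G, d) \<in> finite_metric_groups \<longleftrightarrow> group G \<and> finite (carrier G) \<and>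
     Metric_space (carrier G) d \<and> bi_invariant G d \<and>
     (\<forall>x\<in>carrier G. \<forall>y\<in>carrier G. d x y \<le> 1) \<and> (\<exists>x\<in>carrier G. \<exists>y\<in>carrier G. d x y = 1)"
proof -
  have "carrier G \<noteq> {}" if "group G" using that group.is_monoid monoid.one_closed by blast
  then show ?thesis
    using SUP_eq_1_iff[of "carrier G" d] unfolding finite_metric_groups_def by auto
qed

lemma finite_metric_groupsD:
  assumes "(G, d) \<in> finite_metric_groups"
  shows "group G" "finite (carrier G)" "Metric_space (carrier G) d" "bi_invariant G d"
    "\<forall>x\<in>carrier G. \<forall>y\<in>carrier G. d x y \<le> 1" "\<exists>x\<in>carrier G. \<exists>y\<in>carrier G. d x y = 1"
  using assms unfolding finite_metric_groups_iff by blast+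

text \<open>Direct and wreath products live on types of pairs and functions, whereas the class only
  contains groups of natural numbers; an injective numbering transports multiplication and
  metric.\<close>

lemma finite_metric_group_nat_copy:
  fixes H :: "'h monoid"
  assumes H: "group H" "finite (carrier H)" "Metric_space (carrier H) D" "bi_invariant H D"
    and D: "\<forall>x\<in>carrier H. \<forall>y\<in>carrier H. D x y \<le> 1"
    and D1: "\<exists>x\<in>carrier H. \<exists>y\<in>carrier H. D x y = 1"
  shows "\<exists>(G, d)\<in>finite_metric_groups. \<exists>e\<in>hom H G. e \<one>\<^bsub>H\<^esub> = \<one>\<^bsub>G\<^esub> \<and>
    (\<forall>x\<in>carrier H. \<forall>y\<in>carrier H. d (e x) (e y) = D x y)"
proof -
  interpret H: group H by fact
  interpret D: Metric_space "carrier H" D by fact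
  obtain e :: "'h \<Rightarrow> nat" where e: "inj_on e (carrier H)"
    using finite_imp_inj_to_nat_seg[OF H(2)] by blast
  let ?i = "inv_into (carrier H) e"
  define G where "G = \<lparr>carrier = e ` carrier H, monoid.mult = (\<lambda>x y. e (?i x \<otimes>\<^bsub>H\<^esub> ?i y)), one = e \<one>\<^bsub>H\<^esub>\<rparr>"
  define d where "d = (\<lambda>x y. D (?i x) (?i y))"
  have carr: "carrier G = e ` carrier H" and one: "\<one>\<^bsub>G\<^esub> = e \<one>\<^bsub>H\<^esub>" by (simp_all add: G_def)
  have mult: "e x \<otimes>\<^bsub>G\<^esub> e y = e (x \<otimes>\<^bsub>H\<^esub> y)" if "x \<in> carrier H" "y \<in> carrier H" for x y
    using that e by (simp add: G_def)
  have d: "d (e x) (e y) = D x y" if "x \<in> carrier H" "y \<in> carrier H" for x y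
    using that e by (simp add: d_def)
  have "group G"
  proof (rule groupI)
    fix x assume "x \<in> carrier G"
    then obtain a where a: "x = e a" "a \<in> carrier H" by (auto simp: carr)
    show "\<exists>y\<in>carrier G. y \<otimes>\<^bsub>G\<^esub> x = \<one>\<^bsub>G\<^esub>"
      by (rule bexI[of _ "e (inv\<^bsub>H\<^esub> a)"]) (use a in \<open>simp_all add: mult one carr\<close>)
    show "\<one>\<^bsub>G\<^esub> \<otimes>\<^bsub>G\<^esub> x = x" using a by (simp add: mult one)
  qed (auto simp: carr one mult H.m_assoc)
  moreover have "Metric_space (carrier G) d"
  proof
    fix x y show "0 \<le> d x y" "d x y = d y x" by (simp_all add: d_def D.commute)
  next
    fix x y assume "x \<in> carrier G" "y \<in> carrier G"
    then show "d x y = 0 \<longleftrightarrow> x = y" using e by (auto simp: carr d inj_on_eq_iff)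
  next
    fix x y z assume "x \<in> carrier G" "y \<in> carrier G" "z \<in> carrier G"
    then show "d x z \<le> d x y + d y z" using D.triangle by (auto simp: carr d)
  qed
  moreover have "bi_invariant G d"
    using H(4) by (auto simp: bi_invariant_def carr mult d)
  moreover have "\<forall>x\<in>carrier G. \<forall>y\<in>carrier G. d x y \<le> 1" using D by (simp add: carr d)
  moreover have "\<exists>x\<in>carrier G. \<exists>y\<in>carrier G. d x y = 1"
  proof -
    obtain x y where "x \<in> carrier H" "y \<in> carrier H" "D x y = 1" using D1 by blast
    then show ?thesis by (intro bexI[of _ "e x"] bexI[of _ "e y"]) (simp_all add: carr d)
  qed
  moreover have "finite (carrier G)" using H(2) by (simp add: carr)
  ultimately have "(G, d) \<in> finite_metric_groups" unfolding finite_metric_groups_iff by blast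
  moreover have "e \<in> hom H G" by (rule homI) (simp_all add: carr mult)
  then have "\<exists>e\<in>hom H G. e \<one>\<^bsub>H\<^esub> = \<one>\<^bsub>G\<^esub> \<and>
      (\<forall>x\<in>carrier H. \<forall>y\<in>carrier H. d (e x) (e y) = D x y)"
    by (rule bexI[rotated]) (simp add: one d)
  ultimately show ?thesis by (intro bexI[of _ "(G, d)"]) simp_all
qed

text \<open>The direct product with the maximum metric contains both factors isometrically, and its
  diameter is exactly 1 because this holds for each factor.\<close>

lemma jointly_embeddable_finite_metric_groups: "jointly_embeddable finite_metric_groups"
proof -
  have "\<exists>(K, e)\<in>finite_metric_groups. \<exists>i\<in>hom G K. \<exists>i'\<in>hom G' K.
        i \<one>\<^bsub>G\<^esub> = \<one>\<^bsub>K\<^esub> \<and> i' \<one>\<^bsub>G'\<^esub> = \<one>\<^bsub>K\<^esub> \<and>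
        (\<forall>x\<in>carrier G. \<forall>y\<in>carrier G. e (i x) (i y) = d x y) \<and>
        (\<forall>x\<in>carrier G'. \<forall>y\<in>carrier G'. e (i' x) (i' y) = d' x y)"
    if Gd: "(G, d) \<in> finite_metric_groups" and Gd': "(G', d') \<in> finite_metric_groups" for G d G' d'
  proof -
    note G = finite_metric_groupsD[OF Gd] and G' = finite_metric_groupsD[OF Gd']
    obtain x1 y1 where x1: "x1 \<in> carrier G" "y1 \<in> carrier G" "d x1 y1 = 1" using G(6) by blast
    interpret G: group G by (rule G(1))
    interpret G': group G' by (rule G'(1))
    interpret d: Metric_space "carrier G" d by (rule G(3))
    interpret d': Metric_space "carrier G'" d' by (rule G'(3))
    define H where "H = G \<times>\<times> G'"
    define D where "D = (\<lambda>x y. max (d (fst x) (fst y)) (d' (snd x) (snd y)))"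
    have HM: "Metric_space (carrier H) D"
    proof
      fix x y show "0 \<le> D x y" "D x y = D y x" by (simp_all add: D_def d.commute d'.commute le_max_iff_disj)
    next
      fix x y assume "x \<in> carrier H" "y \<in> carrier H"
      then have xy: "fst x \<in> carrier G" "fst y \<in> carrier G" "snd x \<in> carrier G'" "snd y \<in> carrier G'"
        by (auto simp: H_def DirProd_def)
      have "D x y = 0 \<longleftrightarrow> d (fst x) (fst y) = 0 \<and> d' (snd x) (snd y) = 0"
        using d.nonneg[of "fst x" "fst y"] d'.nonneg[of "snd x" "snd y"] unfolding D_def by linarith
      then show "D x y = 0 \<longleftrightarrow> x = y" using xy by (simp add: prod_eq_iff)
    next
      fix x y z assume "x \<in> carrier H" "y \<in> carrier H" "z \<in> carrier H"
      then have "d (fst x) (fst z) \<le> d (fst x) (fst y) + d (fst y) (fst z)"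
        "d' (snd x) (snd z) \<le> d' (snd x) (snd y) + d' (snd y) (snd z)"
        by (auto simp: H_def DirProd_def intro!: d.triangle d'.triangle)
      then show "D x z \<le> D x y + D y z" unfolding D_def by linarith
    qed
    have HB: "bi_invariant H D"
      using G(4) G'(4) by (auto simp: bi_invariant_def H_def D_def)
    have "group H" "finite (carrier H)"
      using G G' by (auto simp: H_def DirProd_group)
    have HD: "\<forall>x\<in>carrier H. \<forall>y\<in>carrier H. D x y \<le> 1"
      using G(5) G'(5) by (simp add: D_def H_def)
    have H1: "\<exists>x\<in>carrier H. \<exists>y\<in>carrier H. D x y = 1"
      by (rule bexI[of _ "(x1, \<one>\<^bsub>G'\<^esub>)"], rule bexI[of _ "(y1, \<one>\<^bsub>G'\<^esub>)"])
        (use x1 in \<open>simp_all add: H_def D_def\<close>)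
    obtain K e i where K: "(K, e) \<in> finite_metric_groups" "i \<in> hom H K" "i \<one>\<^bsub>H\<^esub> = \<one>\<^bsub>K\<^esub>"
      and e: "\<forall>x\<in>carrier H. \<forall>y\<in>carrier H. e (i x) (i y) = D x y"
      using finite_metric_group_nat_copy[OF \<open>group H\<close> \<open>finite (carrier H)\<close> HM HB HD H1] by blast
    have "(\<lambda>x. i (x, \<one>\<^bsub>G'\<^esub>)) \<in> hom G K"
    proof (rule homI)
      fix x y assume "x \<in> carrier G" "y \<in> carrier G"
      then show "i (x \<otimes>\<^bsub>G\<^esub> y, \<one>\<^bsub>G'\<^esub>) = i (x, \<one>\<^bsub>G'\<^esub>) \<otimes>\<^bsub>K\<^esub> i (y, \<one>\<^bsub>G'\<^esub>)"
        using hom_mult[OF K(2), of "(x, \<one>\<^bsub>G'\<^esub>)" "(y, \<one>\<^bsub>G'\<^esub>)"] by (simp add: H_def)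
    qed (use K(2) in \<open>auto simp: hom_def H_def\<close>)
    moreover have "(\<lambda>x. i (\<one>\<^bsub>G\<^esub>, x)) \<in> hom G' K"
    proof (rule homI)
      fix x y assume "x \<in> carrier G'" "y \<in> carrier G'"
      then show "i (\<one>\<^bsub>G\<^esub>, x \<otimes>\<^bsub>G'\<^esub> y) = i (\<one>\<^bsub>G\<^esub>, x) \<otimes>\<^bsub>K\<^esub> i (\<one>\<^bsub>G\<^esub>, y)"
        using hom_mult[OF K(2), of "(\<one>\<^bsub>G\<^esub>, x)" "(\<one>\<^bsub>G\<^esub>, y)"] by (simp add: H_def)
    qed (use K(2) in \<open>auto simp: hom_def H_def\<close>)
    moreover have "e (i (x, \<one>\<^bsub>G'\<^esub>)) (i (y, \<one>\<^bsub>G'\<^esub>)) = d x y" if "x \<in> carrier G" "y \<in> carrier G" for x y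
      using e[rule_format, of "(x, \<one>\<^bsub>G'\<^esub>)" "(y, \<one>\<^bsub>G'\<^esub>)"] that by (simp add: H_def D_def)
    moreover have "e (i (\<one>\<^bsub>G\<^esub>, x)) (i (\<one>\<^bsub>G\<^esub>, y)) = d' x y" if "x \<in> carrier G'" "y \<in> carrier G'" for x y
      using e[rule_format, of "(\<one>\<^bsub>G\<^esub>, x)" "(\<one>\<^bsub>G\<^esub>, y)"] that by (simp add: H_def D_def)
    moreover have "i (\<one>\<^bsub>G\<^esub>, \<one>\<^bsub>G'\<^esub>) = \<one>\<^bsub>K\<^esub>" using K(3) by (simp add: H_def)
    ultimately show ?thesis
      using K(1) by (intro bexI[of _ "(K, e)"], unfold prod.case)
        (intro bexI[of _ "\<lambda>x. i (x, \<one>\<^bsub>G'\<^esub>)"] bexI[of _ "\<lambda>x. i (\<one>\<^bsub>G\<^esub>, x)"] conjI ballI)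
  qed
  note ex = this
  show ?thesis
    unfolding jointly_embeddable_def
  proof (clarify, goal_cases)
    case (1 G d G' d')
    then have one: "\<one>\<^bsub>G\<^esub> \<in> carrier G" "\<one>\<^bsub>G'\<^esub> \<in> carrier G'"
      by (simp_all add: finite_metric_groups_iff group.is_monoid)
    from ex[OF 1] obtain K e i i' where K: "(K, e) \<in> finite_metric_groups"
      "i \<in> hom G K" "i' \<in> hom G' K" "i \<one>\<^bsub>G\<^esub> = \<one>\<^bsub>K\<^esub>" "i' \<one>\<^bsub>G'\<^esub> = \<one>\<^bsub>K\<^esub>"
      and e: "\<forall>x\<in>carrier G. \<forall>y\<in>carrier G. e (i x) (i y) = d x y"
      and e': "\<forall>x\<in>carrier G'. \<forall>y\<in>carrier G'. e (i' x) (i' y) = d' x y"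
      by blast
    have "c / 2 < e (i x) \<one>\<^bsub>K\<^esub>" if "x \<in> carrier G" "c > 0" "c < d x \<one>\<^bsub>G\<^esub>" for x c
      using e one that K(4) by force
    moreover have "c / 2 < e (i' x) \<one>\<^bsub>K\<^esub>" if "x \<in> carrier G'" "c > 0" "c < d' x \<one>\<^bsub>G'\<^esub>" for x c
      using e' one that K(5) by force
    ultimately show ?case
      using K(1) by (intro bexI[of _ "(K, e)"], unfold prod.case)
        (intro bexI[OF _ K(2)] bexI[OF _ K(3)] conjI ballI allI impI K(4,5); simp add: e e')
  qed
qed

text \<open>The permutational wreath product. A pair (f, \<sigma>) stands for the monomial matrix
  with entry f j in position (\<sigma> j, j), whence the argument \<tau> j of f in the product.
  Extensional functions let the group laws hold as equations between functions.\<close>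

definition wreath_group :: "'i set \<Rightarrow> 'h monoid \<Rightarrow> (('i \<Rightarrow> 'h) \<times> ('i \<Rightarrow> 'i)) monoid" where
  "wreath_group J G =
     \<lparr>carrier = (J \<rightarrow>\<^sub>E carrier G) \<times> Bij J,
      monoid.mult = (\<lambda>(f, \<sigma>) (g, \<tau>). (\<lambda>j\<in>J. f (\<tau> j) \<otimes>\<^bsub>G\<^esub> g j, compose J \<sigma> \<tau>)),
      one = (\<lambda>j\<in>J. \<one>\<^bsub>G\<^esub>, \<lambda>j\<in>J. j)\<rparr>"

lemma group_wreath_group:
  assumes "group G"
  shows "group (wreath_group J G)"
proof -
  interpret G: group G by fact
  have Bij_in: "\<sigma> j \<in> J" if "\<sigma> \<in> Bij J" "j \<in> J" for \<sigma> j
    using Bij_imp_funcset[OF that(1)] that(2) by auto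
  show ?thesis
  proof (rule groupI)
    fix x y assume "x \<in> carrier (wreath_group J G)" "y \<in> carrier (wreath_group J G)"
    then show "x \<otimes>\<^bsub>wreath_group J G\<^esub> y \<in> carrier (wreath_group J G)"
      by (auto simp: wreath_group_def compose_Bij PiE_iff Bij_in)
  next
    show "\<one>\<^bsub>wreath_group J G\<^esub> \<in> carrier (wreath_group J G)"
      by (auto simp: wreath_group_def id_Bij)
  next
    fix x y z assume "x \<in> carrier (wreath_group J G)" "y \<in> carrier (wreath_group J G)"
      "z \<in> carrier (wreath_group J G)"
    then obtain f \<sigma> g \<tau> h \<rho> where x: "x = (f, \<sigma>)" "y = (g, \<tau>)" "z = (h, \<rho>)"
      and fgh: "f \<in> J \<rightarrow>\<^sub>E carrier G" "g \<in> J \<rightarrow>\<^sub>E carrier G" "h \<in> J \<rightarrow>\<^sub>E carrier G"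
      and b: "\<sigma> \<in> Bij J" "\<tau> \<in> Bij J" "\<rho> \<in> Bij J"
      by (auto simp: wreath_group_def)
    show "x \<otimes>\<^bsub>wreath_group J G\<^esub> y \<otimes>\<^bsub>wreath_group J G\<^esub> z =
        x \<otimes>\<^bsub>wreath_group J G\<^esub> (y \<otimes>\<^bsub>wreath_group J G\<^esub> z)"
      using fgh b unfolding x
      by (auto simp: wreath_group_def compose_def G.m_assoc Bij_in PiE_iff intro!: restrict_ext)
  next
    fix x assume "x \<in> carrier (wreath_group J G)"
    then obtain f \<sigma> where x: "x = (f, \<sigma>)" and f: "f \<in> J \<rightarrow>\<^sub>E carrier G" and b: "\<sigma> \<in> Bij J"
      by (auto simp: wreath_group_def)
    show "\<one>\<^bsub>wreath_group J G\<^esub> \<otimes>\<^bsub>wreath_group J G\<^esub> x = x"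
      using f b unfolding x
      by (auto simp: wreath_group_def compose_def Bij_in PiE_iff Bij_def extensional_def intro!: ext)
    define \<tau> where "\<tau> = restrict (inv_into J \<sigma>) J"
    have \<tau>: "\<tau> \<in> Bij J" using restrict_inv_into_Bij[OF b] by (simp add: \<tau>_def)
    have \<tau>\<sigma>: "\<tau> (\<sigma> j) = j" if "j \<in> J" for j
      using b that Bij_in[OF b that] by (auto simp: \<tau>_def Bij_def bij_betw_def)
    have "(\<lambda>j\<in>J. inv\<^bsub>G\<^esub> f (\<tau> j), \<tau>) \<otimes>\<^bsub>wreath_group J G\<^esub> x = \<one>\<^bsub>wreath_group J G\<^esub>"
      using f unfolding x
      by (auto simp: wreath_group_def compose_def Bij_in[OF b] \<tau>\<sigma> PiE_iff intro!: restrict_ext)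
    moreover have "(\<lambda>j\<in>J. inv\<^bsub>G\<^esub> f (\<tau> j), \<tau>) \<in> carrier (wreath_group J G)"
      using f \<tau> Bij_in[OF \<tau>] by (auto simp: wreath_group_def PiE_iff)
    ultimately show "\<exists>y\<in>carrier (wreath_group J G). y \<otimes>\<^bsub>wreath_group J G\<^esub> x = \<one>\<^bsub>wreath_group J G\<^esub>"
      by blast
  qed
qed

definition wreath_dist :: "'i set \<Rightarrow> 'h metric \<Rightarrow> (('i \<Rightarrow> 'h) \<times> ('i \<Rightarrow> 'i)) metric" where
  "wreath_dist J d = (\<lambda>(f, \<sigma>) (g, \<tau>). (\<Sum>j\<in>J. if \<sigma> j = \<tau> j then d (f j) (g j) else 1) / real (card J))"

text \<open>A displaced block counts 1, which bounds every distance in G. The triangle inequality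
  therefore holds in each block, whichever of the three positions coincide.\<close>

lemma Metric_space_wreath_dist:
  assumes J: "finite J" "J \<noteq> {}" and "Metric_space (carrier G) d"
    and le: "\<forall>x\<in>carrier G. \<forall>y\<in>carrier G. d x y \<le> 1"
  shows "Metric_space (carrier (wreath_group J G)) (wreath_dist J d)"
proof -
  interpret d: Metric_space "carrier G" d by fact
  have cJ: "real (card J) > 0" using J by (simp add: card_gt_0_iff)
  show ?thesis
  proof
    fix x y :: "('a \<Rightarrow> 'b) \<times> ('a \<Rightarrow> 'a)"
    show "0 \<le> wreath_dist J d x y"
      by (auto simp: wreath_dist_def split: prod.splits intro!: divide_nonneg_nonneg sum_nonneg)
    have "(\<Sum>j\<in>J. if snd x j = snd y j then d (fst x j) (fst y j) else 1) =
        (\<Sum>j\<in>J. if snd y j = snd x j then d (fst y j) (fst x j) else 1)"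
      by (intro sum.cong refl) (simp add: d.commute eq_commute)
    then show "wreath_dist J d x y = wreath_dist J d y x"
      by (simp add: wreath_dist_def case_prod_unfold)
  next
    fix x y assume "x \<in> carrier (wreath_group J G)" "y \<in> carrier (wreath_group J G)"
    then obtain f \<sigma> g \<tau> where x: "x = (f, \<sigma>)" "y = (g, \<tau>)"
      and fg: "f \<in> J \<rightarrow>\<^sub>E carrier G" "g \<in> J \<rightarrow>\<^sub>E carrier G" and b: "\<sigma> \<in> Bij J" "\<tau> \<in> Bij J"
      by (auto simp: wreath_group_def)
    have "wreath_dist J d x y = 0 \<longleftrightarrow> (\<Sum>j\<in>J. if \<sigma> j = \<tau> j then d (f j) (g j) else 1) = 0"
      using cJ by (simp add: x wreath_dist_def)
    also have "\<dots> \<longleftrightarrow> (\<forall>j\<in>J. (if \<sigma> j = \<tau> j then d (f j) (g j) else 1) = 0)"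
      using J by (intro sum_nonneg_eq_0_iff) auto
    also have "\<dots> \<longleftrightarrow> (\<forall>j\<in>J. \<sigma> j = \<tau> j \<and> f j = g j)"
      using fg by (auto simp: PiE_iff)
    also have "\<dots> \<longleftrightarrow> x = y"
      using fg b unfolding x by (auto simp: PiE_iff Bij_def intro: extensionalityI)
    finally show "wreath_dist J d x y = 0 \<longleftrightarrow> x = y" .
  next
    fix x y z assume "x \<in> carrier (wreath_group J G)" "y \<in> carrier (wreath_group J G)"
      "z \<in> carrier (wreath_group J G)"
    then obtain f \<sigma> g \<tau> h \<rho> where x: "x = (f, \<sigma>)" "y = (g, \<tau>)" "z = (h, \<rho>)"
      and fgh: "f \<in> J \<rightarrow>\<^sub>E carrier G" "g \<in> J \<rightarrow>\<^sub>E carrier G" "h \<in> J \<rightarrow>\<^sub>E carrier G"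
      by (auto simp: wreath_group_def)
    have "(\<Sum>j\<in>J. if \<sigma> j = \<rho> j then d (f j) (h j) else 1) \<le>
        (\<Sum>j\<in>J. (if \<sigma> j = \<tau> j then d (f j) (g j) else 1) + (if \<tau> j = \<rho> j then d (g j) (h j) else 1))"
    proof (rule sum_mono)
      fix j assume "j \<in> J"
      then have c: "f j \<in> carrier G" "g j \<in> carrier G" "h j \<in> carrier G" using fgh by auto
      show "(if \<sigma> j = \<rho> j then d (f j) (h j) else 1) \<le>
        (if \<sigma> j = \<tau> j then d (f j) (g j) else 1) + (if \<tau> j = \<rho> j then d (g j) (h j) else 1)"
        using d.triangle[OF c] d.nonneg[of "f j" "g j"] d.nonneg[of "g j" "h j"] bspec[OF bspec[OF le c(1)] c(3)] by auto
    qed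
    then show "wreath_dist J d x z \<le> wreath_dist J d x y + wreath_dist J d y z"
      using cJ unfolding x by (simp add: wreath_dist_def sum.distrib divide_right_mono flip: add_divide_distrib)
  qed
qed

text \<open>A left factor (h, \<rho>) does not change which blocks are displaced, because \<rho> is
  injective; a right factor permutes the summands by \<rho>.\<close>

lemma bi_invariant_wreath_dist:
  assumes "finite J" "group G" "bi_invariant G d"
  shows "bi_invariant (wreath_group J G) (wreath_dist J d)"
  unfolding bi_invariant_def
proof (intro ballI conjI)
  fix a x y assume "a \<in> carrier (wreath_group J G)" "x \<in> carrier (wreath_group J G)"
    "y \<in> carrier (wreath_group J G)"
  then obtain f \<sigma> g \<tau> h \<rho> where x: "a = (h, \<rho>)" "x = (f, \<sigma>)" "y = (g, \<tau>)"
    and fgh: "f \<in> J \<rightarrow>\<^sub>E carrier G" "g \<in> J \<rightarrow>\<^sub>E carrier G" "h \<in> J \<rightarrow>\<^sub>E carrier G"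
    and b: "\<sigma> \<in> Bij J" "\<tau> \<in> Bij J" "\<rho> \<in> Bij J"
    by (auto simp: wreath_group_def)
  have in_J: "\<sigma> j \<in> J" "\<tau> j \<in> J" "\<rho> j \<in> J" if "j \<in> J" for j
    using b that by (auto dest: Bij_imp_funcset)
  have \<rho>: "inj_on \<rho> J" "bij_betw \<rho> J J" using b by (auto simp: Bij_def bij_betw_def)
  have c: "f j \<in> carrier G" "g j \<in> carrier G" "h j \<in> carrier G" if "j \<in> J" for j using fgh that by auto
  have inv: "d (u \<otimes>\<^bsub>G\<^esub> v) (u \<otimes>\<^bsub>G\<^esub> w) = d v w" "d (v \<otimes>\<^bsub>G\<^esub> u) (w \<otimes>\<^bsub>G\<^esub> u) = d v w"
    if "u \<in> carrier G" "v \<in> carrier G" "w \<in> carrier G" for u v w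
    using assms(3) that by (auto simp: bi_invariant_def)
  show "wreath_dist J d (a \<otimes>\<^bsub>wreath_group J G\<^esub> x) (a \<otimes>\<^bsub>wreath_group J G\<^esub> y) = wreath_dist J d x y"
  proof -
    have "(\<Sum>j\<in>J. if compose J \<rho> \<sigma> j = compose J \<rho> \<tau> j
             then d ((\<lambda>j\<in>J. h (\<sigma> j) \<otimes>\<^bsub>G\<^esub> f j) j) ((\<lambda>j\<in>J. h (\<tau> j) \<otimes>\<^bsub>G\<^esub> g j) j) else 1) =
        (\<Sum>j\<in>J. if \<sigma> j = \<tau> j then d (f j) (g j) else 1)"
      using \<rho>(1) in_J c by (intro sum.cong refl) (auto simp: compose_def inv inj_on_eq_iff)
    then show ?thesis by (simp add: x wreath_dist_def wreath_group_def)
  qed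
  show "wreath_dist J d (x \<otimes>\<^bsub>wreath_group J G\<^esub> a) (y \<otimes>\<^bsub>wreath_group J G\<^esub> a) = wreath_dist J d x y"
  proof -
    have "(\<Sum>j\<in>J. if compose J \<sigma> \<rho> j = compose J \<tau> \<rho> j
             then d ((\<lambda>j\<in>J. f (\<rho> j) \<otimes>\<^bsub>G\<^esub> h j) j) ((\<lambda>j\<in>J. g (\<rho> j) \<otimes>\<^bsub>G\<^esub> h j) j) else 1) =
        (\<Sum>j\<in>J. if \<sigma> (\<rho> j) = \<tau> (\<rho> j) then d (f (\<rho> j)) (g (\<rho> j)) else 1)"
      using in_J c by (intro sum.cong refl) (auto simp: compose_def inv)
    also have "\<dots> = (\<Sum>j\<in>J. if \<sigma> j = \<tau> j then d (f j) (g j) else 1)"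
      by (rule sum.reindex_bij_betw[OF \<rho>(2)])
    finally show ?thesis by (simp add: x wreath_dist_def wreath_group_def)
  qed
qed

lemma wreath_closed_finite_metric_groups: "wreath_closed TYPE('i) finite_metric_groups"
  unfolding wreath_closed_def
proof (clarify, goal_cases)
  case (1 G d J)
  note G = finite_metric_groupsD[OF 1(1)] and le = finite_metric_groupsD(5)[OF 1(1)]
  obtain x1 y1 where x1: "x1 \<in> carrier G" "y1 \<in> carrier G" "d x1 y1 = 1" using G(6) by blast
  note J = 1(2,3)
  interpret G: group G by (rule G(1))
  interpret d: Metric_space "carrier G" d by (rule G(3))
  have cJ: "real (card J) > 0" using J by (simp add: card_gt_0_iff)
  have "finite (Bij J)"
  proof (rule finite_subset)
    show "Bij J \<subseteq> J \<rightarrow>\<^sub>E J" by (auto simp: Bij_def bij_betw_def PiE_def)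
  qed (use J in \<open>simp add: finite_PiE\<close>)
  then have fin: "finite (carrier (wreath_group J G))"
    using J G(2) by (simp add: wreath_group_def finite_PiE)
  have in_W: "(restrict f J, restrict \<tau> J) \<in> carrier (wreath_group J G)"
    if "f \<in> J \<rightarrow> carrier G" "bij_betw \<tau> J J" for f \<tau>
    using that bij_betw_cong[of J "restrict \<tau> J" \<tau> J] by (simp add: wreath_group_def Bij_def)
  have WD: "\<forall>x\<in>carrier (wreath_group J G). \<forall>y\<in>carrier (wreath_group J G). wreath_dist J d x y \<le> 1"
  proof (intro ballI)
    fix x y assume "x \<in> carrier (wreath_group J G)" "y \<in> carrier (wreath_group J G)"
    then obtain f \<sigma> g \<tau> where x: "x = (f, \<sigma>)" "y = (g, \<tau>)"
      and fg: "f \<in> J \<rightarrow>\<^sub>E carrier G" "g \<in> J \<rightarrow>\<^sub>E carrier G"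
      by (auto simp: wreath_group_def)
    have "(\<Sum>j\<in>J. if \<sigma> j = \<tau> j then d (f j) (g j) else 1) \<le> (\<Sum>j\<in>J. 1)"
      using fg le by (intro sum_mono) (auto simp: PiE_iff)
    then show "wreath_dist J d x y \<le> 1" using cJ by (simp add: x wreath_dist_def)
  qed
  \<comment> \<open>Constant families over a pair at distance 1 attain diameter 1.\<close>
  have "(restrict (\<lambda>_. x1) J, restrict id J) \<in> carrier (wreath_group J G)"
      "(restrict (\<lambda>_. y1) J, restrict id J) \<in> carrier (wreath_group J G)"
    by (intro in_W; use x1 in simp)+
  moreover have "wreath_dist J d (restrict (\<lambda>_. x1) J, restrict id J) (restrict (\<lambda>_. y1) J, restrict id J) = 1"
    using cJ x1 by (simp add: wreath_dist_def)
  ultimately have W1: "\<exists>x\<in>carrier (wreath_group J G). \<exists>y\<in>carrier (wreath_group J G). wreath_dist J d x y = 1"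
    by blast
  have "\<exists>(W, D)\<in>finite_metric_groups. \<exists>i\<in>hom (wreath_group J G) W. i \<one>\<^bsub>wreath_group J G\<^esub> = \<one>\<^bsub>W\<^esub> \<and>
    (\<forall>x\<in>carrier (wreath_group J G). \<forall>y\<in>carrier (wreath_group J G). D (i x) (i y) = wreath_dist J d x y)"
    by (rule finite_metric_group_nat_copy[OF group_wreath_group[OF G(1)] fin
        Metric_space_wreath_dist[OF J G(3) le] bi_invariant_wreath_dist[OF J(1) G(1,4)] WD W1])
  then obtain W D i where W: "(W, D) \<in> finite_metric_groups" "i \<in> hom (wreath_group J G) W"
      "i \<one>\<^bsub>wreath_group J G\<^esub> = \<one>\<^bsub>W\<^esub>"
    and D: "\<forall>x\<in>carrier (wreath_group J G). \<forall>y\<in>carrier (wreath_group J G).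
       D (i x) (i y) = wreath_dist J d x y"
    by blast
  define \<omega> where "\<omega> f \<tau> = i (restrict f J, restrict \<tau> J)" for f \<tau>
  have "wreath_embeds J G d W D \<omega>"
  proof (rule wreath_embeds_averageI[OF J G(1)])
    show "0 \<le> d x y \<and> d x y \<le> 1" if "x \<in> carrier G" "y \<in> carrier G" for x y using that le by simp
    fix f \<tau> assume f: "f \<in> J \<rightarrow> carrier G" and \<tau>: "bij_betw \<tau> J J"
    show "\<omega> f \<tau> \<in> carrier W" unfolding \<omega>_def by (rule hom_in_carrier[OF W(2) in_W[OF f \<tau>]])
    show "\<omega> f \<tau> = \<one>\<^bsub>W\<^esub>" if "\<forall>j\<in>J. f j = \<one>\<^bsub>G\<^esub> \<and> \<tau> j = j"
    proof -
      have "(restrict f J, restrict \<tau> J) = \<one>\<^bsub>wreath_group J G\<^esub>"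
        using that by (auto simp: wreath_group_def intro!: restrict_ext)
      then show ?thesis by (simp add: \<omega>_def W(3))
    qed
    fix f' \<tau>' assume f': "f' \<in> J \<rightarrow> carrier G" and \<tau>': "bij_betw \<tau>' J J"
    have \<tau>'_in: "\<tau>' j \<in> J" if "j \<in> J" for j using \<tau>' that by (auto simp: bij_betw_def)
    have "(restrict f J, restrict \<tau> J) \<otimes>\<^bsub>wreath_group J G\<^esub> (restrict f' J, restrict \<tau>' J) =
        (restrict (\<lambda>j. f (\<tau>' j) \<otimes>\<^bsub>G\<^esub> f' j) J, restrict (\<tau> \<circ> \<tau>') J)"
      by (auto simp: wreath_group_def compose_def \<tau>'_in intro!: restrict_ext)
    then show "\<omega> f \<tau> \<otimes>\<^bsub>W\<^esub> \<omega> f' \<tau>' = \<omega> (\<lambda>j. f (\<tau>' j) \<otimes>\<^bsub>G\<^esub> f' j) (\<tau> \<circ> \<tau>')"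
      unfolding \<omega>_def by (metis hom_mult[OF W(2) in_W[OF f \<tau>] in_W[OF f' \<tau>']])
    have "(\<Sum>j\<in>J. if restrict \<tau> J j = restrict \<tau>' J j then d (restrict f J j) (restrict f' J j) else 1) =
        (\<Sum>j\<in>J. if \<tau> j = \<tau>' j then d (f j) (f' j) else 1)"
      by (intro sum.cong refl) simp
    then show "D (\<omega> f \<tau>) (\<omega> f' \<tau>') = (\<Sum>j\<in>J. if \<tau> j = \<tau>' j then d (f j) (f' j) else 1) / real (card J)"
      unfolding \<omega>_def D[rule_format, OF in_W[OF f \<tau>] in_W[OF f' \<tau>']]
      by (simp only: wreath_dist_def prod.case)
  qed
  with W(1) show ?case by blast
qed

section \<open>Linear and unitary groups\<close>

text \<open>The rank is the largest size of such a set of columns; this replaces all block decompositions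
  of column spaces by manipulations of sums.\<close>

definition indep_cols :: "'k :: field mat \<Rightarrow> nat set \<Rightarrow> bool" where
  "indep_cols K I \<longleftrightarrow> I \<subseteq> {..<dim_col K} \<and>
     (\<forall>a. (\<forall>r<dim_row K. (\<Sum>y\<in>I. K $$ (r, y) * a y) = 0) \<longrightarrow> (\<forall>y\<in>I. a y = 0))"

lemma indep_colsD:
  "indep_cols K I \<Longrightarrow> (\<And>r. r < dim_row K \<Longrightarrow> (\<Sum>y\<in>I. K $$ (r, y) * a y) = 0) \<Longrightarrow> y \<in> I \<Longrightarrow> a y = 0"
  unfolding indep_cols_def by blast

lemma indep_cols_finite: "indep_cols K I \<Longrightarrow> finite I"
  unfolding indep_cols_def by (elim conjE) (rule finite_subset[OF _ finite_lessThan])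

lemma (in vec_space) card_indep_cols_le_rank:
  assumes K: "K \<in> carrier_mat n N" and I: "indep_cols K I"
  shows "card I \<le> rank K"
proof -
  have IN: "I \<subseteq> {..<N}" using I K by (simp add: indep_cols_def)
  have finI: "finite I" using I by (rule indep_cols_finite)
  have inj: "inj_on (col K) I"
  proof (rule inj_onI, rule ccontr)
    fix y z assume yz: "y \<in> I" "z \<in> I" "col K y = col K z" "y \<noteq> z"
    \<comment> \<open>\<open>indep_cols\<close> speaks of positions, not of vectors: equal columns
      in two positions would satisfy the relation with coefficients 1 and -1.\<close>
    define a where "a t = (if t = y then 1 else if t = z then - 1 else 0 :: 'a)" for t
    have "(\<Sum>t\<in>I. K $$ (r, t) * a t) = 0" if "r < dim_row K" for r
    proof -
      have "(\<Sum>t\<in>I. K $$ (r, t) * a t) = (\<Sum>t\<in>{y, z}. K $$ (r, t) * a t)"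
        by (rule sum.mono_neutral_right) (use finI yz in \<open>auto simp: a_def\<close>)
      also have "\<dots> = K $$ (r, y) - K $$ (r, z)" using yz by (simp add: a_def)
      also have "\<dots> = 0"
        using arg_cong[OF yz(3), of "\<lambda>v. v $ r"] that yz(1,2) IN K by (auto simp: subset_iff)
      finally show ?thesis .
    qed
    then have "a y = 0" by (rule indep_colsD[OF I _ yz(1)])
    then show False by (simp add: a_def)
  qed
  have sub: "col K ` I \<subseteq> set (cols K)" using IN K by (auto simp: cols_def)
  have carr: "col K ` I \<subseteq> carrier_vec n" using K by auto
  have "lin_indpt (col K ` I)"
  proof (rule finite_lin_indpt2)
    show "finite (col K ` I)" using finI by simp
    show "col K ` I \<subseteq> carrier_vec n" by (rule carr)
    fix a assume 0: "lincomb a (col K ` I) = 0\<^sub>v n"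
    have "(\<Sum>y\<in>I. K $$ (r, y) * a (col K y)) = 0" if r: "r < dim_row K" for r
    proof -
      have rn: "r < n" using r K by simp
      have "0 = lincomb a (col K ` I) $ r" using 0 rn by simp
      also have "\<dots> = (\<Sum>y\<in>I. a (col K y) * col K y $ r)"
        unfolding lincomb_index[OF rn carr] by (rule sum.reindex[OF inj, unfolded comp_def])
      also have "\<dots> = (\<Sum>y\<in>I. K $$ (r, y) * a (col K y))"
        using IN K r by (intro sum.cong) (auto simp: mult.commute subset_iff)
      finally show ?thesis by simp
    qed
    then have "a (col K y) = 0" if "y \<in> I" for y
      using indep_colsD[OF I, of "\<lambda>y. a (col K y)" y] that by blast
    then show "\<forall>v\<in>col K ` I. a v = 0" by simp
  qed
  then have "card (col K ` I) \<le> rank K" by (rule rank_ge_card_indpt[OF K sub])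
  then show ?thesis using card_image[OF inj] by simp
qed

text \<open>A maximal independent set of column vectors has as many elements as the rank; one
  position is chosen for each vector, so repeated columns cause no trouble.\<close>

lemma (in vec_space) indep_cols_exists:
  assumes K: "K \<in> carrier_mat n N"
  shows "\<exists>I. indep_cols K I \<and> card I = rank K"
proof -
  obtain S where S: "maximal S (\<lambda>T. T \<subseteq> set (cols K) \<and> lin_indpt T)"
    using maximal_exists[of "\<lambda>T. T \<subseteq> set (cols K) \<and> lin_indpt T" "card (set (cols K))" "{}"]
    by (meson List.finite_set card_mono empty_iff empty_subsetI finite_lin_indpt2 rev_finite_subset)
  then have SK: "S \<subseteq> set (cols K)" and ind: "lin_indpt S" by (simp_all add: maximal_def)
  have rank: "rank K = card S" by (rule rank_card_indpt[OF K S])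
  have finS: "finite S" using SK finite_subset by blast
  have carr: "S \<subseteq> carrier_vec n" using SK cols_dim[of K] K by blast
  have "\<forall>s\<in>S. \<exists>y<N. col K y = s" using SK K by (force simp: cols_def)
  then obtain y where y: "\<And>s. s \<in> S \<Longrightarrow> y s < N \<and> col K (y s) = s" by metis
  have inj: "inj_on y S" by (rule inj_onI) (metis y)
  have "indep_cols K (y ` S)"
    unfolding indep_cols_def
  proof (intro conjI allI impI)
    show "y ` S \<subseteq> {..<dim_col K}" using y K by auto
    fix a assume 0: "\<forall>r<dim_row K. (\<Sum>t\<in>y ` S. K $$ (r, t) * a t) = 0"
    have "lincomb (\<lambda>s. a (y s)) S = 0\<^sub>v n"
    proof (rule eq_vecI)
      show "dim_vec (lincomb (\<lambda>s. a (y s)) S) = dim_vec (0\<^sub>v n)" using lincomb_dim[OF finS carr] by simp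
      fix r assume "r < dim_vec (0\<^sub>v n :: 'a vec)"
      then have r: "r < n" by simp
      have "lincomb (\<lambda>s. a (y s)) S $ r = (\<Sum>s\<in>S. a (y s) * s $ r)" by (rule lincomb_index[OF r carr])
      also have "\<dots> = (\<Sum>s\<in>S. K $$ (r, y s) * a (y s))"
      proof (rule sum.cong[OF refl])
        fix s assume "s \<in> S"
        then have ys: "y s < N" "col K (y s) = s" using y by blast+
        then have "s $ r = K $$ (r, y s)" using index_col[of r K "y s"] r K by auto
        then show "a (y s) * s $ r = K $$ (r, y s) * a (y s)" by (simp add: mult.commute)
      qed
      also have "\<dots> = (\<Sum>t\<in>y ` S. K $$ (r, t) * a t)" by (rule sum.reindex[OF inj, unfolded comp_def, symmetric])
      also have "\<dots> = 0" using 0 r K by simp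
      finally show "lincomb (\<lambda>s. a (y s)) S $ r = 0\<^sub>v n $ r" using r by simp
    qed
    then have "(\<lambda>s. a (y s)) \<in> S \<rightarrow> {0}"
      using not_lindepD[OF ind finS subset_refl, of "\<lambda>s. a (y s)"] by simp
    then show "\<forall>t\<in>y ` S. a t = 0" by auto
  qed
  then show ?thesis using rank card_image[OF inj] by (intro exI[of _ "y ` S"]) simp
qed

lemma mat_mult_index: "A \<in> carrier_mat m m \<Longrightarrow> B \<in> carrier_mat m m \<Longrightarrow> i < m \<Longrightarrow> l < m \<Longrightarrow>
   (A * B) $$ (i, l) = (\<Sum>k<m. A $$ (i, k) * B $$ (k, l))" for m and A B :: "'k :: comm_ring_1 mat"
  by (simp add: scalar_prod_def atLeast0LessThan)

text \<open>Matrices with rows and columns indexed by \<open>J \<times> {..<n}\<close>, through a bijection \<open>e\<close> onto an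
  initial segment of the natural numbers.\<close>

locale block_indices =
  fixes J :: "'i set" and n :: nat and e :: "'i \<times> nat \<Rightarrow> nat"
  assumes J: "finite J" "J \<noteq> {}" and n: "n \<ge> 1"
    and e: "bij_betw e (J \<times> {..<n}) {..<n * card J}"
begin

abbreviation "N \<equiv> n * card J"

lemma inj_e: "inj_on e (J \<times> {..<n})"
  using e by (simp add: bij_betw_def)

lemma e_less: "a \<in> J \<Longrightarrow> i < n \<Longrightarrow> e (a, i) < N"
  using e by (auto simp: bij_betw_def)

lemma e_eq_iff: "a \<in> J \<Longrightarrow> i < n \<Longrightarrow> b \<in> J \<Longrightarrow> l < n \<Longrightarrow> e (a, i) = e (b, l) \<longleftrightarrow> a = b \<and> i = l"
  using inj_on_eq_iff[OF inj_e, of "(a, i)" "(b, l)"] by simp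

lemma e_cases:
  assumes "x < N"
  obtains a i where "a \<in> J" "i < n" "x = e (a, i)"
proof -
  have "x \<in> e ` (J \<times> {..<n})" using assms e by (simp add: bij_betw_def)
  then show thesis using that by blast
qed

lemma sum_e: "(\<Sum>x<N. h x) = (\<Sum>a\<in>J. \<Sum>i<n. h (e (a, i)))"
  using J by (simp add: sum.reindex_bij_betw[OF e, symmetric] sum.cartesian_product)

lemma sum_e_Sigma:
  assumes "T \<subseteq> J" "\<And>b. b \<in> T \<Longrightarrow> I b \<subseteq> {..<n}"
  shows "(\<Sum>y\<in>e ` (SIGMA b:T. I b). h y) = (\<Sum>b\<in>T. \<Sum>l\<in>I b. h (e (b, l)))"
proof -
  have sub: "(SIGMA b:T. I b) \<subseteq> J \<times> {..<n}" using assms by blast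
  have "(\<Sum>y\<in>e ` (SIGMA b:T. I b). h y) = (\<Sum>z\<in>(SIGMA b:T. I b). h (e z))"
    by (rule sum.reindex[OF inj_on_subset[OF inj_e sub], unfolded comp_def])
  also have "\<dots> = (\<Sum>b\<in>T. \<Sum>l\<in>I b. h (e (b, l)))"
    using assms J finite_subset[OF assms(1)] finite_subset[OF assms(2)] by (subst sum.Sigma) auto
  finally show ?thesis .
qed

lemma card_e_Sigma:
  assumes "T \<subseteq> J" "\<And>b. b \<in> T \<Longrightarrow> I b \<subseteq> {..<n}"
  shows "card (e ` (SIGMA b:T. I b)) = (\<Sum>b\<in>T. card (I b))"
  using sum_e_Sigma[OF assms, where h = "\<lambda>_. 1 :: nat"] by simp

text \<open>A linear relation among the chosen columns of D b, extended by zero, is a relation among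
  columns of K, because column block b of K has no entries outside block row \<rho> b. So
  independent columns of K stay independent inside each block; a block in T can contribute at most
  its n columns.\<close>

lemma block_rank_le:
  fixes K :: "'k :: field mat"
  assumes K: "K \<in> carrier_mat N N" and D: "\<And>b. b \<in> J \<Longrightarrow> D b \<in> carrier_mat n n"
    and block: "\<And>b a i l. b \<in> J - T \<Longrightarrow> a \<in> J \<Longrightarrow> i < n \<Longrightarrow> l < n \<Longrightarrow>
      K $$ (e (a, i), e (b, l)) = (if a = \<rho> b then D b $$ (i, l) else 0)"
  shows "vec_space.rank N K \<le> (\<Sum>b\<in>J. if b \<in> T then n else vec_space.rank n (D b))"
proof -
  obtain I where I: "indep_cols K I" "card I = vec_space.rank N K"
    using vec_space.indep_cols_exists[OF K] by blast
  define I' where "I' b = {l \<in> {..<n}. e (b, l) \<in> I}" for b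
  have "I \<subseteq> {..<N}" using I(1) K by (simp add: indep_cols_def)
  have I_eq: "I = e ` (SIGMA b:J. I' b)"
  proof
    show "I \<subseteq> e ` (SIGMA b:J. I' b)"
    proof
      fix x assume x: "x \<in> I"
      then obtain a i where "a \<in> J" "i < n" "x = e (a, i)" using \<open>I \<subseteq> {..<N}\<close> e_cases[of x] by blast
      then show "x \<in> e ` (SIGMA b:J. I' b)" using x by (auto simp: I'_def)
    qed
  qed (auto simp: I'_def)
  have I'_sub: "I' b \<subseteq> {..<n}" for b by (auto simp: I'_def)
  have "card I = (\<Sum>b\<in>J. card (I' b))"
    unfolding I_eq by (rule card_e_Sigma) (use I'_sub in auto)
  also have "\<dots> \<le> (\<Sum>b\<in>J. if b \<in> T then n else vec_space.rank n (D b))"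
  proof (rule sum_mono)
    fix b assume b: "b \<in> J"
    show "card (I' b) \<le> (if b \<in> T then n else vec_space.rank n (D b))"
    proof (cases "b \<in> T")
      case True
      then show ?thesis using card_mono[OF finite_lessThan I'_sub[of b]] by simp
    next
      case False
      have "indep_cols (D b) (I' b)"
        unfolding indep_cols_def
      proof (intro conjI allI impI ballI)
        show "I' b \<subseteq> {..<dim_col (D b)}" using I'_sub D[OF b] by simp
        fix c l assume 0: "\<forall>r<dim_row (D b). (\<Sum>y\<in>I' b. D b $$ (r, y) * c y) = 0" and l: "l \<in> I' b"
        \<comment> \<open>The coefficients c of block b, extended by zero to all columns; the sum of
          indicator terms avoids decoding y.\<close>
        define a where "a y = (\<Sum>l\<in>I' b. if y = e (b, l) then c l else 0)" for y
        have finI': "finite (I' b)" by (simp add: I'_def)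
        have a_e: "a (e (b', l')) = (if b' = b then c l' else 0)" if "b' \<in> J" "l' \<in> I' b'" for b' l'
        proof -
          have "a (e (b', l')) = (\<Sum>l\<in>I' b. if b' = b \<and> l = l' then c l else 0)"
            unfolding a_def using that b I'_sub by (intro sum.cong refl if_cong) (auto simp: e_eq_iff subset_iff)
          then show ?thesis using that finI' by (cases "b' = b") (auto simp: sum.delta)
        qed
        have "(\<Sum>y\<in>I. K $$ (x, y) * a y) = 0" if "x < dim_row K" for x
        proof -
          have "x < N" using that K by simp
          then obtain a' i where x: "a' \<in> J" "i < n" "x = e (a', i)" by (rule e_cases)
          have "(\<Sum>y\<in>I. K $$ (x, y) * a y) = (\<Sum>b'\<in>J. \<Sum>l'\<in>I' b'. K $$ (x, e (b', l')) * a (e (b', l')))"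
            unfolding I_eq by (rule sum_e_Sigma) (use I'_sub in auto)
          also have "\<dots> = (\<Sum>b'\<in>J. if b' = b then (\<Sum>l'\<in>I' b. K $$ (x, e (b, l')) * c l') else 0)"
            by (intro sum.cong refl) (auto simp: a_e intro!: sum.cong sum.neutral)
          also have "\<dots> = (\<Sum>l'\<in>I' b. K $$ (x, e (b, l')) * c l')" using J b by (simp add: sum.delta)
          also have "\<dots> = (\<Sum>l'\<in>I' b. if a' = \<rho> b then D b $$ (i, l') * c l' else 0)"
            using block[of b] False b x I'_sub by (intro sum.cong refl) (auto simp: subset_iff)
          also have "\<dots> = 0" using 0 x D[OF b] by (cases "a' = \<rho> b") auto
          finally show ?thesis .
        qed
        moreover have "e (b, l) \<in> I" using l by (simp add: I'_def)
        ultimately have "a (e (b, l)) = 0" by (rule indep_colsD[OF I(1)])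
        then show "c l = 0" using a_e[OF b l] by simp
      qed
      then show ?thesis using vec_space.card_indep_cols_le_rank[OF D[OF b]] False by simp
    qed
  qed
  finally show ?thesis using I(2) by simp
qed

text \<open>Restricted to the block rows \<rho> t and block columns t with t in T, the matrix is
  block diagonal. Independent columns of the D t can be combined, as the rows of \<rho> t isolate
  the part of a relation that belongs to t.\<close>

lemma block_rank_ge:
  fixes K :: "'k :: field mat"
  assumes K: "K \<in> carrier_mat N N" and T: "T \<subseteq> J" and D: "\<And>t. t \<in> T \<Longrightarrow> D t \<in> carrier_mat n n"
    and \<rho>: "\<And>t. t \<in> T \<Longrightarrow> \<rho> t \<in> J"
    and block: "\<And>t t' i l. t \<in> T \<Longrightarrow> t' \<in> T \<Longrightarrow> i < n \<Longrightarrow> l < n \<Longrightarrow>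
      K $$ (e (\<rho> t, i), e (t', l)) = (if t' = t then D t $$ (i, l) else 0)"
  shows "(\<Sum>t\<in>T. vec_space.rank n (D t)) \<le> vec_space.rank N K"
proof -
  have "\<forall>t\<in>T. \<exists>I. indep_cols (D t) I \<and> card I = vec_space.rank n (D t)"
    using vec_space.indep_cols_exists[OF D] by blast
  then obtain I where I: "\<And>t. t \<in> T \<Longrightarrow> indep_cols (D t) (I t)" "\<And>t. t \<in> T \<Longrightarrow> card (I t) = vec_space.rank n (D t)"
    by metis
  have I_sub: "I t \<subseteq> {..<n}" if "t \<in> T" for t using I(1)[OF that] D[OF that] by (simp add: indep_cols_def)
  have finT: "finite T" using T J finite_subset by blast
  have "indep_cols K (e ` (SIGMA t:T. I t))"
    unfolding indep_cols_def
  proof (intro conjI allI impI ballI)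
    show "e ` (SIGMA t:T. I t) \<subseteq> {..<dim_col K}" using T I_sub e_less K by fastforce
    fix a y assume 0: "\<forall>r<dim_row K. (\<Sum>y\<in>e ` (SIGMA t:T. I t). K $$ (r, y) * a y) = 0"
      and "y \<in> e ` (SIGMA t:T. I t)"
    then obtain t l where t: "t \<in> T" "l \<in> I t" "y = e (t, l)" by blast
    have "(\<Sum>l\<in>I t. D t $$ (i, l) * a (e (t, l))) = 0" if "i < dim_row (D t)" for i
    proof -
      have i: "i < n" using that D[OF t(1)] by simp
      have "e (\<rho> t, i) < dim_row K" using e_less[OF \<rho>[OF t(1)] i] K by simp
      then have "0 = (\<Sum>y\<in>e ` (SIGMA t:T. I t). K $$ (e (\<rho> t, i), y) * a y)" using 0 by simp
      also have "\<dots> = (\<Sum>t'\<in>T. \<Sum>l\<in>I t'. K $$ (e (\<rho> t, i), e (t', l)) * a (e (t', l)))"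
        by (rule sum_e_Sigma[OF T I_sub])
      also have "\<dots> = (\<Sum>t'\<in>T. if t' = t then (\<Sum>l\<in>I t. D t $$ (i, l) * a (e (t, l))) else 0)"
      proof (rule sum.cong[OF refl])
        fix t' assume t': "t' \<in> T"
        have "(\<Sum>l\<in>I t'. K $$ (e (\<rho> t, i), e (t', l)) * a (e (t', l))) =
            (\<Sum>l\<in>I t'. if t' = t then D t $$ (i, l) * a (e (t', l)) else 0)"
          using block[OF t(1) t' i] I_sub[OF t'] by (intro sum.cong refl) (auto simp: subset_iff)
        then show "(\<Sum>l\<in>I t'. K $$ (e (\<rho> t, i), e (t', l)) * a (e (t', l))) =
            (if t' = t then (\<Sum>l\<in>I t. D t $$ (i, l) * a (e (t, l))) else 0)"
          by (cases "t' = t") simp_all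
      qed
      also have "\<dots> = (\<Sum>l\<in>I t. D t $$ (i, l) * a (e (t, l)))" using finT t(1) by (simp add: sum.delta)
      finally show ?thesis by simp
    qed
    then show "a y = 0" unfolding t(3) by (rule indep_colsD[OF I(1)[OF t(1)] _ t(2)])
  qed
  then have "card (e ` (SIGMA t:T. I t)) \<le> vec_space.rank N K"
    by (rule vec_space.card_indep_cols_le_rank[OF K])
  then show ?thesis using card_e_Sigma[OF T I_sub] I(2) by simp
qed

definition block_mat :: "('i \<Rightarrow> 'k :: comm_ring_1 mat) \<Rightarrow> ('i \<Rightarrow> 'i) \<Rightarrow> 'k mat" where
  "block_mat f \<tau> = mat N N (\<lambda>(x, y).
     let (a, i) = inv_into (J \<times> {..<n}) e x; (b, l) = inv_into (J \<times> {..<n}) e y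
     in if a = \<tau> b then f b $$ (i, l) else 0)"

lemma block_mat_carrier [simp]: "block_mat f \<tau> \<in> carrier_mat N N"
  by (simp add: block_mat_def)

lemma block_mat_dim [simp]: "dim_row (block_mat f \<tau>) = N" "dim_col (block_mat f \<tau>) = N"
  by (simp_all add: block_mat_def)

lemma block_mat_index:
  assumes "a \<in> J" "i < n" "b \<in> J" "l < n"
  shows "block_mat f \<tau> $$ (e (a, i), e (b, l)) = (if a = \<tau> b then f b $$ (i, l) else 0)"
proof -
  have "inv_into (J \<times> {..<n}) e (e (a, i)) = (a, i)" "inv_into (J \<times> {..<n}) e (e (b, l)) = (b, l)"
    using assms by (simp_all add: inv_into_f_f[OF inj_e])
  then show ?thesis using assms by (simp add: block_mat_def e_less)
qed

lemma mat_eqI_blocks: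
  assumes "A \<in> carrier_mat N N" "B \<in> carrier_mat N N"
    and "\<And>a i b l. a \<in> J \<Longrightarrow> i < n \<Longrightarrow> b \<in> J \<Longrightarrow> l < n \<Longrightarrow> A $$ (e (a, i), e (b, l)) = B $$ (e (a, i), e (b, l))"
  shows "A = B"
proof (rule eq_matI)
  fix x y assume xy: "x < dim_row B" "y < dim_col B"
  then have "x < N" "y < N" using assms(2) by auto
  then show "A $$ (x, y) = B $$ (x, y)" using assms(3) by (elim e_cases) simp
qed (use assms in auto)

lemma block_mat_one:
  assumes "\<And>j. j \<in> J \<Longrightarrow> f j = 1\<^sub>m n \<and> \<tau> j = j"
  shows "block_mat f \<tau> = 1\<^sub>m N"
  by (rule mat_eqI_blocks) (use assms in \<open>auto simp: block_mat_index e_less e_eq_iff\<close>)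

lemma block_mat_mult:
  assumes f: "\<And>j. j \<in> J \<Longrightarrow> f j \<in> carrier_mat n n" and g: "\<And>j. j \<in> J \<Longrightarrow> g j \<in> carrier_mat n n"
    and \<sigma>: "bij_betw \<sigma> J J"
  shows "block_mat f \<tau> * block_mat g \<sigma> = block_mat (\<lambda>j. f (\<sigma> j) * g j) (\<tau> \<circ> \<sigma>)"
proof (rule mat_eqI_blocks)
  fix a i b l assume ab: "a \<in> J" "i < n" "b \<in> J" "l < n"
  have \<sigma>b: "\<sigma> b \<in> J" using \<sigma> ab by (auto simp: bij_betw_def)
  have "(block_mat f \<tau> * block_mat g \<sigma>) $$ (e (a, i), e (b, l)) =
      (\<Sum>x<N. block_mat f \<tau> $$ (e (a, i), x) * block_mat g \<sigma> $$ (x, e (b, l)))"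
    using ab by (intro mat_mult_index block_mat_carrier e_less)
  also have "\<dots> = (\<Sum>c\<in>J. \<Sum>m<n. (if a = \<tau> c then f c $$ (i, m) else 0) * (if c = \<sigma> b then g b $$ (m, l) else 0))"
    unfolding sum_e using ab by (intro sum.cong refl) (simp add: block_mat_index)
  \<comment> \<open>Column block b of the right factor lives in block row \<sigma> b, so the sum
    over c has one term.\<close>
  also have "\<dots> = (\<Sum>c\<in>J. if c = \<sigma> b then \<Sum>m<n. (if a = \<tau> c then f c $$ (i, m) else 0) * g b $$ (m, l) else 0)"
    by (intro sum.cong refl) auto
  also have "\<dots> = (\<Sum>m<n. (if a = \<tau> (\<sigma> b) then f (\<sigma> b) $$ (i, m) else 0) * g b $$ (m, l))"
    using J \<sigma>b by (simp add: sum.delta)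
  also have "\<dots> = (if a = \<tau> (\<sigma> b) then (f (\<sigma> b) * g b) $$ (i, l) else 0)"
    using mat_mult_index[OF f[OF \<sigma>b] g[OF ab(3)] ab(2,4)] by simp
  finally show "(block_mat f \<tau> * block_mat g \<sigma>) $$ (e (a, i), e (b, l)) =
      block_mat (\<lambda>j. f (\<sigma> j) * g j) (\<tau> \<circ> \<sigma>) $$ (e (a, i), e (b, l))"
    using ab by (simp add: block_mat_index)
qed (auto intro: mult_carrier_mat)

end

lemma block_indices_exists:
  assumes "finite J" "J \<noteq> {}" "n \<ge> 1"
  shows "\<exists>e. block_indices J n e"
proof -
  have "card (J \<times> {..<n}) = card {..<n * card J}" by (simp add: card_cartesian_product)
  then have "\<exists>e. bij_betw e (J \<times> {..<n}) {..<n * card J}"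
    using assms by (intro finite_same_card_bij) auto
  then show ?thesis using assms by (auto simp: block_indices_def)
qed

section \<open>Block monomial matrices over a field and the rank distance\<close>

lemma carrier_GL: "carrier (GL ty n) = {A \<in> carrier_mat n n. \<exists>B\<in>carrier_mat n n. B * A = 1\<^sub>m n \<and> A * B = 1\<^sub>m n}"
  by (simp add: GL_def units_of_def Units_def ring_mat_simps ring_mat_def)

lemma mult_GL: "A \<otimes>\<^bsub>GL ty n\<^esub> B = A * B" and one_GL: "\<one>\<^bsub>GL ty n\<^esub> = 1\<^sub>m n"
  by (simp_all add: GL_def units_of_def ring_mat_simps)

lemma group_GL: "group (GL TYPE('k :: field) n)"
  unfolding GL_def by (rule monoid.units_group[OF ring.is_monoid[OF ring_mat]])

lemma rank_GL:
  assumes "A \<in> carrier (GL TYPE('k :: field) n)"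
  shows "vec_space.rank n A = n"
proof -
  obtain B where A: "A \<in> carrier_mat n n" and B: "B \<in> carrier_mat n n" "B * A = 1\<^sub>m n"
    using assms by (auto simp: carrier_GL)
  have "det B * det A = 1" using det_mult[OF B(1) A] B(2) by simp
  then have "det A \<noteq> 0" by auto
  then show ?thesis by (rule vec_space.low_rank_det_zero[OF A])
qed

text \<open>Take T as large as possible among the subsets disjoint from their image. A point j
  outside T cannot be added, so j lies in \<tau> T or \<tau> j lies in T. Hence J is covered by T,
  its image and its preimage, each with at most as many elements as T.\<close>

lemma fixed_point_free_displaced_subset:
  assumes J: "finite J" and \<tau>: "bij_betw \<tau> J J" and free: "\<And>j. j \<in> J \<Longrightarrow> \<tau> j \<noteq> j"
  shows "\<exists>T\<subseteq>J. \<tau> ` T \<inter> T = {} \<and> card J \<le> 3 * card T"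
proof -
  define P where "P T \<longleftrightarrow> T \<subseteq> J \<and> \<tau> ` T \<inter> T = {}" for T
  have "P {}" by (simp add: P_def)
  then obtain T where T: "P T" and max: "\<And>T'. P T' \<Longrightarrow> card T' \<le> card T"
    using ex_has_greatest_nat[of P "{}" card "Suc (card J)"] J
    by (auto simp: P_def less_Suc_eq_le card_mono)
  have TJ: "T \<subseteq> J" and disj: "\<tau> ` T \<inter> T = {}" using T by (simp_all add: P_def)
  have finT: "finite T" using TJ J by (rule finite_subset)
  define R where "R = {j \<in> J. \<tau> j \<in> T}"
  have "card R \<le> card T"
    using \<tau> finT by (intro card_inj_on_le[of \<tau>]) (auto simp: R_def bij_betw_def inj_on_def)
  have "J \<subseteq> T \<union> \<tau> ` T \<union> R"
  proof
    fix j assume j: "j \<in> J"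
    show "j \<in> T \<union> \<tau> ` T \<union> R"
    proof (rule ccontr)
      assume n: "j \<notin> T \<union> \<tau> ` T \<union> R"
      then have "P (insert j T)" using j free[OF j] TJ disj by (auto simp: P_def R_def)
      then have "card (insert j T) \<le> card T" by (rule max)
      then show False using n finT by simp
    qed
  qed
  then have "card J \<le> card (T \<union> \<tau> ` T \<union> R)"
    using finT J by (intro card_mono) (auto simp: R_def)
  also have "\<dots> \<le> card T + card (\<tau> ` T) + card R"
    using card_Un_le[of "T \<union> \<tau> ` T" R] card_Un_le[of T "\<tau> ` T"] by linarith
  also have "\<dots> \<le> 3 * card T" using \<open>card R \<le> card T\<close> card_image_le[OF finT, of \<tau>] by linarith
  finally show ?thesis using TJ disj by blast
qed

lemma (in block_indices) block_mat_GL: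
  assumes f: "f \<in> J \<rightarrow> carrier (GL TYPE('k :: field) n)" and \<tau>: "bij_betw \<tau> J J"
  shows "block_mat f \<tau> \<in> carrier (GL TYPE('k) N)"
proof -
  have "\<forall>j\<in>J. \<exists>B\<in>carrier_mat n n. B * f j = 1\<^sub>m n \<and> f j * B = 1\<^sub>m n"
    using f by (auto simp: carrier_GL)
  then obtain B where B: "\<And>j. j \<in> J \<Longrightarrow> B j \<in> carrier_mat n n"
    "\<And>j. j \<in> J \<Longrightarrow> B j * f j = 1\<^sub>m n" "\<And>j. j \<in> J \<Longrightarrow> f j * B j = 1\<^sub>m n" by metis
  have fc: "f j \<in> carrier_mat n n" if "j \<in> J" for j using f that by (auto simp: carrier_GL)
  define \<sigma> where "\<sigma> = inv_into J \<tau>"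
  have \<sigma>: "bij_betw \<sigma> J J" unfolding \<sigma>_def by (rule bij_betw_inv_into[OF \<tau>])
  have \<sigma>_in: "\<sigma> j \<in> J" if "j \<in> J" for j using \<sigma> that by (auto simp: bij_betw_def)
  have inv: "\<tau> (\<sigma> j) = j" "\<sigma> (\<tau> j) = j" if "j \<in> J" for j
    using \<tau> that by (auto simp: \<sigma>_def bij_betw_def f_inv_into_f)
  \<comment> \<open>The inverse of a block monomial matrix has permutation \<sigma>, and the block
    that inverts f j stands in column \<tau> j, so the family is B composed with \<sigma>.\<close>
  have 1: "block_mat f \<tau> * block_mat (\<lambda>j. B (\<sigma> j)) \<sigma> = 1\<^sub>m N"
    by (subst block_mat_mult[OF fc _ \<sigma>]) (auto intro!: block_mat_one simp: B \<sigma>_in inv)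
  have 2: "block_mat (\<lambda>j. B (\<sigma> j)) \<sigma> * block_mat f \<tau> = 1\<^sub>m N"
    by (subst block_mat_mult[OF _ fc \<tau>]) (auto intro!: block_mat_one simp: B \<sigma>_in inv)
  show ?thesis
    using 1 2 by (auto simp: carrier_GL intro!: bexI[of _ "block_mat (\<lambda>j. B (\<sigma> j)) \<sigma>"])
qed

lemma (in block_indices) block_mat_wreath_mult:
  assumes G: "carrier G \<subseteq> carrier_mat n n" "\<And>A B. A \<otimes>\<^bsub>G\<^esub> B = A * B" "\<And>A B. A \<otimes>\<^bsub>W\<^esub> B = A * B"
    and f: "f \<in> J \<rightarrow> carrier G" and g: "g \<in> J \<rightarrow> carrier G" and \<sigma>: "bij_betw \<sigma> J J"
  shows "block_mat f \<tau> \<otimes>\<^bsub>W\<^esub> block_mat g \<sigma> = block_mat (\<lambda>j. f (\<sigma> j) \<otimes>\<^bsub>G\<^esub> g j) (\<tau> \<circ> \<sigma>)"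
  unfolding G(2,3) by (rule block_mat_mult) (use f g G(1) \<sigma> in auto)

lemma rank_dist_bounds:
  assumes "n \<ge> 1" "A \<in> carrier_mat n n" "B \<in> carrier_mat n n"
  shows "0 \<le> rank_dist n A B" "rank_dist n A B \<le> 1"
proof -
  have "vec_space.rank n (A - B) \<le> n" using assms by (intro vec_space.rank_le_nc) auto
  then show "0 \<le> rank_dist n A B" "rank_dist n A B \<le> 1" using assms(1) by (simp_all add: rank_dist_def)
qed

text \<open>Subtracting two block monomial matrices can put two nonzero blocks into one column and
  several into one row, so the rank is only estimated: from above by column blocks, from below by a
  block diagonal part. Without fixed points, that part has columns T and rows \<tau> T for a set T
  disjoint from its image.\<close>

lemma GL_wreath_embeds:
  fixes J :: "'i set"
  assumes n: "n \<ge> 1" and J: "finite J" "J \<noteq> {}"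
  shows "\<exists>\<omega>. wreath_embeds J (GL TYPE('k :: field) n) (rank_dist n)
     (GL TYPE('k) (n * card J)) (rank_dist (n * card J)) \<omega>"
proof -
  obtain e where "block_indices J n e" using block_indices_exists[OF J n] by blast
  then interpret block_indices J n e .
  let ?G = "GL TYPE('k) n" and ?W = "GL TYPE('k) N"
  have cJ: "real (card J) > 0" using J by (simp add: card_gt_0_iff)
  have Gc: "carrier ?G \<subseteq> carrier_mat n n" by (auto simp: carrier_GL)
  \<comment> \<open>Writing the identity as a block matrix brings differences with it under
    \<open>diff\<close>.\<close>
  have W1: "\<one>\<^bsub>?W\<^esub> = block_mat (\<lambda>_. 1\<^sub>m n) id" by (subst block_mat_one) (simp_all add: one_GL)
  have diff: "(block_mat f \<tau> - block_mat g \<sigma>) $$ (e (a, i), e (b, l)) =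
      (if a = \<tau> b then f b $$ (i, l) else 0) - (if a = \<sigma> b then g b $$ (i, l) else 0)"
    if "a \<in> J" "i < n" "b \<in> J" "l < n" for f g :: "'i \<Rightarrow> 'k mat" and \<tau> \<sigma> a i b l
    using that by (simp add: block_mat_index e_less)
  have diff_carr: "block_mat f \<tau> - block_mat g \<sigma> \<in> carrier_mat N N" for f g :: "'i \<Rightarrow> 'k mat" and \<tau> \<sigma>
    by (rule minus_carrier_mat) simp
  have "wreath_embeds J ?G (rank_dist n) ?W (rank_dist N) block_mat"
    unfolding wreath_embeds_def
  proof (intro ballI allI impI conjI)
    fix f :: "'i \<Rightarrow> 'k mat" and \<tau> assume f: "f \<in> J \<rightarrow> carrier ?G" and \<tau>: "bij_betw \<tau> J J"
    have fc: "f j \<in> carrier_mat n n" if "j \<in> J" for j using f Gc that by blast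
    have \<tau>_in: "\<tau> j \<in> J" if "j \<in> J" for j using \<tau> that by (auto simp: bij_betw_def)
    have inj: "\<tau> i = \<tau> j \<longleftrightarrow> i = j" if "i \<in> J" "j \<in> J" for i j
      using \<tau> that by (auto simp: bij_betw_def inj_on_def)
    show "block_mat f \<tau> \<in> carrier ?W" by (rule block_mat_GL[OF f \<tau>])
    show "block_mat f \<tau> = \<one>\<^bsub>?W\<^esub>" if "\<forall>j\<in>J. f j = \<one>\<^bsub>?G\<^esub> \<and> \<tau> j = j"
      using that by (simp add: one_GL block_mat_one)
    show "c / 2 < rank_dist N (block_mat f \<tau>) \<one>\<^bsub>?W\<^esub>"
      if T: "T \<subseteq> J" and c: "c > 0" and "card J \<le> 2 * card T \<and> (\<forall>j\<in>T. \<tau> j = j \<and> c < rank_dist n (f j) \<one>\<^bsub>?G\<^esub>)" for T c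
    proof -
      have cT: "card J \<le> 2 * card T" and fixed: "\<And>j. j \<in> T \<Longrightarrow> \<tau> j = j"
        and far: "\<And>j. j \<in> T \<Longrightarrow> c < rank_dist n (f j) (1\<^sub>m n)" using that by (auto simp: one_GL)
      have "(\<Sum>t\<in>T. vec_space.rank n (f t - 1\<^sub>m n)) \<le> vec_space.rank N (block_mat f \<tau> - block_mat (\<lambda>_. 1\<^sub>m n) id)"
      proof (rule block_rank_ge[where \<rho> = id, OF diff_carr T])
        show "f t - 1\<^sub>m n \<in> carrier_mat n n" for t by (rule minus_carrier_mat) simp
        fix t t' i l assume t: "t \<in> T" "t' \<in> T" "i < n" "l < n"
        then have "t \<in> J" "t' \<in> J" using T by auto
        then show "(block_mat f \<tau> - block_mat (\<lambda>_. 1\<^sub>m n) id) $$ (e (id t, i), e (t', l)) =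
            (if t' = t then (f t - 1\<^sub>m n) $$ (i, l) else 0)"
          using t fixed fc[of t] by (auto simp: diff)
      qed (use T in auto)
      then have "real (\<Sum>t\<in>T. vec_space.rank n (f t - 1\<^sub>m n)) / real N \<le> rank_dist N (block_mat f \<tau>) \<one>\<^bsub>?W\<^esub>"
        unfolding W1 rank_dist_def by (intro divide_right_mono of_nat_mono) simp_all
      moreover have "real (\<Sum>t\<in>T. vec_space.rank n (f t - 1\<^sub>m n)) / real N =
          (\<Sum>t\<in>J. if t \<in> T then rank_dist n (f t) (1\<^sub>m n) else 0) / real (card J)"
        using J T by (simp add: sum.If_cases Int_absorb1 rank_dist_def flip: sum_divide_distrib)
      moreover have "\<dots> > c / 2"
        using J T cT c far by (intro less_average[of J T]) (auto simp: rank_dist_def)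
      ultimately show ?thesis by linarith
    qed
    show "1 / 4 < rank_dist N (block_mat f \<tau>) \<one>\<^bsub>?W\<^esub>" if free: "\<forall>j\<in>J. \<tau> j \<noteq> j"
    proof -
      obtain T where T: "T \<subseteq> J" "\<tau> ` T \<inter> T = {}" "card J \<le> 3 * card T"
        using fixed_point_free_displaced_subset[OF J(1) \<tau>] free by blast
      \<comment> \<open>In rows \<tau> t and columns from T the identity has only zero blocks, since
        \<tau> t is not in T; what remains are the invertible blocks f t.\<close>
      have "(\<Sum>t\<in>T. vec_space.rank n (f t)) \<le> vec_space.rank N (block_mat f \<tau> - block_mat (\<lambda>_. 1\<^sub>m n) id)"
      proof (rule block_rank_ge[where \<rho> = \<tau>, OF diff_carr T(1)])
        show "f t \<in> carrier_mat n n" "\<tau> t \<in> J" if "t \<in> T" for t using that T(1) fc \<tau>_in by auto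
        fix t t' i l assume t: "t \<in> T" "t' \<in> T" "i < n" "l < n"
        then have tJ: "t \<in> J" "t' \<in> J" using T by auto
        moreover have "\<tau> t \<noteq> t'" using t T(2) by blast
        ultimately show "(block_mat f \<tau> - block_mat (\<lambda>_. 1\<^sub>m n) id) $$ (e (\<tau> t, i), e (t', l)) =
            (if t' = t then f t $$ (i, l) else 0)"
          using t inj[OF tJ] \<tau>_in by (auto simp: diff)
      qed
      moreover have "(\<Sum>t\<in>T. vec_space.rank n (f t)) = card T * n"
        using f T(1) rank_GL[where 'k = 'k] by (simp add: Pi_iff subset_iff)
      ultimately have "real (card T * n) / real N \<le> rank_dist N (block_mat f \<tau>) \<one>\<^bsub>?W\<^esub>"
        unfolding W1 rank_dist_def by (intro divide_right_mono of_nat_mono) simp_all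
      moreover have "real (card T * n) / real N = real (card T) / real (card J)" using n by simp
      \<comment> \<open>The proportion of T in J is at least 1/3, which is where the constant 1/4
        gets its room.\<close>
      moreover have "1 / 4 < real (card T) / real (card J)" using T(3) cJ by (simp add: field_simps)
      ultimately show ?thesis by linarith
    qed
    fix g :: "'i \<Rightarrow> 'k mat" and \<sigma> assume g: "g \<in> J \<rightarrow> carrier ?G" and \<sigma>: "bij_betw \<sigma> J J"
    have gc: "g j \<in> carrier_mat n n" if "j \<in> J" for j using g Gc that by blast
    show "block_mat f \<tau> \<otimes>\<^bsub>?W\<^esub> block_mat g \<sigma> = block_mat (\<lambda>j. f (\<sigma> j) \<otimes>\<^bsub>?G\<^esub> g j) (\<tau> \<circ> \<sigma>)"
      by (rule block_mat_wreath_mult[OF Gc mult_GL mult_GL f g \<sigma>])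
    show "rank_dist N (block_mat f \<tau>) (block_mat g \<sigma>) \<le> \<eta> + 2 * sqrt (real (card T) / real (card J))"
      if T: "T \<subseteq> J" and \<eta>: "\<eta> \<ge> 0" and near: "\<forall>j\<in>J - T. \<tau> j = \<sigma> j \<and> rank_dist n (f j) (g j) \<le> \<eta>" for T \<eta>
    proof -
      have "vec_space.rank N (block_mat f \<tau> - block_mat g \<sigma>) \<le>
          (\<Sum>b\<in>J. if b \<in> T then n else vec_space.rank n (f b - g b))"
      proof (rule block_rank_le[where \<rho> = \<tau>, OF diff_carr])
        show "f b - g b \<in> carrier_mat n n" if "b \<in> J" for b using gc[OF that] by (rule minus_carrier_mat)
        fix b a i l assume b: "b \<in> J - T" "a \<in> J" "i < n" "l < n"
        then have "\<tau> b = \<sigma> b" using near by blast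
        then show "(block_mat f \<tau> - block_mat g \<sigma>) $$ (e (a, i), e (b, l)) =
            (if a = \<tau> b then (f b - g b) $$ (i, l) else 0)"
          using b gc[of b] by (simp add: diff)
      qed
      then have "real (vec_space.rank N (block_mat f \<tau> - block_mat g \<sigma>)) \<le>
          real (\<Sum>b\<in>J. if b \<in> T then n else vec_space.rank n (f b - g b))" by (simp only: of_nat_le_iff)
      then have "rank_dist N (block_mat f \<tau>) (block_mat g \<sigma>) \<le>
          real (\<Sum>b\<in>J. if b \<in> T then n else vec_space.rank n (f b - g b)) / real N"
        unfolding rank_dist_def by (intro divide_right_mono) auto
      also have "\<dots> = (\<Sum>b\<in>J. real (if b \<in> T then n else vec_space.rank n (f b - g b)) / real n) / real (card J)"
        by (simp add: sum_divide_distrib)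
      also have "\<dots> = (\<Sum>b\<in>J. if b \<in> T then 1 else rank_dist n (f b) (g b)) / real (card J)"
        using n by (intro arg_cong2[of _ _ _ _ "(/)"] sum.cong) (auto simp: rank_dist_def)
      also have "\<dots> \<le> \<eta> + 1 * (real (card T) / real (card J))"
        using J T \<eta> near rank_dist_bounds(2)[OF n fc gc] by (intro average_le) auto
      also have "\<dots> \<le> \<eta> + 2 * sqrt (real (card T) / real (card J))"
        using le_two_sqrt[of "real (card T) / real (card J)"] card_mono[OF J(1) T] cJ by simp
      finally show ?thesis .
    qed
  qed
  then show ?thesis by blast
qed

section \<open>Unitary groups and the Hilbert--Schmidt distance\<close>

lemma mat_adjoint_carrier [simp]:
  "A \<in> carrier_mat m n \<Longrightarrow> mat_adjoint A \<in> carrier_mat n m"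
  by (auto simp: mat_adjoint_def)

lemma mat_adjoint_dim [simp]:
  "dim_row (mat_adjoint A) = dim_col A" "dim_col (mat_adjoint A) = dim_row A"
  using mat_adjoint_carrier[of A "dim_row A" "dim_col A"] by (auto simp del: mat_adjoint_carrier)

lemma mat_adjoint_index:
  "A \<in> carrier_mat m n \<Longrightarrow> i < n \<Longrightarrow> j < m \<Longrightarrow> mat_adjoint A $$ (i, j) = conjugate (A $$ (j, i))"
  by (auto simp: mat_adjoint_def mat_of_rows_index)

lemma mat_adjoint_mult:
  fixes A B :: "complex mat"
  assumes A: "A \<in> carrier_mat n n" and B: "B \<in> carrier_mat n n"
  shows "mat_adjoint (A * B) = mat_adjoint B * mat_adjoint A"
proof (rule eq_matI)
  note AB = mult_carrier_mat[OF A B] and A' = mat_adjoint_carrier[OF A] and B' = mat_adjoint_carrier[OF B]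
  fix i j assume "i < dim_row (mat_adjoint B * mat_adjoint A)" "j < dim_col (mat_adjoint B * mat_adjoint A)"
  then have ij: "i < n" "j < n" using A' B' by auto
  show "mat_adjoint (A * B) $$ (i, j) = (mat_adjoint B * mat_adjoint A) $$ (i, j)"
    unfolding mat_adjoint_index[OF AB ij] mat_mult_index[OF A B ij(2,1)] mat_mult_index[OF B' A' ij] conjugate_complex_def cnj_sum
    using ij by (intro sum.cong refl) (simp add: mat_adjoint_index[OF A] mat_adjoint_index[OF B] mult.commute)
qed (use mat_adjoint_carrier[OF mult_carrier_mat[OF A B]] mat_adjoint_carrier[OF A] mat_adjoint_carrier[OF B] in auto)

lemma mat_adjoint_adjoint:
  fixes A :: "complex mat"
  assumes A: "A \<in> carrier_mat n n"
  shows "mat_adjoint (mat_adjoint A) = A"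
proof (rule eq_matI)
  fix i j assume "i < dim_row A" "j < dim_col A"
  then have ij: "i < n" "j < n" using A by auto
  then show "mat_adjoint (mat_adjoint A) $$ (i, j) = A $$ (i, j)"
    by (simp add: mat_adjoint_index[OF mat_adjoint_carrier[OF A]] mat_adjoint_index[OF A])
qed (use mat_adjoint_carrier[OF mat_adjoint_carrier[OF A]] A in auto)

lemma unitary_group_simps:
  "A \<in> carrier (unitary_group n) \<longleftrightarrow> A \<in> carrier_mat n n \<and> A * mat_adjoint A = 1\<^sub>m n \<and> mat_adjoint A * A = 1\<^sub>m n"
  "A \<otimes>\<^bsub>unitary_group n\<^esub> B = A * B" "\<one>\<^bsub>unitary_group n\<^esub> = 1\<^sub>m n"
  by (simp_all add: unitary_group_def)

lemma mat_mult_regroup: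
  fixes A B C D :: "'k :: comm_ring_1 mat"
  assumes "A \<in> carrier_mat n n" "B \<in> carrier_mat n n" "C \<in> carrier_mat n n" "D \<in> carrier_mat n n"
  shows "A * B * (C * D) = A * (B * C) * D"
  using assoc_mult_mat[OF assms(1,2) mult_carrier_mat[OF assms(3,4)]] assoc_mult_mat[OF assms(2,3,4)]
    assoc_mult_mat[OF assms(1) mult_carrier_mat[OF assms(2,3)] assms(4)] by simp

lemma group_unitary_group: "group (unitary_group n)"
proof (rule groupI)
  fix A B assume AB: "A \<in> carrier (unitary_group n)" "B \<in> carrier (unitary_group n)"
  then have A: "A \<in> carrier_mat n n" "A * mat_adjoint A = 1\<^sub>m n" "mat_adjoint A * A = 1\<^sub>m n"
    and B: "B \<in> carrier_mat n n" "B * mat_adjoint B = 1\<^sub>m n" "mat_adjoint B * B = 1\<^sub>m n"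
    by (simp_all add: unitary_group_simps)
  note A' = mat_adjoint_carrier[OF A(1)] and B' = mat_adjoint_carrier[OF B(1)]
  have "A * B * (mat_adjoint B * mat_adjoint A) = A * (B * mat_adjoint B) * mat_adjoint A"
    by (rule mat_mult_regroup[OF A(1) B(1) B' A'])
  moreover have "mat_adjoint B * mat_adjoint A * (A * B) = mat_adjoint B * (mat_adjoint A * A) * B"
    by (rule mat_mult_regroup[OF B' A' A(1) B(1)])
  ultimately show "A \<otimes>\<^bsub>unitary_group n\<^esub> B \<in> carrier (unitary_group n)"
    using A B A' B' by (simp add: unitary_group_simps mat_adjoint_mult[OF A(1) B(1)])
next
  have "mat_adjoint (1\<^sub>m n) = (1\<^sub>m n :: complex mat)"
    by (rule eq_matI) (auto simp: mat_adjoint_index[OF one_carrier_mat])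
  then show "\<one>\<^bsub>unitary_group n\<^esub> \<in> carrier (unitary_group n)" by (simp add: unitary_group_simps)
next
  fix A assume A: "A \<in> carrier (unitary_group n)"
  then show "\<one>\<^bsub>unitary_group n\<^esub> \<otimes>\<^bsub>unitary_group n\<^esub> A = A" by (auto simp: unitary_group_simps)
  show "\<exists>B\<in>carrier (unitary_group n). B \<otimes>\<^bsub>unitary_group n\<^esub> A = \<one>\<^bsub>unitary_group n\<^esub>"
    using A by (intro bexI[of _ "mat_adjoint A"]) (auto simp: unitary_group_simps mat_adjoint_adjoint)
qed (auto simp: unitary_group_simps assoc_mult_mat[of _ n n _ n _ n])

lemma unitary_col_norm:
  assumes "A \<in> carrier (unitary_group n)" "l < n"
  shows "(\<Sum>i<n. (cmod (A $$ (i, l)))\<^sup>2) = 1"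
proof -
  have A: "A \<in> carrier_mat n n" "mat_adjoint A * A = 1\<^sub>m n" using assms by (simp_all add: unitary_group_simps)
  have "1 = (mat_adjoint A * A) $$ (l, l)" using A assms by simp
  also have "\<dots> = (\<Sum>i<n. mat_adjoint A $$ (l, i) * A $$ (i, l))"
    by (rule mat_mult_index[OF mat_adjoint_carrier[OF A(1)] A(1) assms(2,2)])
  also have "\<dots> = (\<Sum>i<n. complex_of_real ((cmod (A $$ (i, l)))\<^sup>2))"
    using assms(2) by (intro sum.cong refl) (simp add: mat_adjoint_index[OF A(1)] complex_norm_square mult.commute del: of_real_power)
  finally show ?thesis by (metis of_real_eq_1_iff of_real_sum)
qed

text \<open>The squared Frobenius distance, with the columns outermost because unitarity is used
  through columns of norm 1.\<close>

definition entry_dist2 :: "nat \<Rightarrow> complex mat \<Rightarrow> complex mat \<Rightarrow> real" where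
  "entry_dist2 n A B = (\<Sum>l<n. \<Sum>i<n. (cmod (A $$ (i, l) - B $$ (i, l)))\<^sup>2)"

lemma hilbert_schmidt_dist_eq:
  assumes A: "A \<in> carrier_mat n n" and B: "B \<in> carrier_mat n n"
  shows "hilbert_schmidt_dist n A B = sqrt (entry_dist2 n A B / real n)"
proof -
  let ?C = "A - B"
  have C: "?C \<in> carrier_mat n n" using B by (rule minus_carrier_mat)
  have "mat_trace (?C * mat_adjoint ?C) = (\<Sum>i<n. \<Sum>l<n. ?C $$ (i, l) * mat_adjoint ?C $$ (l, i))"
    unfolding mat_trace_def
  proof (intro sum.cong)
    show "{..<dim_row (?C * mat_adjoint ?C)} = {..<n}" using B by simp
    show "(?C * mat_adjoint ?C) $$ (i, i) = (\<Sum>l<n. ?C $$ (i, l) * mat_adjoint ?C $$ (l, i))"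
      if "i \<in> {..<n}" for i using that by (intro mat_mult_index[OF C mat_adjoint_carrier[OF C]]) auto
  qed
  also have "\<dots> = (\<Sum>i<n. \<Sum>l<n. complex_of_real ((cmod (A $$ (i, l) - B $$ (i, l)))\<^sup>2))"
    using A B by (intro sum.cong refl) (simp add: mat_adjoint_index[OF C] complex_norm_square del: of_real_power)
  also have "\<dots> = complex_of_real (\<Sum>i<n. \<Sum>l<n. (cmod (A $$ (i, l) - B $$ (i, l)))\<^sup>2)" by simp
  finally have "Re (mat_trace (?C * mat_adjoint ?C)) = entry_dist2 n A B"
    unfolding entry_dist2_def by (subst sum.swap) simp
  then show ?thesis by (simp add: hilbert_schmidt_dist_def)
qed

lemma entry_dist2_nonneg: "entry_dist2 n A B \<ge> 0"
  by (simp add: entry_dist2_def sum_nonneg)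

text \<open>Each column contributes at most 2 + 2, from the bound of |z - w|^2 by 2|z|^2 + 2|w|^2.
  After normalisation the 4 bounds the squared distance of an exceptional block, and its root is the
  factor 2 in the continuity clause.\<close>

lemma entry_dist2_unitary_le:
  assumes "A \<in> carrier (unitary_group n)" "B \<in> carrier (unitary_group n)"
  shows "entry_dist2 n A B \<le> 4 * real n"
proof -
  have "(\<Sum>i<n. (cmod (A $$ (i, l) - B $$ (i, l)))\<^sup>2) \<le> 4" if l: "l < n" for l
  proof -
    have "(cmod (z - w))\<^sup>2 \<le> 2 * (cmod z)\<^sup>2 + 2 * (cmod w)\<^sup>2" for z w
    proof -
      have "(cmod (z - w))\<^sup>2 \<le> (cmod z + cmod w)\<^sup>2" by (intro power_mono norm_triangle_ineq4) simp
      also have "\<dots> \<le> 2 * (cmod z)\<^sup>2 + 2 * (cmod w)\<^sup>2"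
        using sum_squares_bound[of "cmod z" "cmod w"] by (simp add: power2_sum)
      finally show ?thesis .
    qed
    then have "(\<Sum>i<n. (cmod (A $$ (i, l) - B $$ (i, l)))\<^sup>2) \<le>
        (\<Sum>i<n. 2 * (cmod (A $$ (i, l)))\<^sup>2 + 2 * (cmod (B $$ (i, l)))\<^sup>2)" by (intro sum_mono)
    also have "\<dots> = 4"
      using unitary_col_norm[OF assms(1) l] unitary_col_norm[OF assms(2) l]
      by (simp add: sum.distrib flip: sum_distrib_left)
    finally show ?thesis .
  qed
  then have "entry_dist2 n A B \<le> (\<Sum>l<n. 4)" unfolding entry_dist2_def by (intro sum_mono) auto
  then show ?thesis by simp
qed

lemma (in block_indices) block_mat_unitary:
  assumes f: "f \<in> J \<rightarrow> carrier (unitary_group n)" and \<tau>: "bij_betw \<tau> J J"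
  shows "block_mat f \<tau> \<in> carrier (unitary_group N)"
proof -
  have fc: "f j \<in> carrier_mat n n" "f j * mat_adjoint (f j) = 1\<^sub>m n" "mat_adjoint (f j) * f j = 1\<^sub>m n"
    if "j \<in> J" for j using f that by (auto simp: unitary_group_simps)
  define \<sigma> where "\<sigma> = inv_into J \<tau>"
  have \<sigma>: "bij_betw \<sigma> J J" unfolding \<sigma>_def by (rule bij_betw_inv_into[OF \<tau>])
  have \<sigma>_in: "\<sigma> j \<in> J" if "j \<in> J" for j using \<sigma> that by (auto simp: bij_betw_def)
  have inv: "\<tau> (\<sigma> j) = j" "\<sigma> (\<tau> j) = j" if "j \<in> J" for j
    using \<tau> that by (auto simp: \<sigma>_def bij_betw_def f_inv_into_f)
  have adj: "mat_adjoint (block_mat f \<tau>) = block_mat (\<lambda>j. mat_adjoint (f (\<sigma> j))) \<sigma>"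
  proof (rule mat_eqI_blocks)
    fix a i b l assume ab: "a \<in> J" "i < n" "b \<in> J" "l < n"
    have "b = \<tau> a \<longleftrightarrow> a = \<sigma> b" using inv ab by auto
    then show "mat_adjoint (block_mat f \<tau>) $$ (e (a, i), e (b, l)) =
        block_mat (\<lambda>j. mat_adjoint (f (\<sigma> j))) \<sigma> $$ (e (a, i), e (b, l))"
      using ab by (auto simp: mat_adjoint_index[OF block_mat_carrier] e_less block_mat_index
          mat_adjoint_index[OF fc(1)])
  qed (simp_all add: mat_adjoint_carrier[OF block_mat_carrier])
  have "block_mat f \<tau> * block_mat (\<lambda>j. mat_adjoint (f (\<sigma> j))) \<sigma> = 1\<^sub>m N"
    by (subst block_mat_mult[OF fc(1) _ \<sigma>]) (auto intro!: block_mat_one simp: fc \<sigma>_in inv)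
  moreover have "block_mat (\<lambda>j. mat_adjoint (f (\<sigma> j))) \<sigma> * block_mat f \<tau> = 1\<^sub>m N"
    by (subst block_mat_mult[OF _ fc(1) \<tau>]) (auto intro!: block_mat_one simp: fc \<sigma>_in inv)
  ultimately show ?thesis by (simp add: unitary_group_simps adj)
qed

text \<open>Where \<tau> b = \<sigma> b, the blocks are compared entry by entry. Where they differ,
  the two columns have disjoint supports and norm 1, so their squared distance is 2, for each of the
  n columns of the block.\<close>

lemma (in block_indices) entry_dist2_block_mat:
  assumes f: "f \<in> J \<rightarrow> carrier (unitary_group n)" and \<tau>: "bij_betw \<tau> J J"
    and g: "g \<in> J \<rightarrow> carrier (unitary_group n)" and \<sigma>: "bij_betw \<sigma> J J"
  shows "entry_dist2 N (block_mat f \<tau>) (block_mat g \<sigma>) =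
    (\<Sum>b\<in>J. if \<tau> b = \<sigma> b then entry_dist2 n (f b) (g b) else 2 * real n)"
proof -
  have "entry_dist2 N (block_mat f \<tau>) (block_mat g \<sigma>) = (\<Sum>b\<in>J. \<Sum>l<n. \<Sum>a\<in>J. \<Sum>i<n.
      (cmod ((if a = \<tau> b then f b $$ (i, l) else 0) - (if a = \<sigma> b then g b $$ (i, l) else 0)))\<^sup>2)"
    unfolding entry_dist2_def sum_e by (intro sum.cong refl) (simp add: block_mat_index)
  also have "\<dots> = (\<Sum>b\<in>J. if \<tau> b = \<sigma> b then entry_dist2 n (f b) (g b) else 2 * real n)"
  proof (rule sum.cong[OF refl])
    fix b assume b: "b \<in> J"
    have in_J: "\<tau> b \<in> J" "\<sigma> b \<in> J" using \<tau> \<sigma> b by (auto simp: bij_betw_def)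
    have fb: "f b \<in> carrier (unitary_group n)" "g b \<in> carrier (unitary_group n)" using f g b by auto
    have "(\<Sum>a\<in>J. \<Sum>i<n. (cmod ((if a = \<tau> b then f b $$ (i, l) else 0) - (if a = \<sigma> b then g b $$ (i, l) else 0)))\<^sup>2) =
        (if \<tau> b = \<sigma> b then \<Sum>i<n. (cmod (f b $$ (i, l) - g b $$ (i, l)))\<^sup>2 else 2)" if l: "l < n" for l
    proof (cases "\<tau> b = \<sigma> b")
      case True
      then have "(\<Sum>a\<in>J. \<Sum>i<n. (cmod ((if a = \<tau> b then f b $$ (i, l) else 0) - (if a = \<sigma> b then g b $$ (i, l) else 0)))\<^sup>2) =
          (\<Sum>a\<in>J. if a = \<sigma> b then \<Sum>i<n. (cmod (f b $$ (i, l) - g b $$ (i, l)))\<^sup>2 else 0)"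
        by (intro sum.cong refl) auto
      then show ?thesis using True J in_J by (simp add: sum.delta)
    next
      case False
      then have "(\<Sum>a\<in>J. \<Sum>i<n. (cmod ((if a = \<tau> b then f b $$ (i, l) else 0) - (if a = \<sigma> b then g b $$ (i, l) else 0)))\<^sup>2) =
          (\<Sum>a\<in>J. (if a = \<tau> b then \<Sum>i<n. (cmod (f b $$ (i, l)))\<^sup>2 else 0) +
            (if a = \<sigma> b then \<Sum>i<n. (cmod (g b $$ (i, l)))\<^sup>2 else 0))"
        by (intro sum.cong refl) auto
      also have "\<dots> = 2"
        using J in_J unitary_col_norm[OF fb(1) l] unitary_col_norm[OF fb(2) l] by (simp add: sum.distrib sum.delta)
      finally show ?thesis using False by simp
    qed
    then show "(\<Sum>l<n. \<Sum>a\<in>J. \<Sum>i<n.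
        (cmod ((if a = \<tau> b then f b $$ (i, l) else 0) - (if a = \<sigma> b then g b $$ (i, l) else 0)))\<^sup>2) =
        (if \<tau> b = \<sigma> b then entry_dist2 n (f b) (g b) else 2 * real n)"
      by (simp add: entry_dist2_def)
  qed
  finally show ?thesis .
qed

text \<open>The squared distance is the average of the squared block distances, with 2 for a
  displaced block. With t the proportion of exceptional blocks, the root of \<eta>^2 + 4t is at most
  \<eta> plus twice the root of t. For separation, half of the blocks give more than c^2/2, which is
  at least (c/2)^2.\<close>

lemma unitary_group_wreath_embeds:
  fixes J :: "'i set"
  assumes n: "n \<ge> 1" and J: "finite J" "J \<noteq> {}"
  shows "\<exists>\<omega>. wreath_embeds J (unitary_group n) (hilbert_schmidt_dist n)
     (unitary_group (n * card J)) (hilbert_schmidt_dist (n * card J)) \<omega>"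
proof -
  obtain e where "block_indices J n e" using block_indices_exists[OF J n] by blast
  then interpret block_indices J n e .
  let ?G = "unitary_group n" and ?W = "unitary_group N" and ?d = "hilbert_schmidt_dist n"
  have cJ: "real (card J) > 0" using J by (simp add: card_gt_0_iff)
  have Gc: "carrier ?G \<subseteq> carrier_mat n n" by (auto simp: unitary_group_simps)
  have one: "(\<lambda>_. 1\<^sub>m n) \<in> J \<rightarrow> carrier ?G"
    using group_unitary_group[of n] unitary_group_simps(3)[of n] by (metis Pi_I group.is_monoid monoid.one_closed)
  have W1: "\<one>\<^bsub>?W\<^esub> = block_mat (\<lambda>_. 1\<^sub>m n) id" by (subst block_mat_one) (simp_all add: unitary_group_simps)
  have d2: "(?d A B)\<^sup>2 = entry_dist2 n A B / real n" "?d A B \<ge> 0"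
    if "A \<in> carrier ?G" "B \<in> carrier ?G" for A B
  proof -
    have "A \<in> carrier_mat n n" "B \<in> carrier_mat n n" using that Gc by auto
    then show "(?d A B)\<^sup>2 = entry_dist2 n A B / real n" "?d A B \<ge> 0"
      using entry_dist2_nonneg by (simp_all add: hilbert_schmidt_dist_eq)
  qed
  have d4: "(?d A B)\<^sup>2 \<le> 4" if "A \<in> carrier ?G" "B \<in> carrier ?G" for A B
    using entry_dist2_unitary_le[OF that] n by (simp add: d2(1)[OF that] divide_le_eq)
  have D: "hilbert_schmidt_dist N (block_mat f \<tau>) (block_mat g \<sigma>) =
      sqrt ((\<Sum>b\<in>J. if \<tau> b = \<sigma> b then (?d (f b) (g b))\<^sup>2 else 2) / real (card J))"
    if f: "f \<in> J \<rightarrow> carrier ?G" and \<tau>: "bij_betw \<tau> J J" and g: "g \<in> J \<rightarrow> carrier ?G" and \<sigma>: "bij_betw \<sigma> J J"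
    for f \<tau> g \<sigma>
  proof -
    have "entry_dist2 N (block_mat f \<tau>) (block_mat g \<sigma>) / real N =
        (\<Sum>b\<in>J. (if \<tau> b = \<sigma> b then entry_dist2 n (f b) (g b) else 2 * real n) / real n) / real (card J)"
      unfolding entry_dist2_block_mat[OF that] by (simp flip: sum_divide_distrib)
    also have "\<dots> = (\<Sum>b\<in>J. if \<tau> b = \<sigma> b then (?d (f b) (g b))\<^sup>2 else 2) / real (card J)"
      using f g n d2(1) by (intro arg_cong2[of _ _ _ _ "(/)"] sum.cong refl) (auto simp: Pi_iff)
    finally show ?thesis by (simp only: hilbert_schmidt_dist_eq[OF block_mat_carrier block_mat_carrier])
  qed
  have "wreath_embeds J ?G ?d ?W (hilbert_schmidt_dist N) block_mat"
    unfolding wreath_embeds_def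
  proof (intro ballI allI impI conjI)
    fix f :: "'i \<Rightarrow> complex mat" and \<tau> assume f: "f \<in> J \<rightarrow> carrier ?G" and \<tau>: "bij_betw \<tau> J J"
    show "block_mat f \<tau> \<in> carrier ?W" by (rule block_mat_unitary[OF f \<tau>])
    show "block_mat f \<tau> = \<one>\<^bsub>?W\<^esub>" if "\<forall>j\<in>J. f j = \<one>\<^bsub>?G\<^esub> \<and> \<tau> j = j"
      using that by (simp add: unitary_group_simps(3) block_mat_one)
    note D1 = D[OF f \<tau> one bij_betw_id, folded W1]
    show "c / 2 < hilbert_schmidt_dist N (block_mat f \<tau>) \<one>\<^bsub>?W\<^esub>"
      if T: "T \<subseteq> J" and c: "c > 0" and "card J \<le> 2 * card T \<and> (\<forall>j\<in>T. \<tau> j = j \<and> c < ?d (f j) \<one>\<^bsub>?G\<^esub>)" for T c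
    proof -
      have cT: "card J \<le> 2 * card T" and far: "\<And>j. j \<in> T \<Longrightarrow> \<tau> j = j \<and> c < ?d (f j) (1\<^sub>m n)"
        using that by (auto simp: unitary_group_simps(3))
      have "c\<^sup>2 / 2 < (\<Sum>b\<in>J. if \<tau> b = id b then (?d (f b) (1\<^sub>m n))\<^sup>2 else 2) / real (card J)"
        using J T cT c far by (intro less_average[of J T]) (auto intro: power_strict_mono)
      moreover have "(c / 2)\<^sup>2 \<le> c\<^sup>2 / 2" by (simp add: power2_eq_square)
      ultimately show ?thesis unfolding D1 using c by (intro real_less_rsqrt) linarith
    qed
    show "1 / 4 < hilbert_schmidt_dist N (block_mat f \<tau>) \<one>\<^bsub>?W\<^esub>" if free: "\<forall>j\<in>J. \<tau> j \<noteq> j"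
    proof -
      have "(\<Sum>b\<in>J. if \<tau> b = id b then (?d (f b) (1\<^sub>m n))\<^sup>2 else 2) = (\<Sum>b\<in>J. 2)"
        using free by (intro sum.cong) auto
      then have "(\<Sum>b\<in>J. if \<tau> b = id b then (?d (f b) (1\<^sub>m n))\<^sup>2 else 2) / real (card J) = 2" using cJ by simp
      then show ?thesis unfolding D1 by (simp only:) (rule real_less_rsqrt, simp add: power2_eq_square)
    qed
    fix g :: "'i \<Rightarrow> complex mat" and \<sigma> assume g: "g \<in> J \<rightarrow> carrier ?G" and \<sigma>: "bij_betw \<sigma> J J"
    show "block_mat f \<tau> \<otimes>\<^bsub>?W\<^esub> block_mat g \<sigma> = block_mat (\<lambda>j. f (\<sigma> j) \<otimes>\<^bsub>?G\<^esub> g j) (\<tau> \<circ> \<sigma>)"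
      by (rule block_mat_wreath_mult[OF Gc unitary_group_simps(2) unitary_group_simps(2) f g \<sigma>])
    show "hilbert_schmidt_dist N (block_mat f \<tau>) (block_mat g \<sigma>) \<le> \<eta> + 2 * sqrt (real (card T) / real (card J))"
      if T: "T \<subseteq> J" and \<eta>: "\<eta> \<ge> 0" and near: "\<forall>j\<in>J - T. \<tau> j = \<sigma> j \<and> ?d (f j) (g j) \<le> \<eta>" for T \<eta>
    proof -
      let ?t = "real (card T) / real (card J)"
      have fg: "f j \<in> carrier ?G" "g j \<in> carrier ?G" if "j \<in> J" for j using f g that by auto
      have "(\<Sum>b\<in>J. if \<tau> b = \<sigma> b then (?d (f b) (g b))\<^sup>2 else 2) / real (card J) \<le> \<eta>\<^sup>2 + 4 * ?t"
        using J T near fg d4 d2(2) by (intro average_le) (auto intro: power_mono)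
      also have "\<dots> \<le> (\<eta> + 2 * sqrt ?t)\<^sup>2" using \<eta> by (simp add: power2_sum power_mult_distrib)
      finally show ?thesis unfolding D[OF f \<tau> g \<sigma>] using \<eta> by (intro real_le_lsqrt) auto
    qed
  qed
  then show ?thesis by blast
qed

section \<open>Monomial automorphisms of a halo\<close>

context group
begin

lemma carrier_AutoGroup: "carrier (AutoGroup G) = auto G"
  by (simp add: AutoGroup_def)

lemma auto_in_carrier: "\<beta> \<in> auto G \<Longrightarrow> a \<in> carrier G \<Longrightarrow> \<beta> a \<in> carrier G"
  by (auto simp: auto_def hom_def)

lemma auto_eqI:
  assumes "\<beta> \<in> auto G" "\<gamma> \<in> auto G" "\<And>a. a \<in> carrier G \<Longrightarrow> \<beta> a = \<gamma> a"
  shows "\<beta> = \<gamma>"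
  using assms by (intro extensionalityI[of _ "carrier G"]) (auto simp: auto_def Bij_def)

lemma AutoGroup_mult: "\<beta> \<in> auto G \<Longrightarrow> \<gamma> \<in> auto G \<Longrightarrow> \<beta> \<otimes>\<^bsub>AutoGroup G\<^esub> \<gamma> = compose (carrier G) \<beta> \<gamma>"
  by (simp add: AutoGroup_def BijGroup_def auto_def)

lemma AutoGroup_apply:
  "\<beta> \<in> auto G \<Longrightarrow> \<gamma> \<in> auto G \<Longrightarrow> a \<in> carrier G \<Longrightarrow> (\<beta> \<otimes>\<^bsub>AutoGroup G\<^esub> \<gamma>) a = \<beta> (\<gamma> a)"
  by (simp add: AutoGroup_mult compose_def)

lemma AutoGroup_one: "\<one>\<^bsub>AutoGroup G\<^esub> = (\<lambda>a\<in>carrier G. a)"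
  by (simp add: AutoGroup_def BijGroup_def)

lemma inv_AutoGroup_in: "\<beta> \<in> auto G \<Longrightarrow> inv\<^bsub>AutoGroup G\<^esub> \<beta> \<in> auto G"
  using group.inv_closed[OF AutoGroup, of \<beta>] by (simp add: carrier_AutoGroup)

lemma mult_AutoGroup_in: "\<beta> \<in> auto G \<Longrightarrow> \<gamma> \<in> auto G \<Longrightarrow> \<beta> \<otimes>\<^bsub>AutoGroup G\<^esub> \<gamma> \<in> auto G"
  using monoid.m_closed[OF group.is_monoid[OF AutoGroup], of \<beta> \<gamma>] by (simp add: carrier_AutoGroup)

lemma inv_AutoGroup_apply:
  assumes "\<beta> \<in> auto G" "a \<in> carrier G"
  shows "(inv\<^bsub>AutoGroup G\<^esub> \<beta>) (\<beta> a) = a" "\<beta> ((inv\<^bsub>AutoGroup G\<^esub> \<beta>) a) = a"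
proof -
  have "inv\<^bsub>AutoGroup G\<^esub> \<beta> \<otimes>\<^bsub>AutoGroup G\<^esub> \<beta> = \<one>\<^bsub>AutoGroup G\<^esub>"
    "\<beta> \<otimes>\<^bsub>AutoGroup G\<^esub> inv\<^bsub>AutoGroup G\<^esub> \<beta> = \<one>\<^bsub>AutoGroup G\<^esub>"
    using assms(1) by (simp_all add: carrier_AutoGroup group.l_inv[OF AutoGroup] group.r_inv[OF AutoGroup])
  then show "(inv\<^bsub>AutoGroup G\<^esub> \<beta>) (\<beta> a) = a" "\<beta> ((inv\<^bsub>AutoGroup G\<^esub> \<beta>) a) = a"
    using AutoGroup_apply[OF inv_AutoGroup_in[OF assms(1)] assms] AutoGroup_apply[OF assms(1) inv_AutoGroup_in[OF assms(1)] assms(2)]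
      assms by (simp_all add: AutoGroup_one)
qed

lemma auto_group_hom: "\<beta> \<in> auto G \<Longrightarrow> group_hom G G \<beta>"
  by (simp add: group_hom_def group_hom_axioms_def auto_def is_group)

lemma auto_image_generate:
  "\<beta> \<in> auto G \<Longrightarrow> K \<subseteq> carrier G \<Longrightarrow> \<beta> ` generate G K = generate G (\<beta> ` K)"
  using group_hom.generate_img[OF auto_group_hom] by blast

lemma auto_eq_on_generate:
  assumes "\<beta> \<in> auto G" "\<gamma> \<in> auto G" "K \<subseteq> carrier G" "\<And>a. a \<in> K \<Longrightarrow> \<beta> a = \<gamma> a"
    and "a \<in> generate G K"
  shows "\<beta> a = \<gamma> a"
  using assms(5)
proof (induction rule: generate.induct)
  case one
  then show ?case
    using group_hom.hom_one[OF auto_group_hom[OF assms(1)]] group_hom.hom_one[OF auto_group_hom[OF assms(2)]]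
    by simp
next
  case (incl h)
  then show ?case by (rule assms(4))
next
  case (inv h)
  then have "h \<in> carrier G" using assms(3) by blast
  then show ?case using assms(4)[OF inv]
    using group_hom.hom_inv[OF auto_group_hom[OF assms(1)]] group_hom.hom_inv[OF auto_group_hom[OF assms(2)]]
    by simp
next
  case (eng h1 h2)
  then have "h1 \<in> carrier G" "h2 \<in> carrier G" using generate_in_carrier[OF assms(3)] by blast+
  then show ?case using eng.IH assms(1,2) by (simp add: auto_def hom_def)
qed

lemma auto_eqI_generate:
  assumes "\<beta> \<in> auto G" "\<gamma> \<in> auto G" "K \<subseteq> carrier G" "\<And>a. a \<in> K \<Longrightarrow> \<beta> a = \<gamma> a"
    and "carrier G = generate G K"
  shows "\<beta> = \<gamma>"
  using auto_eqI[OF assms(1,2)] auto_eq_on_generate[OF assms(1-4)] assms(5) by blast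

end

text \<open>E and its image have the same size, so their complements in the union have too, and any
  bijection between these completes j.\<close>

lemma inj_on_extends_to_permutation:
  assumes "finite E" "inj_on j E"
  shows "\<exists>p. p permutes (E \<union> j ` E) \<and> (\<forall>x\<in>E. p x = j x)"
proof -
  let ?Z = "E \<union> j ` E"
  have "finite ?Z" using assms by simp
  have "card (?Z - E) = card (?Z - j ` E)"
    using assms card_image[OF assms(2)] by (simp add: card_Diff_subset)
  then obtain h where h: "bij_betw h (?Z - E) (?Z - j ` E)"
    using \<open>finite ?Z\<close> finite_same_card_bij[of "?Z - E" "?Z - j ` E"] by auto
  define p where "p x = (if x \<in> E then j x else if x \<in> ?Z then h x else x)" for x
  have "bij_betw p (E \<union> (?Z - E)) (j ` E \<union> (?Z - j ` E))"
  proof (rule bij_betw_combine)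
    show "bij_betw p E (j ` E)" using assms(2) by (auto simp: bij_betw_def p_def inj_on_def)
    show "bij_betw p (?Z - E) (?Z - j ` E)"
      using h by (subst bij_betw_cong[of _ p h]) (auto simp: p_def)
  qed auto
  moreover have "E \<union> (?Z - E) = ?Z" "j ` E \<union> (?Z - j ` E) = ?Z" by auto
  ultimately have "bij_betw p ?Z ?Z" by simp
  then have "p permutes ?Z" by (rule bij_imp_permutes) (auto simp: p_def)
  then show ?thesis by (intro exI[of _ p]) (simp add: p_def)
qed

lemma group_semidirect_product:
  assumes "group N" "group \<Gamma>"
    and closed: "\<And>g x. g \<in> carrier \<Gamma> \<Longrightarrow> x \<in> carrier N \<Longrightarrow> \<theta> g x \<in> carrier N"
    and hom: "\<And>g x y. g \<in> carrier \<Gamma> \<Longrightarrow> x \<in> carrier N \<Longrightarrow> y \<in> carrier N \<Longrightarrow>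
       \<theta> g (x \<otimes>\<^bsub>N\<^esub> y) = \<theta> g x \<otimes>\<^bsub>N\<^esub> \<theta> g y"
    and comp: "\<And>g h x. g \<in> carrier \<Gamma> \<Longrightarrow> h \<in> carrier \<Gamma> \<Longrightarrow> x \<in> carrier N \<Longrightarrow>
       \<theta> (g \<otimes>\<^bsub>\<Gamma>\<^esub> h) x = \<theta> g (\<theta> h x)"
    and one: "\<And>x. x \<in> carrier N \<Longrightarrow> \<theta> \<one>\<^bsub>\<Gamma>\<^esub> x = x"
  shows "group (semidirect_product N \<Gamma> \<theta>)"
proof -
  interpret N: group N by fact
  interpret \<Gamma>: group \<Gamma> by fact
  show ?thesis
  proof (rule groupI)
    fix z assume "z \<in> carrier (semidirect_product N \<Gamma> \<theta>)"
    then obtain x g where z: "z = (x, g)" "x \<in> carrier N" "g \<in> carrier \<Gamma>"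
      by (auto simp: semidirect_product_def)
    have "\<theta> (inv\<^bsub>\<Gamma>\<^esub> g) (inv\<^bsub>N\<^esub> x) \<otimes>\<^bsub>N\<^esub> \<theta> (inv\<^bsub>\<Gamma>\<^esub> g) x = \<theta> (inv\<^bsub>\<Gamma>\<^esub> g) \<one>\<^bsub>N\<^esub>"
      using z by (simp flip: hom)
    also have "\<dots> = \<one>\<^bsub>N\<^esub>"
      using hom[of "inv\<^bsub>\<Gamma>\<^esub> g" "\<one>\<^bsub>N\<^esub>" "\<one>\<^bsub>N\<^esub>"] z closed[of "inv\<^bsub>\<Gamma>\<^esub> g" "\<one>\<^bsub>N\<^esub>"] by simp
    finally show "\<exists>w\<in>carrier (semidirect_product N \<Gamma> \<theta>).
        w \<otimes>\<^bsub>semidirect_product N \<Gamma> \<theta>\<^esub> z = \<one>\<^bsub>semidirect_product N \<Gamma> \<theta>\<^esub>"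
      using z closed
      by (intro bexI[of _ "(\<theta> (inv\<^bsub>\<Gamma>\<^esub> g) (inv\<^bsub>N\<^esub> x), inv\<^bsub>\<Gamma>\<^esub> g)"]) (auto simp: semidirect_product_def)
  next
    fix z w v assume "z \<in> carrier (semidirect_product N \<Gamma> \<theta>)" "w \<in> carrier (semidirect_product N \<Gamma> \<theta>)"
      "v \<in> carrier (semidirect_product N \<Gamma> \<theta>)"
    then obtain x g y h u k where "z = (x, g)" "w = (y, h)" "v = (u, k)" "x \<in> carrier N" "y \<in> carrier N"
      "u \<in> carrier N" "g \<in> carrier \<Gamma>" "h \<in> carrier \<Gamma>" "k \<in> carrier \<Gamma>"
      by (cases z; cases w; cases v) (simp add: semidirect_product_def)
    then show "z \<otimes>\<^bsub>semidirect_product N \<Gamma> \<theta>\<^esub> w \<otimes>\<^bsub>semidirect_product N \<Gamma> \<theta>\<^esub> v =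
        z \<otimes>\<^bsub>semidirect_product N \<Gamma> \<theta>\<^esub> (w \<otimes>\<^bsub>semidirect_product N \<Gamma> \<theta>\<^esub> v)"
      by (simp add: semidirect_product_def closed hom comp N.m_assoc \<Gamma>.m_assoc)
  qed (auto simp: semidirect_product_def closed one)
qed

text \<open>One halo with the categories stripped away, so that sets and graphs share the argument.
  The map c v w stands for the canonical isomorphism from L({v}) to L({w}), read inside L(X);
  \<open>swap\<close> is the form in which condition (b) is used.\<close>

locale monomial_halo =
  fixes X :: "'x set" and G :: "'g monoid" and H :: "'x set \<Rightarrow> 'g set" and c :: "'x \<Rightarrow> 'x \<Rightarrow> 'g \<Rightarrow> 'g"
  assumes halo: "halo_over X G H"
    and joins: "\<And>Y Z. Y \<subseteq> X \<Longrightarrow> Z \<subseteq> X \<Longrightarrow> H (Y \<union> Z) = generate G (H Y \<union> H Z)"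
    and c_refl: "\<And>v a. v \<in> X \<Longrightarrow> a \<in> H {v} \<Longrightarrow> c v v a = a"
    and c_in: "\<And>v w a. v \<in> X \<Longrightarrow> w \<in> X \<Longrightarrow> a \<in> H {v} \<Longrightarrow> c v w a \<in> H {w}"
    and c_trans: "\<And>u v w a. u \<in> X \<Longrightarrow> v \<in> X \<Longrightarrow> w \<in> X \<Longrightarrow> a \<in> H {u} \<Longrightarrow> c v w (c u v a) = c u w a"
    and swap: "\<And>u w. u \<in> X \<Longrightarrow> w \<in> X \<Longrightarrow> u \<noteq> w \<Longrightarrow>
      \<exists>\<gamma>\<in>auto G. \<gamma> ` H {u, w} = H {u, w} \<and> (\<forall>a\<in>H (X - {u, w}). \<gamma> a = a) \<and>
        (\<forall>a\<in>H {u}. \<gamma> a = c u w a) \<and> (\<forall>a\<in>H {w}. \<gamma> a = c w u a)"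

sublocale monomial_halo \<subseteq> group G
  using halo by (simp add: halo_over_def)

section \<open>Generation by vertex subgroups and monomial automorphisms\<close>

context monomial_halo
begin

abbreviation "A \<equiv> AutoGroup G"

lemma group_A: "group A"
  by (rule AutoGroup)

lemma H_subgroup: "Y \<subseteq> X \<Longrightarrow> subgroup (H Y) G"
  and H_mono: "Z \<subseteq> Y \<Longrightarrow> Y \<subseteq> X \<Longrightarrow> H Z \<subseteq> H Y"
  and H_empty: "H {} = {\<one>\<^bsub>G\<^esub>}"
  and H_top: "H X = carrier G"
  and H_Int: "Y \<subseteq> X \<Longrightarrow> Z \<subseteq> X \<Longrightarrow> H (Y \<inter> Z) = H Y \<inter> H Z"
  using halo by (simp_all add: halo_over_def)

lemma H_top_generate: "carrier G = generate G (\<Union>{H Y | Y. Y \<subseteq> X \<and> finite Y})"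
proof -
  have "H X = generate G (\<Union>{H Y | Y. Y \<subseteq> X \<and> finite Y})"
    using halo unfolding halo_over_def by (elim conjE)
  then show ?thesis by (simp only: H_top)
qed

lemma H_carrier: "Y \<subseteq> X \<Longrightarrow> H Y \<subseteq> carrier G"
  using H_subgroup subgroup.subset by blast

lemma points_carrier: "Y \<subseteq> X \<Longrightarrow> (\<Union>v\<in>Y. H {v}) \<subseteq> carrier G"
  by (intro UN_least H_carrier) auto

text \<open>Condition (a) splits off one vertex at a time, down to the trivial group of the empty
  set.\<close>

lemma H_finite_subset:
  assumes "finite Y" "Y \<subseteq> X"
  shows "H Y \<subseteq> generate G (\<Union>v\<in>Y. H {v})"
  using assms
proof (induction Y rule: finite_induct)
  case empty
  then show ?case by (simp add: H_empty generate.one)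
next
  case (insert v Y)
  then have IH: "H Y \<subseteq> generate G (\<Union>v\<in>insert v Y. H {v})"
    using mono_generate[of "\<Union>v\<in>Y. H {v}" "\<Union>v\<in>insert v Y. H {v}"] by blast
  have "H (insert v Y) = generate G (H {v} \<union> H Y)" using joins[of "{v}" Y] insert by simp
  also have "\<dots> \<subseteq> generate G (\<Union>v\<in>insert v Y. H {v})"
  proof (rule generate_subgroup_incl)
    show "subgroup (generate G (\<Union>v\<in>insert v Y. H {v})) G"
      using points_carrier[OF insert.prems] by (rule generate_is_subgroup)
    have "H {v} \<subseteq> generate G (\<Union>v\<in>insert v Y. H {v})" by (auto intro: generate.incl)
    then show "H {v} \<union> H Y \<subseteq> generate G (\<Union>v\<in>insert v Y. H {v})" using IH by blast
  qed
  finally show ?case .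
qed

lemma H_finitely_supported:
  assumes "a \<in> carrier G"
  shows "\<exists>Z\<subseteq>X. finite Z \<and> a \<in> H Z"
proof -
  have "a \<in> generate G (\<Union>{H Y | Y. Y \<subseteq> X \<and> finite Y})"
    using assms H_top_generate by simp
  then show ?thesis
  proof (induction rule: generate.induct)
    case one
    then show ?case using H_empty by (intro exI[of _ "{}"]) simp
  next
    case (incl h)
    then show ?case by blast
  next
    case (inv h)
    then obtain Y where Y: "Y \<subseteq> X" "finite Y" "h \<in> H Y" by blast
    then have "inv\<^bsub>G\<^esub> h \<in> H Y" using H_subgroup by (simp add: subgroup.m_inv_closed)
    then show ?case using Y by blast
  next
    case (eng h1 h2)
    then obtain Z1 Z2 where Z: "Z1 \<subseteq> X" "finite Z1" "h1 \<in> H Z1" "Z2 \<subseteq> X" "finite Z2" "h2 \<in> H Z2" by blast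
    then have "h1 \<in> H (Z1 \<union> Z2)" "h2 \<in> H (Z1 \<union> Z2)"
      using H_mono[of Z1 "Z1 \<union> Z2"] H_mono[of Z2 "Z1 \<union> Z2"] by blast+
    then have "h1 \<otimes>\<^bsub>G\<^esub> h2 \<in> H (Z1 \<union> Z2)"
      using H_subgroup[of "Z1 \<union> Z2"] Z by (simp add: subgroup.m_closed)
    then show ?case using Z by (intro exI[of _ "Z1 \<union> Z2"]) simp
  qed
qed

text \<open>Condition (a) only reaches finite unions. An element of L(Y) lies in some L(Z) with Z
  finite by axiom (ii), hence in the group of the finite set Y \<inter> Z by axiom (iii), where the
  finite case applies.\<close>

lemma H_generate:
  assumes "Y \<subseteq> X"
  shows "H Y = generate G (\<Union>v\<in>Y. H {v})"
proof
  show "generate G (\<Union>v\<in>Y. H {v}) \<subseteq> H Y"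
    using H_mono[of _ Y] assms by (intro generate_subgroup_incl H_subgroup) auto
  show "H Y \<subseteq> generate G (\<Union>v\<in>Y. H {v})"
  proof
    fix a assume a: "a \<in> H Y"
    then obtain Z where Z: "Z \<subseteq> X" "finite Z" "a \<in> H Z"
      using H_finitely_supported H_carrier[OF assms] by blast
    then have "a \<in> H (Y \<inter> Z)" using H_Int[OF assms Z(1)] a by blast
    then have "a \<in> generate G (\<Union>v\<in>Y \<inter> Z. H {v})"
      using H_finite_subset[of "Y \<inter> Z"] Z assms by blast
    then show "a \<in> generate G (\<Union>v\<in>Y. H {v})"
      using mono_generate[of "\<Union>v\<in>Y \<inter> Z. H {v}" "\<Union>v\<in>Y. H {v}"] by blast
  qed
qed

lemma carrier_generate: "carrier G = generate G (\<Union>v\<in>X. H {v})"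
  using H_generate[of X] H_top by simp

lemma auto_eqI_points:
  assumes "\<beta> \<in> auto G" "\<gamma> \<in> auto G" "\<And>v a. v \<in> X \<Longrightarrow> a \<in> H {v} \<Longrightarrow> \<beta> a = \<gamma> a"
  shows "\<beta> = \<gamma>"
  by (rule auto_eqI_generate[OF assms(1,2) points_carrier[OF subset_refl] _ carrier_generate])
    (use assms(3) in blast)

definition supp :: "('g \<Rightarrow> 'g) \<Rightarrow> 'x set \<Rightarrow> bool" where
  "supp \<beta> Y \<longleftrightarrow> \<beta> ` H Y = H Y \<and> (\<forall>a\<in>H (X - Y). \<beta> a = a)"

definition finitary_autos :: "('g \<Rightarrow> 'g) set" where
  "finitary_autos = {\<beta> \<in> auto G. \<exists>Y\<subseteq>X. finite Y \<and> supp \<beta> Y}"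

definition monomial :: "('g \<Rightarrow> 'g) \<Rightarrow> ('x \<Rightarrow> 'x) \<Rightarrow> bool" where
  "monomial Q q \<longleftrightarrow> Q \<in> auto G \<and> bij_betw q X X \<and> (\<forall>v\<in>X. \<forall>a\<in>H {v}. Q a = c v (q v) a)"

text \<open>By condition (a), L(Z) is generated by L(Y), which \<beta> preserves, and L(Z - Y),
  which \<beta> fixes pointwise.\<close>

lemma supp_mono:
  assumes "\<beta> \<in> auto G" "supp \<beta> Y" "Y \<subseteq> Z" "Z \<subseteq> X"
  shows "supp \<beta> Z"
  unfolding supp_def
proof
  have fixd: "\<beta> a = a" if "a \<in> H (X - Y)" for a using assms(2) that by (simp add: supp_def)
  have sub: "H (Z - Y) \<subseteq> H (X - Y)" using assms by (intro H_mono) auto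
  have "Y \<union> (Z - Y) = Z" using assms by blast
  then have Z: "H Z = generate G (H Y \<union> H (Z - Y))" using joins[of Y "Z - Y"] assms by fastforce
  have "\<beta> ` H (Z - Y) = H (Z - Y)" using fixd sub by force
  moreover have "\<beta> ` H Y = H Y" using assms(2) by (simp add: supp_def)
  ultimately have "\<beta> ` (H Y \<union> H (Z - Y)) = H Y \<union> H (Z - Y)" by (simp add: image_Un)
  moreover have "H Y \<union> H (Z - Y) \<subseteq> carrier G" using H_carrier[of Y] H_carrier[of "Z - Y"] assms by blast
  ultimately show "\<beta> ` H Z = H Z" unfolding Z using auto_image_generate[OF assms(1)] by simp
  have "H (X - Z) \<subseteq> H (X - Y)" using assms by (intro H_mono) auto
  then show "\<forall>a\<in>H (X - Z). \<beta> a = a" using fixd by blast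
qed

lemma supp_in: "supp \<beta> Y \<Longrightarrow> a \<in> H Y \<Longrightarrow> \<beta> a \<in> H Y"
  unfolding supp_def by blast

lemma supp_mult:
  assumes "\<beta> \<in> auto G" "\<gamma> \<in> auto G" "supp \<beta> Y" "supp \<gamma> Y" "Y \<subseteq> X"
  shows "supp (\<beta> \<otimes>\<^bsub>A\<^esub> \<gamma>) Y"
proof -
  have app: "(\<beta> \<otimes>\<^bsub>A\<^esub> \<gamma>) a = \<beta> (\<gamma> a)" if "a \<in> H Z" "Z \<subseteq> X" for a Z
    using AutoGroup_apply[OF assms(1,2)] H_carrier that by blast
  have "(\<beta> \<otimes>\<^bsub>A\<^esub> \<gamma>) ` H Y = \<beta> ` (\<gamma> ` H Y)"
    unfolding image_image by (rule image_cong) (use app assms(5) in auto)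
  also have "\<dots> = H Y" using assms(3,4) by (simp add: supp_def)
  finally show ?thesis
    using assms(3,4) app[of _ "X - Y"] by (simp add: supp_def)
qed

lemma supp_inv:
  assumes "\<beta> \<in> auto G" "supp \<beta> Y" "Y \<subseteq> X"
  shows "supp (inv\<^bsub>A\<^esub> \<beta>) Y"
proof -
  have inv: "(inv\<^bsub>A\<^esub> \<beta>) (\<beta> a) = a" if "a \<in> H Z" "Z \<subseteq> X" for a Z
    using inv_AutoGroup_apply(1)[OF assms(1)] H_carrier that by blast
  have "(inv\<^bsub>A\<^esub> \<beta>) ` H Y = (inv\<^bsub>A\<^esub> \<beta>) ` (\<beta> ` H Y)" using assms(2) by (simp add: supp_def)
  also have "\<dots> = (\<lambda>a. a) ` H Y"
    unfolding image_image by (rule image_cong) (use inv assms(3) in auto)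
  finally have "(inv\<^bsub>A\<^esub> \<beta>) ` H Y = H Y" by simp
  moreover have "(inv\<^bsub>A\<^esub> \<beta>) a = a" if "a \<in> H (X - Y)" for a
    using inv[of a "X - Y"] that assms(2) by (simp add: supp_def)
  ultimately show ?thesis by (simp add: supp_def)
qed

lemma finitary_autos_common_supp:
  assumes "finite D" "D \<subseteq> finitary_autos"
  shows "\<exists>Y\<subseteq>X. finite Y \<and> (\<forall>\<beta>\<in>D. supp \<beta> Y)"
  using assms
proof (induction D rule: finite_induct)
  case (insert \<beta> D)
  then obtain Y Z where Y: "Y \<subseteq> X" "finite Y" "\<forall>\<beta>\<in>D. supp \<beta> Y" and Z: "Z \<subseteq> X" "finite Z" "supp \<beta> Z"
    by (auto simp: finitary_autos_def)
  have "supp \<gamma> (Y \<union> Z)" if "\<gamma> \<in> insert \<beta> D" for \<gamma>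
  proof -
    have "\<gamma> \<in> auto G" using that insert.prems by (auto simp: finitary_autos_def)
    moreover have "supp \<gamma> Y \<or> supp \<gamma> Z" using that Y Z by blast
    ultimately show ?thesis
      using supp_mono[of \<gamma> Y "Y \<union> Z"] supp_mono[of \<gamma> Z "Y \<union> Z"] Y(1) Z(1) by blast
  qed
  then show ?case using Y Z by (intro exI[of _ "Y \<union> Z"]) simp
qed auto

lemma one_finitary: "\<one>\<^bsub>A\<^esub> \<in> finitary_autos"
proof -
  have "supp \<one>\<^bsub>A\<^esub> {}" using H_carrier[of X] by (auto simp: supp_def H_empty AutoGroup_one H_top)
  then show ?thesis using id_in_auto by (auto simp: finitary_autos_def AutoGroup_one)
qed

lemma subgroup_finitary_autos: "subgroup finitary_autos A"
proof (rule group.subgroupI[OF group_A])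
  show "finitary_autos \<subseteq> carrier A" by (auto simp: finitary_autos_def carrier_AutoGroup)
  show "finitary_autos \<noteq> {}" using one_finitary by blast
  show "inv\<^bsub>A\<^esub> \<beta> \<in> finitary_autos" if "\<beta> \<in> finitary_autos" for \<beta>
    using that supp_inv inv_AutoGroup_in by (auto simp: finitary_autos_def)
  show "\<beta> \<otimes>\<^bsub>A\<^esub> \<gamma> \<in> finitary_autos" if \<beta>\<gamma>: "\<beta> \<in> finitary_autos" "\<gamma> \<in> finitary_autos" for \<beta> \<gamma>
  proof -
    obtain Y where Y: "Y \<subseteq> X" "finite Y" "\<forall>\<delta>\<in>{\<beta>, \<gamma>}. supp \<delta> Y"
      using finitary_autos_common_supp[of "{\<beta>, \<gamma>}"] \<beta>\<gamma> by auto
    then show ?thesis using \<beta>\<gamma> supp_mult[of \<beta> \<gamma> Y] mult_AutoGroup_in by (auto simp: finitary_autos_def)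
  qed
qed

lemma monomial_auto: "monomial Q q \<Longrightarrow> Q \<in> auto G"
  and monomial_bij: "monomial Q q \<Longrightarrow> bij_betw q X X"
  and monomial_apply: "monomial Q q \<Longrightarrow> v \<in> X \<Longrightarrow> a \<in> H {v} \<Longrightarrow> Q a = c v (q v) a"
  by (simp_all add: monomial_def)

lemma monomial_perm_in: "monomial Q q \<Longrightarrow> v \<in> X \<Longrightarrow> q v \<in> X"
  using monomial_bij by (auto simp: bij_betw_def)

lemma H_point_carrier: "v \<in> X \<Longrightarrow> a \<in> H {v} \<Longrightarrow> a \<in> carrier G"
  using H_carrier[of "{v}"] by auto

lemma monomial_mult:
  assumes "monomial Q q" "monomial R r"
  shows "monomial (Q \<otimes>\<^bsub>A\<^esub> R) (q \<circ> r)"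
  unfolding monomial_def
proof (intro conjI ballI)
  show "Q \<otimes>\<^bsub>A\<^esub> R \<in> auto G" using assms mult_AutoGroup_in monomial_auto by blast
  show "bij_betw (q \<circ> r) X X" using assms monomial_bij bij_betw_trans by blast
  fix v a assume va: "v \<in> X" "a \<in> H {v}"
  have "r v \<in> X" "q (r v) \<in> X" using monomial_perm_in assms va by blast+
  then show "(Q \<otimes>\<^bsub>A\<^esub> R) a = c v ((q \<circ> r) v) a"
    using va assms AutoGroup_apply[OF monomial_auto[OF assms(1)] monomial_auto[OF assms(2)] H_point_carrier[OF va]]
    by (simp add: monomial_apply c_in c_trans)
qed

lemma monomial_inv:
  assumes "monomial Q q"
  shows "monomial (inv\<^bsub>A\<^esub> Q) (inv_into X q)"
  unfolding monomial_def
proof (intro conjI ballI)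
  have q: "inj_on q X" "q ` X = X" using monomial_bij[OF assms] by (auto simp: bij_betw_def)
  show "inv\<^bsub>A\<^esub> Q \<in> auto G" using assms inv_AutoGroup_in monomial_auto by blast
  show "bij_betw (inv_into X q) X X" using monomial_bij[OF assms] by (rule bij_betw_inv_into)
  fix v a assume va: "v \<in> X" "a \<in> H {v}"
  define w where "w = inv_into X q v"
  have w: "w \<in> X" "q w = v" using va q by (simp_all add: w_def inv_into_into f_inv_into_f)
  have "Q (c v w a) = a"
    using monomial_apply[OF assms w(1) c_in[OF va(1) w(1) va(2)]] w va by (simp add: c_trans c_refl)
  moreover have "c v w a \<in> carrier G" using c_in[OF va(1) w(1) va(2)] H_point_carrier w by blast
  ultimately show "(inv\<^bsub>A\<^esub> Q) a = c v (inv_into X q v) a"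
    using inv_AutoGroup_apply(1)[OF monomial_auto[OF assms], of "c v w a"] by (simp add: w_def)
qed

lemma monomial_unique:
  assumes "monomial Q q" "monomial R r" "\<And>v. v \<in> X \<Longrightarrow> q v = r v"
  shows "Q = R"
  using assms by (intro auto_eqI_points monomial_auto) (auto simp: monomial_apply)

lemma monomial_one: "monomial \<one>\<^bsub>A\<^esub> id"
  using id_in_auto H_point_carrier by (auto simp: monomial_def AutoGroup_one c_refl)

text \<open>On one vertex, c (q v) v inverts c v (q v), so Q carries L({v}) onto L({q v}). Both
  sides of the equation are generated by such vertex subgroups.\<close>

lemma monomial_image:
  assumes "monomial Q q" "Y \<subseteq> X"
  shows "Q ` H Y = H (q ` Y)"
proof -
  have qY: "q ` Y \<subseteq> X" using assms monomial_perm_in by blast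
  have "Q ` H {v} = H {q v}" if "v \<in> X" for v
  proof -
    have "q v \<in> X" using that assms monomial_perm_in by blast
    have "Q ` H {v} = c v (q v) ` H {v}" using monomial_apply[OF assms(1) that] by (rule image_cong[OF refl])
    also have "\<dots> = H {q v}"
    proof
      show "c v (q v) ` H {v} \<subseteq> H {q v}" using c_in that \<open>q v \<in> X\<close> by blast
      show "H {q v} \<subseteq> c v (q v) ` H {v}"
      proof
        fix a assume a: "a \<in> H {q v}"
        then have "a = c v (q v) (c (q v) v a)" using that \<open>q v \<in> X\<close> by (simp add: c_trans c_refl)
        moreover have "c (q v) v a \<in> H {v}" using a that \<open>q v \<in> X\<close> c_in by blast
        ultimately show "a \<in> c v (q v) ` H {v}" by (rule image_eqI)
      qed
    qed
    finally show ?thesis .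
  qed
  then have "Q ` (\<Union>v\<in>Y. H {v}) = (\<Union>v\<in>q ` Y. H {v})" using assms(2) unfolding image_UN by fastforce
  then show ?thesis
    using auto_image_generate[OF monomial_auto[OF assms(1)] points_carrier[OF assms(2)]]
    by (simp add: H_generate[OF assms(2)] H_generate[OF qY])
qed

lemma supp_conjugate:
  assumes "monomial Q q" "\<beta> \<in> auto G" "supp \<beta> Y" "Y \<subseteq> X"
  shows "supp (Q \<otimes>\<^bsub>A\<^esub> \<beta> \<otimes>\<^bsub>A\<^esub> inv\<^bsub>A\<^esub> Q) (q ` Y)"
proof -
  note Q = monomial_auto[OF assms(1)]
  have q: "inj_on q X" "q ` X = X" using monomial_bij[OF assms(1)] by (auto simp: bij_betw_def)
  have *: "(Q \<otimes>\<^bsub>A\<^esub> \<beta> \<otimes>\<^bsub>A\<^esub> inv\<^bsub>A\<^esub> Q) (Q a) = Q (\<beta> a)" if "a \<in> carrier G" for a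
    using that Q assms(2) mult_AutoGroup_in[OF Q assms(2)] inv_AutoGroup_in[OF Q] auto_in_carrier[OF Q that]
    by (simp add: AutoGroup_apply inv_AutoGroup_apply)
  have "(Q \<otimes>\<^bsub>A\<^esub> \<beta> \<otimes>\<^bsub>A\<^esub> inv\<^bsub>A\<^esub> Q) ` H (q ` Y) = (Q \<otimes>\<^bsub>A\<^esub> \<beta> \<otimes>\<^bsub>A\<^esub> inv\<^bsub>A\<^esub> Q) ` (Q ` H Y)"
    using monomial_image[OF assms(1,4)] by simp
  also have "\<dots> = Q ` (\<beta> ` H Y)"
    unfolding image_image by (rule image_cong) (use * H_carrier[OF assms(4)] in auto)
  also have "\<dots> = H (q ` Y)" using assms(3) monomial_image[OF assms(1,4)] by (simp add: supp_def)
  finally have 1: "(Q \<otimes>\<^bsub>A\<^esub> \<beta> \<otimes>\<^bsub>A\<^esub> inv\<^bsub>A\<^esub> Q) ` H (q ` Y) = H (q ` Y)" .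
  have "X - q ` Y = q ` (X - Y)" using inj_on_image_set_diff[OF q(1), of X Y] q(2) assms(4) by simp
  then have "H (X - q ` Y) = Q ` H (X - Y)" using monomial_image[OF assms(1), of "X - Y"] by simp
  moreover have "(Q \<otimes>\<^bsub>A\<^esub> \<beta> \<otimes>\<^bsub>A\<^esub> inv\<^bsub>A\<^esub> Q) (Q a) = Q a" if "a \<in> H (X - Y)" for a
    using * assms(3) that H_carrier[of "X - Y"] by (auto simp: supp_def)
  ultimately show ?thesis using 1 by (auto simp: supp_def)
qed

text \<open>It suffices to test on a in L({v}). If v is in Y, then a and \<beta>(a) both lie in
  L(Y), where Q is the identity. If v is not in Y, injectivity keeps q v outside Y, so \<beta> fixes
  both a and Q(a).\<close>

lemma monomial_commutes:
  assumes "monomial Q q" "\<beta> \<in> auto G" "supp \<beta> Y" "Y \<subseteq> X" and fixd: "\<And>v. v \<in> Y \<Longrightarrow> q v = v"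
  shows "Q \<otimes>\<^bsub>A\<^esub> \<beta> = \<beta> \<otimes>\<^bsub>A\<^esub> Q"
proof -
  note Q = monomial_auto[OF assms(1)]
  have q: "inj_on q X" "q ` X = X" using monomial_bij[OF assms(1)] by (auto simp: bij_betw_def)
  have Q_id: "Q a = a" if "a \<in> H Y" for a
  proof -
    have "Q a = (\<one>\<^bsub>A\<^esub>) a"
    proof (rule auto_eq_on_generate[OF Q _ points_carrier[OF assms(4)]])
      show "\<one>\<^bsub>A\<^esub> \<in> auto G" using id_in_auto by (simp add: AutoGroup_one)
      show "a \<in> generate G (\<Union>v\<in>Y. H {v})" using that H_generate[OF assms(4)] by simp
      fix b assume "b \<in> (\<Union>v\<in>Y. H {v})"
      then obtain v where v: "v \<in> Y" "b \<in> H {v}" by blast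
      then have "v \<in> X" using assms(4) by blast
      then show "Q b = \<one>\<^bsub>A\<^esub> b"
        using monomial_apply[OF assms(1) _ v(2)] fixd[OF v(1)] v c_refl H_point_carrier by (simp add: AutoGroup_one)
    qed
    also have "\<dots> = a" using that H_carrier[OF assms(4)] by (auto simp: AutoGroup_one)
    finally show ?thesis .
  qed
  show ?thesis
  proof (rule auto_eqI_points)
    show "Q \<otimes>\<^bsub>A\<^esub> \<beta> \<in> auto G" "\<beta> \<otimes>\<^bsub>A\<^esub> Q \<in> auto G" using Q assms(2) mult_AutoGroup_in by blast+
    fix v a assume va: "v \<in> X" "a \<in> H {v}"
    then have a: "a \<in> carrier G" by (rule H_point_carrier)
    have "Q (\<beta> a) = \<beta> (Q a)"
    proof (cases "v \<in> Y")
      case True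
      then have "a \<in> H Y" using H_mono[of "{v}" Y] va assms(4) by blast
      then show ?thesis using supp_in[OF assms(3)] Q_id by simp
    next
      case False
      then have "a \<in> H (X - Y)" using H_mono[of "{v}" "X - Y"] va by blast
      then have "\<beta> a = a" using assms(3) by (simp add: supp_def)
      have "q v \<in> X" using monomial_perm_in assms(1) va by blast
      moreover have "q v \<notin> Y"
      proof
        assume "q v \<in> Y"
        then have "q (q v) = q v" by (rule fixd)
        then have "q v = v" using q(1) va \<open>q v \<in> X\<close> by (simp add: inj_on_eq_iff)
        then show False using False \<open>q v \<in> Y\<close> by simp
      qed
      moreover have "Q a \<in> H {q v}" using monomial_apply[OF assms(1) va] c_in va \<open>q v \<in> X\<close> by simp
      ultimately have "Q a \<in> H (X - Y)" using H_mono[of "{q v}" "X - Y"] by blast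
      then have "\<beta> (Q a) = Q a" using assms(3) by (simp add: supp_def)
      with \<open>\<beta> a = a\<close> show ?thesis by simp
    qed
    then show "(Q \<otimes>\<^bsub>A\<^esub> \<beta>) a = (\<beta> \<otimes>\<^bsub>A\<^esub> Q) a" using Q assms(2) a by (simp add: AutoGroup_apply)
  qed
qed

lemma monomial_swap:
  assumes "u \<in> X" "w \<in> X" "u \<noteq> w"
  shows "\<exists>\<gamma>\<in>finitary_autos. monomial \<gamma> (Transposition.transpose u w)"
proof -
  obtain \<gamma> where \<gamma>: "\<gamma> \<in> auto G" "\<gamma> ` H {u, w} = H {u, w}" "\<forall>a\<in>H (X - {u, w}). \<gamma> a = a"
    "\<forall>a\<in>H {u}. \<gamma> a = c u w a" "\<forall>a\<in>H {w}. \<gamma> a = c w u a"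
    using swap[OF assms] by blast
  have "\<gamma> a = c v (Transposition.transpose u w v) a" if va: "v \<in> X" "a \<in> H {v}" for v a
  proof (cases "v \<in> {u, w}")
    case True
    then show ?thesis using \<gamma>(4,5) va by (auto simp: Transposition.transpose_def)
  next
    case False
    then have "a \<in> H (X - {u, w})" using H_mono[of "{v}" "X - {u, w}"] va by blast
    then show ?thesis using \<gamma>(3) False va c_refl by (simp add: Transposition.transpose_def)
  qed
  moreover have "bij_betw (Transposition.transpose u w) X X"
    by (rule permutes_imp_bij[OF permutes_swap_id[OF assms(1,2)]])
  ultimately have "monomial \<gamma> (Transposition.transpose u w)" using \<gamma>(1) by (simp add: monomial_def)
  moreover have "\<gamma> \<in> finitary_autos"
    using \<gamma>(1-3) assms by (auto simp: finitary_autos_def supp_def intro!: exI[of _ "{u, w}"])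
  ultimately show ?thesis by blast
qed

lemma monomial_exists:
  assumes "p permutes Z" "finite Z" "Z \<subseteq> X"
  shows "\<exists>P\<in>finitary_autos. monomial P p"
  using assms(1,2)
proof (induction rule: permutes_induct)
  case id
  then show ?case using one_finitary monomial_one by blast
next
  case (swap a b p)
  then obtain P where P: "P \<in> finitary_autos" "monomial P p" by blast
  have "a \<in> X" "b \<in> X" using swap assms(3) by auto
  then obtain \<gamma> where "\<gamma> \<in> finitary_autos" "monomial \<gamma> (Transposition.transpose a b)"
    using monomial_swap \<open>a \<noteq> b\<close> by blast
  then show ?case
    using P monomial_mult subgroup.m_closed[OF subgroup_finitary_autos] by blast
qed

text \<open>The quotient Q of P' U by P is again monomial, and its permutation fixes Y pointwise, so
  it commutes with \<gamma> and cancels from the conjugation by P' U = P Q.\<close>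

lemma conjugate_eq:
  assumes "monomial P p" "monomial P' p'" "monomial U u" "\<gamma> \<in> auto G" "supp \<gamma> Y" "Y \<subseteq> X"
    and eq: "\<And>x. x \<in> Y \<Longrightarrow> p' (u x) = p x"
  shows "P' \<otimes>\<^bsub>A\<^esub> (U \<otimes>\<^bsub>A\<^esub> \<gamma> \<otimes>\<^bsub>A\<^esub> inv\<^bsub>A\<^esub> U) \<otimes>\<^bsub>A\<^esub> inv\<^bsub>A\<^esub> P' = P \<otimes>\<^bsub>A\<^esub> \<gamma> \<otimes>\<^bsub>A\<^esub> inv\<^bsub>A\<^esub> P"
proof -
  interpret A: group A by (rule group_A)
  have carr: "P \<in> carrier A" "P' \<in> carrier A" "U \<in> carrier A" "\<gamma> \<in> carrier A"
    using assms monomial_auto by (simp_all add: carrier_AutoGroup)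
  define Q where "Q = inv\<^bsub>A\<^esub> P \<otimes>\<^bsub>A\<^esub> (P' \<otimes>\<^bsub>A\<^esub> U)"
  have Q: "monomial Q (inv_into X p \<circ> (p' \<circ> u))"
    unfolding Q_def
    by (rule monomial_mult[OF monomial_inv[OF assms(1)] monomial_mult[OF assms(2,3)]])
  have inj: "inj_on p X" using monomial_bij[OF assms(1)] by (simp add: bij_betw_def)
  have "Q \<otimes>\<^bsub>A\<^esub> \<gamma> = \<gamma> \<otimes>\<^bsub>A\<^esub> Q"
    by (rule monomial_commutes[OF Q assms(4-6)]) (use eq inj assms(6) in auto)
  moreover have Qc: "Q \<in> carrier A" using carr by (simp add: Q_def)
  moreover have PQ: "P \<otimes>\<^bsub>A\<^esub> Q = P' \<otimes>\<^bsub>A\<^esub> U" using carr by (simp add: Q_def flip: A.m_assoc)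
  moreover have "P' \<otimes>\<^bsub>A\<^esub> (U \<otimes>\<^bsub>A\<^esub> \<gamma> \<otimes>\<^bsub>A\<^esub> inv\<^bsub>A\<^esub> U) \<otimes>\<^bsub>A\<^esub> inv\<^bsub>A\<^esub> P' =
      (P' \<otimes>\<^bsub>A\<^esub> U) \<otimes>\<^bsub>A\<^esub> \<gamma> \<otimes>\<^bsub>A\<^esub> inv\<^bsub>A\<^esub> (P' \<otimes>\<^bsub>A\<^esub> U)"
    using carr by (simp add: A.m_assoc A.inv_mult_group)
  moreover have "(P \<otimes>\<^bsub>A\<^esub> Q) \<otimes>\<^bsub>A\<^esub> \<gamma> \<otimes>\<^bsub>A\<^esub> inv\<^bsub>A\<^esub> (P \<otimes>\<^bsub>A\<^esub> Q) =
      P \<otimes>\<^bsub>A\<^esub> (Q \<otimes>\<^bsub>A\<^esub> \<gamma>) \<otimes>\<^bsub>A\<^esub> (inv\<^bsub>A\<^esub> Q \<otimes>\<^bsub>A\<^esub> inv\<^bsub>A\<^esub> P)"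
    using carr Qc by (simp add: A.m_assoc A.inv_mult_group)
  moreover have "P \<otimes>\<^bsub>A\<^esub> (\<gamma> \<otimes>\<^bsub>A\<^esub> Q) \<otimes>\<^bsub>A\<^esub> (inv\<^bsub>A\<^esub> Q \<otimes>\<^bsub>A\<^esub> inv\<^bsub>A\<^esub> P) = P \<otimes>\<^bsub>A\<^esub> \<gamma> \<otimes>\<^bsub>A\<^esub> inv\<^bsub>A\<^esub> P"
  proof -
    have "Q \<otimes>\<^bsub>A\<^esub> (inv\<^bsub>A\<^esub> Q \<otimes>\<^bsub>A\<^esub> inv\<^bsub>A\<^esub> P) = inv\<^bsub>A\<^esub> P" using carr Qc by (simp flip: A.m_assoc)
    then show ?thesis using carr Qc by (simp add: A.m_assoc)
  qed
  ultimately show ?thesis by simp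
qed

end

text \<open>The common consequence of soficness of an action on a set and on a graph: edges are
  forgotten, and the action axioms are kept as a separate assumption.\<close>

definition orbit_approximable :: "'a monoid \<Rightarrow> 'x set \<Rightarrow> ('a \<Rightarrow> 'x \<Rightarrow> 'x) \<Rightarrow> bool" where
  "orbit_approximable \<Gamma> X \<alpha> \<longleftrightarrow>
     (\<forall>F E \<epsilon>. F \<subseteq> carrier \<Gamma> \<and> finite F \<and> E \<subseteq> X \<and> finite E \<and> \<epsilon> > 0 \<longrightarrow>
        (\<exists>A. finite A \<and> (\<exists>\<phi>\<in>carrier \<Gamma> \<rightarrow> carrier (BijGroup A).
           unital \<Gamma> (BijGroup A) \<phi> \<and>
           almost_multiplicative \<Gamma> (BijGroup A) (hamming A) F \<epsilon> \<phi> \<and>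
           set_orbit_approx \<Gamma> \<alpha> F E \<epsilon> A \<phi>)))"

text \<open>U g stands for the automorphism of L(X) induced by \<alpha>(g). Functoriality is
  represented by the sole demand that it move vertex subgroups canonically.\<close>

locale monomial_action = monomial_halo X G H c + group_action \<Gamma> X \<alpha>
  for X :: "'x set" and G :: "'g monoid" and H c and \<Gamma> :: "'a monoid" and \<alpha> +
  fixes U :: "'a \<Rightarrow> 'g \<Rightarrow> 'g"
  assumes monomial_U: "\<And>g. g \<in> carrier \<Gamma> \<Longrightarrow> monomial (U g) (\<alpha> g)"

context monomial_action
begin

abbreviation "N \<equiv> A\<lparr>carrier := finitary_autos\<rparr>"

abbreviation "\<theta> \<equiv> (\<lambda>g \<beta>. U g \<otimes>\<^bsub>A\<^esub> \<beta> \<otimes>\<^bsub>A\<^esub> inv\<^bsub>A\<^esub> U g)"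

lemma group_\<Gamma>: "group \<Gamma>"
  using group_hom by (simp add: group_hom_def)

lemma group_N: "group N"
  by (rule subgroup.subgroup_is_group[OF subgroup_finitary_autos group_A])

lemma act_mult:
  "g \<in> carrier \<Gamma> \<Longrightarrow> h \<in> carrier \<Gamma> \<Longrightarrow> x \<in> X \<Longrightarrow> \<alpha> (g \<otimes>\<^bsub>\<Gamma>\<^esub> h) x = \<alpha> g (\<alpha> h x)"
  by (rule composition_rule)

lemma U_auto: "g \<in> carrier \<Gamma> \<Longrightarrow> U g \<in> auto G"
  using monomial_U monomial_auto by blast

text \<open>Both sides are monomial over the same permutation of X, and the permutation determines
  the automorphism.\<close>

lemma U_mult:
  assumes "g \<in> carrier \<Gamma>" "h \<in> carrier \<Gamma>"
  shows "U (g \<otimes>\<^bsub>\<Gamma>\<^esub> h) = U g \<otimes>\<^bsub>A\<^esub> U h"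
proof (rule monomial_unique)
  show "monomial (U (g \<otimes>\<^bsub>\<Gamma>\<^esub> h)) (\<alpha> (g \<otimes>\<^bsub>\<Gamma>\<^esub> h))"
    using assms group_\<Gamma> by (intro monomial_U) (simp add: group.is_monoid monoid.m_closed)
  show "monomial (U g \<otimes>\<^bsub>A\<^esub> U h) (\<alpha> g \<circ> \<alpha> h)" using assms by (intro monomial_mult monomial_U)
qed (simp add: act_mult assms)

lemma U_one: "U \<one>\<^bsub>\<Gamma>\<^esub> = \<one>\<^bsub>A\<^esub>"
proof (rule monomial_unique[OF _ monomial_one])
  show "monomial (U \<one>\<^bsub>\<Gamma>\<^esub>) (\<alpha> \<one>\<^bsub>\<Gamma>\<^esub>)"
    using group_\<Gamma> by (intro monomial_U) (simp add: group.is_monoid)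
  show "\<alpha> \<one>\<^bsub>\<Gamma>\<^esub> v = id v" if "v \<in> X" for v using id_eq_one that by (metis id_apply restrict_apply')
qed

lemma \<theta>_finitary:
  assumes "g \<in> carrier \<Gamma>" "\<beta> \<in> finitary_autos"
  shows "\<theta> g \<beta> \<in> finitary_autos"
proof -
  obtain Y where Y: "\<beta> \<in> auto G" "Y \<subseteq> X" "finite Y" "supp \<beta> Y"
    using assms(2) by (auto simp: finitary_autos_def)
  have "supp (\<theta> g \<beta>) (\<alpha> g ` Y)"
    by (rule supp_conjugate[OF monomial_U[OF assms(1)] Y(1,4,2)])
  moreover have "\<alpha> g ` Y \<subseteq> X" using monomial_perm_in[OF monomial_U[OF assms(1)]] Y(2) by blast
  moreover have "\<theta> g \<beta> \<in> auto G"
    using U_auto[OF assms(1)] Y(1) by (intro mult_AutoGroup_in inv_AutoGroup_in)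
  ultimately show ?thesis using Y(3) by (auto simp: finitary_autos_def)
qed

lemma finitary_carrier_A: "\<beta> \<in> finitary_autos \<Longrightarrow> \<beta> \<in> carrier A"
  using subgroup.subset[OF subgroup_finitary_autos] by blast

lemma group_semidirect: "group (semidirect_product N \<Gamma> \<theta>)"
proof (rule group_semidirect_product[OF group_N group_\<Gamma>])
  interpret A: group A by (rule group_A)
  have U: "g \<in> carrier \<Gamma> \<Longrightarrow> U g \<in> carrier A" for g using U_auto by (simp add: carrier_AutoGroup)
  show "\<theta> \<one>\<^bsub>\<Gamma>\<^esub> x = x" if "x \<in> carrier N" for x
    using that finitary_carrier_A by (simp add: U_one)
  fix g assume g: "g \<in> carrier \<Gamma>"
  fix x assume "x \<in> carrier N"
  then have x: "x \<in> finitary_autos" "x \<in> carrier A" using finitary_carrier_A by auto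
  show "\<theta> g x \<in> carrier N" using \<theta>_finitary[OF g x(1)] by simp
  show "\<theta> g (x \<otimes>\<^bsub>N\<^esub> y) = \<theta> g x \<otimes>\<^bsub>N\<^esub> \<theta> g y" if "y \<in> carrier N" for y
  proof -
    have y: "y \<in> carrier A" using that finitary_carrier_A by simp
    have "inv\<^bsub>A\<^esub> U g \<otimes>\<^bsub>A\<^esub> (U g \<otimes>\<^bsub>A\<^esub> z) = z" if "z \<in> carrier A" for z
      using U[OF g] that by (simp flip: A.m_assoc)
    then show ?thesis using U[OF g] x y by (simp add: A.m_assoc)
  qed
  show "\<theta> (g \<otimes>\<^bsub>\<Gamma>\<^esub> h) x = \<theta> g (\<theta> h x)" if "h \<in> carrier \<Gamma>" for h
    using g that U[OF g] U[OF that] x by (simp add: U_mult A.m_assoc A.inv_mult_group)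
qed

lemma inv_N: "\<beta> \<in> finitary_autos \<Longrightarrow> inv\<^bsub>N\<^esub> \<beta> = inv\<^bsub>A\<^esub> \<beta>"
  by (rule group.m_inv_consistent[OF group_A subgroup_finitary_autos])

text \<open>\<Gamma> acts on the permutations s of X by composing with \<alpha>(g) on the left. The
  conjugator at s is monomial over the inverse of s; as the inverse of \<alpha>(g) s composed with
  \<alpha>(g) is the inverse of s, the conjugation equation holds at every s and all errors
  vanish.\<close>

lemma sofically_inner_finite:
  assumes "finite X"
  shows "sofically_inner TYPE('x \<Rightarrow> 'x) N \<Gamma> \<theta>"
  unfolding sofically_inner_def
proof (intro allI impI, goal_cases)
  case *: (1 F E \<epsilon>)
  define S where "S = {s. s permutes X}"
  \<comment> \<open>Outside X the value is x because \<open>permutes\<close> asks for the identity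
    there.\<close>
  define \<phi> where "\<phi> g s x = (if x \<in> X then \<alpha> g (s x) else x)" for g and s :: "'x \<Rightarrow> 'x" and x
  have S: "finite S" "id \<in> S" using assms finite_permutations by (auto simp: S_def permutes_id)
  have sX: "s x \<in> X" if "s \<in> S" "x \<in> X" for s x using that by (auto simp: S_def permutes_in_image)
  have \<alpha>_bij: "bij_betw (\<alpha> g) X X" if "g \<in> carrier \<Gamma>" for g using monomial_U[OF that] by (rule monomial_bij)
  have \<phi>_in: "\<phi> g s \<in> S" if "g \<in> carrier \<Gamma>" "s \<in> S" for g s
  proof -
    have "bij_betw (\<alpha> g \<circ> s) X X"
      using that \<alpha>_bij by (auto simp: S_def intro: bij_betw_trans permutes_imp_bij)
    then have "bij_betw (\<phi> g s) X X" by (subst bij_betw_cong[of X _ "\<alpha> g \<circ> s"]) (auto simp: \<phi>_def)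
    then show ?thesis unfolding S_def by (auto intro: bij_imp_permutes simp: \<phi>_def)
  qed
  have \<phi>_mult: "\<phi> (g \<otimes>\<^bsub>\<Gamma>\<^esub> h) s = \<phi> g (\<phi> h s)" if "g \<in> carrier \<Gamma>" "h \<in> carrier \<Gamma>" "s \<in> S" for g h s
    using that sX by (auto simp: \<phi>_def act_mult)
  have \<phi>_bij: "bij_betw (\<phi> g) S S" if "g \<in> carrier \<Gamma>" for g
  proof -
    have "inj_on (\<phi> g) S"
    proof (rule inj_onI)
      fix s t assume st: "s \<in> S" "t \<in> S" and eq: "\<phi> g s = \<phi> g t"
      show "s = t"
      proof
        fix x
        show "s x = t x"
        proof (cases "x \<in> X")
          case True
          then have "\<alpha> g (s x) = \<alpha> g (t x)" using fun_cong[OF eq, of x] by (simp add: \<phi>_def)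
          then show ?thesis using \<alpha>_bij[OF that] sX[OF _ True] st by (auto simp: bij_betw_def inj_on_eq_iff)
        next
          case False
          then show ?thesis using st by (simp add: S_def permutes_not_in)
        qed
      qed
    qed
    moreover have "\<phi> g ` S \<subseteq> S" using \<phi>_in[OF that] by blast
    ultimately show ?thesis using S(1) by (simp add: bij_betw_def endo_inj_surj)
  qed
  have "\<forall>s\<in>S. \<exists>P\<in>finitary_autos. monomial P (inv_into UNIV s)"
    using monomial_exists[OF permutes_inv assms subset_refl] by (auto simp: S_def)
  then obtain P where P: "\<And>s. s \<in> S \<Longrightarrow> P s \<in> finitary_autos" "\<And>s. s \<in> S \<Longrightarrow> monomial (P s) (inv_into UNIV s)"
    by metis
  show ?case
  proof (intro exI[of _ S] exI[of _ \<phi>] exI[of _ P] conjI ballI impI)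
    show "finite S" "S \<noteq> {}" using S by auto
    show "bij_betw (\<phi> g) S S" if "g \<in> carrier \<Gamma>" for g by (rule \<phi>_bij[OF that])
    show "\<phi> \<one>\<^bsub>\<Gamma>\<^esub> s = s" if "s \<in> S" for s
    proof
      fix x
      have "\<alpha> \<one>\<^bsub>\<Gamma>\<^esub> y = y" if "y \<in> X" for y using id_eq_one that by (metis restrict_apply')
      then show "\<phi> \<one>\<^bsub>\<Gamma>\<^esub> s x = s x" using that sX by (auto simp: \<phi>_def S_def permutes_not_in)
    qed
    fix g assume g: "g \<in> F"
    then have g': "g \<in> carrier \<Gamma>" using * by blast
    show "real (card {s \<in> S. \<phi> (g \<otimes>\<^bsub>\<Gamma>\<^esub> h) s \<noteq> \<phi> g (\<phi> h s)}) \<le> \<epsilon> * real (card S)" if "h \<in> F" for h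
    proof -
      have "h \<in> carrier \<Gamma>" using that * by blast
      then have "{s \<in> S. \<phi> (g \<otimes>\<^bsub>\<Gamma>\<^esub> h) s \<noteq> \<phi> g (\<phi> h s)} = {}" using \<phi>_mult[OF g'] by blast
      then have "card {s \<in> S. \<phi> (g \<otimes>\<^bsub>\<Gamma>\<^esub> h) s \<noteq> \<phi> g (\<phi> h s)} = 0" by (simp only: card.empty)
      then show ?thesis using * by simp
    qed
    fix x s assume x: "x \<in> E" and s: "s \<in> S"
    have "x \<in> finitary_autos" using x * by auto
    then obtain Y where Y: "x \<in> auto G" "Y \<subseteq> X" "supp x Y" by (auto simp: finitary_autos_def)
    have "inv_into UNIV (\<phi> g s) (\<alpha> g y) = inv_into UNIV s y" if "y \<in> Y" for y
    proof -
      have y: "y \<in> X" using that Y by blast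
      define z where "z = inv_into UNIV s y"
      have "z \<in> X" "s z = y"
        using s y permutes_inverses(1)[of s X y] permutes_in_image[OF permutes_inv, of s X y]
        by (auto simp: z_def S_def)
      then have "\<phi> g s z = \<alpha> g y" by (simp add: \<phi>_def)
      moreover have "\<phi> g s permutes X" using \<phi>_in[OF g' s] by (simp add: S_def)
      ultimately show ?thesis by (metis permutes_inverses(2) z_def)
    qed
    then show "P (\<phi> g s) \<otimes>\<^bsub>N\<^esub> \<theta> g x \<otimes>\<^bsub>N\<^esub> inv\<^bsub>N\<^esub> P (\<phi> g s) = P s \<otimes>\<^bsub>N\<^esub> x \<otimes>\<^bsub>N\<^esub> inv\<^bsub>N\<^esub> P s"
      using conjugate_eq[OF P(2)[OF s] P(2)[OF \<phi>_in[OF g' s]] monomial_U[OF g'] Y(1,3,2)]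
      by (simp add: inv_N P(1) s \<phi>_in[OF g' s])
  qed (use * P in auto)
qed

lemma sofically_inner_infinite:
  assumes "infinite X"
    and sofic: "orbit_approximable \<Gamma> X \<alpha>"
  shows "sofically_inner TYPE(nat) N \<Gamma> \<theta>"
  unfolding sofically_inner_def
proof (intro allI impI, goal_cases)
  case *: (1 F D \<epsilon>)
  interpret \<Gamma>: group \<Gamma> by (rule group_\<Gamma>)
  obtain Y where Y: "Y \<subseteq> X" "finite Y" "\<forall>\<beta>\<in>D. supp \<beta> Y"
    using finitary_autos_common_supp[of D] * by auto
  \<comment> \<open>The orbit condition at \<alpha>(g)y needs both this point and its preimage y in
    E, for every y in the common support Y.\<close>
  define E where "E = Y \<union> (\<Union>g\<in>F. \<alpha> g ` Y)"
  have \<alpha>_in: "\<alpha> g x \<in> X" if "g \<in> carrier \<Gamma>" "x \<in> X" for g x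
    using monomial_perm_in[OF monomial_U[OF that(1)] that(2)] .
  have E: "E \<subseteq> X" "finite E" using Y * \<alpha>_in by (auto simp: E_def subset_iff)
  obtain B \<phi> where B: "finite B" and \<phi>: "\<phi> \<in> carrier \<Gamma> \<rightarrow> carrier (BijGroup B)" "unital \<Gamma> (BijGroup B) \<phi>"
    "almost_multiplicative \<Gamma> (BijGroup B) (hamming B) F \<epsilon> \<phi>" "set_orbit_approx \<Gamma> \<alpha> F E \<epsilon> B \<phi>"
    using sofic[unfolded orbit_approximable_def, rule_format, of F E \<epsilon>] * E by blast
  obtain C :: "nat set" and S \<pi> where C: "finite C" and S: "S \<subseteq> B" "real (card S) > (1 - \<epsilon>) * real (card B)"
    and \<pi>: "\<forall>s\<in>S. \<pi> s \<in> injections E C" and compat: "orbit_compatible \<Gamma> \<alpha> F E \<phi> S \<pi>"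
    using \<phi>(4) unfolding set_orbit_approx_def by blast
  \<comment> \<open>The strict lower bound on the size of S excludes the empty index set.\<close>
  have "B \<noteq> {}" using S by auto
  have cB: "real (card B) > 0" using B \<open>B \<noteq> {}\<close> by (simp add: card_gt_0_iff)
  have \<phi>_bij: "bij_betw (\<phi> g) B B" if "g \<in> carrier \<Gamma>" for g
    using \<phi>(1) that by (auto simp: BijGroup_def Bij_def Pi_iff)
  have "\<exists>Z\<subseteq>X. finite Z \<and> card Z = card C" using infinite_arbitrarily_large[OF assms(1)] by blast
  then obtain Z where Z: "Z \<subseteq> X" "finite Z" "card Z = card C" by blast
  then obtain \<iota> where \<iota>: "bij_betw \<iota> C Z" using finite_same_card_bij[OF C Z(2)] by auto
  \<comment> \<open>Outside S the conjugator is arbitrary, and 1 is taken.\<close>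
  have "\<exists>P p. P \<in> finitary_autos \<and> monomial P p \<and> (s \<in> S \<longrightarrow> (\<forall>x\<in>E. p x = \<iota> (\<pi> s x)))" for s
  proof (cases "s \<in> S")
    case True
    let ?j = "\<lambda>x. \<iota> (\<pi> s x)"
    have \<pi>s: "inj_on (\<pi> s) E" "\<pi> s ` E \<subseteq> C" using \<pi> True by (auto simp: injections_def)
    have "inj_on ?j E" using \<pi>s \<iota> by (auto simp: bij_betw_def inj_on_def subset_iff)
    then obtain p where p: "p permutes (E \<union> ?j ` E)" "\<forall>x\<in>E. p x = ?j x"
      using inj_on_extends_to_permutation[OF E(2)] by blast
    have "?j ` E \<subseteq> X" using \<pi>s \<iota> Z(1) by (auto simp: bij_betw_def subset_iff)
    then obtain P where "P \<in> finitary_autos" "monomial P p"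
      using monomial_exists[OF p(1)] E by auto
    then show ?thesis using p(2) by blast
  next
    case False
    then show ?thesis using one_finitary monomial_one by blast
  qed
  then obtain P p where P: "\<And>s. P s \<in> finitary_autos" "\<And>s. monomial (P s) (p s)"
    and p: "\<And>s x. s \<in> S \<Longrightarrow> x \<in> E \<Longrightarrow> p s x = \<iota> (\<pi> s x)"
    by metis
  show ?case
  proof (rule exI[of _ B], rule exI[of _ \<phi>], rule exI[of _ S], rule exI[of _ P], intro conjI ballI impI)
    show "\<phi> \<one>\<^bsub>\<Gamma>\<^esub> s = s" if "s \<in> B" for s using \<phi>(2) that by (simp add: unital_def BijGroup_def)
    show "real (card (B - S)) \<le> \<epsilon> * real (card B)"
      using S B by (simp add: card_Diff_subset finite_subset card_mono of_nat_diff algebra_simps)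
    fix g assume g: "g \<in> F"
    then have g': "g \<in> carrier \<Gamma>" using * by blast
    show "real (card {s \<in> B. \<phi> (g \<otimes>\<^bsub>\<Gamma>\<^esub> h) s \<noteq> \<phi> g (\<phi> h s)}) \<le> \<epsilon> * real (card B)"
      if h: "h \<in> F" "g \<otimes>\<^bsub>\<Gamma>\<^esub> h \<in> F" for h
    proof -
      have h': "h \<in> carrier \<Gamma>" using h * by blast
      have Bij: "\<phi> g \<in> Bij B" "\<phi> h \<in> Bij B" using \<phi>(1) g' h' by (auto simp: BijGroup_def Pi_iff)
      have "{s \<in> B. \<phi> (g \<otimes>\<^bsub>\<Gamma>\<^esub> h) s = (\<phi> g \<otimes>\<^bsub>BijGroup B\<^esub> \<phi> h) s} = {s \<in> B. \<phi> (g \<otimes>\<^bsub>\<Gamma>\<^esub> h) s = \<phi> g (\<phi> h s)}"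
        using Bij by (auto simp: BijGroup_def compose_def)
      moreover have "hamming B (\<phi> (g \<otimes>\<^bsub>\<Gamma>\<^esub> h)) (\<phi> g \<otimes>\<^bsub>BijGroup B\<^esub> \<phi> h) < \<epsilon>"
        using \<phi>(3) g h by (simp add: almost_multiplicative_def)
      ultimately have "1 - real (card {s \<in> B. \<phi> (g \<otimes>\<^bsub>\<Gamma>\<^esub> h) s = \<phi> g (\<phi> h s)}) / real (card B) < \<epsilon>"
        by (simp add: hamming_def)
      then have "real (card B) - real (card {s \<in> B. \<phi> (g \<otimes>\<^bsub>\<Gamma>\<^esub> h) s = \<phi> g (\<phi> h s)}) < \<epsilon> * real (card B)"
        using cB by (simp add: field_simps)
      moreover have "card B = card {s \<in> B. \<phi> (g \<otimes>\<^bsub>\<Gamma>\<^esub> h) s = \<phi> g (\<phi> h s)} +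
          card {s \<in> B. \<phi> (g \<otimes>\<^bsub>\<Gamma>\<^esub> h) s \<noteq> \<phi> g (\<phi> h s)}"
        using B by (subst card_Un_disjoint[symmetric]) (auto intro!: arg_cong[of _ _ card])
      ultimately show ?thesis by linarith
    qed
    fix x s assume x: "x \<in> D" and s: "s \<in> S" and gs: "\<phi> g s \<in> S"
    have x': "x \<in> auto G" "supp x Y" using x * Y(3) by (auto simp: finitary_autos_def)
    have "p (\<phi> g s) (\<alpha> g y) = p s y" if "y \<in> Y" for y
    proof -
      have y: "y \<in> X" "y \<in> E" "\<alpha> g y \<in> E" using that Y(1) g by (auto simp: E_def)
      have "\<alpha> (inv\<^bsub>\<Gamma>\<^esub> g) (\<alpha> g y) = y"
        using act_mult[of "inv\<^bsub>\<Gamma>\<^esub> g" g y] g' y(1) id_eq_one by (metis \<Gamma>.inv_closed \<Gamma>.l_inv restrict_apply')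
      then have "\<pi> (\<phi> g s) (\<alpha> g y) = \<pi> s y"
        using compat g s gs y unfolding orbit_compatible_def by metis
      then show ?thesis using p s gs y by simp
    qed
    then show "P (\<phi> g s) \<otimes>\<^bsub>N\<^esub> \<theta> g x \<otimes>\<^bsub>N\<^esub> inv\<^bsub>N\<^esub> P (\<phi> g s) = P s \<otimes>\<^bsub>N\<^esub> x \<otimes>\<^bsub>N\<^esub> inv\<^bsub>N\<^esub> P s"
      using conjugate_eq[OF P(2)[of s] P(2)[of "\<phi> g s"] monomial_U[OF g'] x' Y(1)]
      by (simp add: inv_N P(1))
  qed (use B S \<open>B \<noteq> {}\<close> \<phi>_bij P in auto)
qed

end

section \<open>Residual finiteness of automorphism groups\<close>

text \<open>A homomorphism is determined by its values on the generators S, and an extensional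
  function by its values on the carrier, so restriction to S is injective.\<close>

lemma finite_extensional_homs:
  assumes "group K" "group Q" "finite (carrier Q)" "finite S" "S \<subseteq> carrier K" "generate K S = carrier K"
  shows "finite {h \<in> extensional (carrier K). h \<in> hom K Q}"
proof (rule inj_on_finite)
  let ?P = "{h \<in> extensional (carrier K). h \<in> hom K Q}"
  show "finite (S \<rightarrow>\<^sub>E carrier Q)" using assms by (simp add: finite_PiE)
  show "(\<lambda>h. restrict h S) ` ?P \<subseteq> S \<rightarrow>\<^sub>E carrier Q"
    using assms(5) by (auto simp: hom_def Pi_iff)
  show "inj_on (\<lambda>h. restrict h S) ?P"
  proof (rule inj_onI)
    fix h k assume hk: "h \<in> ?P" "k \<in> ?P" and eq: "restrict h S = restrict k S"
    have hom: "group_hom K Q h" "group_hom K Q k"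
      using hk assms by (simp_all add: group_hom_def group_hom_axioms_def)
    interpret h: group_hom K Q h by (rule hom(1))
    interpret k: group_hom K Q k by (rule hom(2))
    have on_S: "h a = k a" if "a \<in> S" for a using fun_cong[OF eq, of a] that by simp
    have "h a = k a" if "a \<in> generate K S" for a
      using that
    proof (induction rule: generate.induct)
      case (inv b)
      then have "b \<in> carrier K" using assms(5) by blast
      then show ?case using on_S[OF inv] by simp
    next
      case (eng a b)
      then have "a \<in> carrier K" "b \<in> carrier K" using group.generate_in_carrier[OF assms(1,5)] by blast+
      then show ?case using eng.IH by simp
    qed (simp_all add: on_S)
    then show "h = k" using hk assms(6) by (intro extensionalityI[of _ "carrier K"]) auto
  qed
qed

context monomial_halo
begin

lemma auto_eq_one_if_supp:
  assumes "\<beta> \<in> auto G" "supp \<beta> Y" "Y \<subseteq> X" "\<And>a. a \<in> H Y \<Longrightarrow> \<beta> a = a"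
  shows "\<beta> = \<one>\<^bsub>A\<^esub>"
proof (rule auto_eqI_points[OF assms(1)])
  show "\<one>\<^bsub>A\<^esub> \<in> auto G" using id_in_auto by (simp add: AutoGroup_one)
  fix v a assume va: "v \<in> X" "a \<in> H {v}"
  have "\<beta> a = a"
  proof (cases "v \<in> Y")
    case True
    then show ?thesis using assms(4) H_mono[of "{v}" Y] assms(3) va by blast
  next
    case False
    then have "a \<in> H (X - Y)" using H_mono[of "{v}" "X - Y"] va by blast
    then show ?thesis using assms(2) by (simp add: supp_def)
  qed
  then show "\<beta> a = \<one>\<^bsub>A\<^esub> a" using H_point_carrier[OF va] by (simp add: AutoGroup_one)
qed

text \<open>The automorphisms supported in \<open>Y\<close> permute the homomorphisms from \<open>H Y\<close> to a fixed finite
  group, of which there are finitely many; the image of this action, acting on itself by left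
  multiplication, is the finite quotient that is needed.\<close>

lemma finitary_autos_locally_residually_finite:
  assumes fg: "\<And>Y. Y \<subseteq> X \<Longrightarrow> finite Y \<Longrightarrow> \<exists>S\<subseteq>H Y. finite S \<and> generate G S = H Y"
    and rf: "\<And>Y a. Y \<subseteq> X \<Longrightarrow> finite Y \<Longrightarrow> a \<in> H Y \<Longrightarrow> a \<noteq> \<one>\<^bsub>G\<^esub> \<Longrightarrow>
      \<exists>(Q :: 'q monoid) p. group Q \<and> finite (carrier Q) \<and> p \<in> hom (G\<lparr>carrier := H Y\<rparr>) Q \<and> p a \<noteq> \<one>\<^bsub>Q\<^esub>"
    and F: "F \<subseteq> finitary_autos" "finite F"
  shows "\<exists>(J :: (('g \<Rightarrow> 'q) \<Rightarrow> ('g \<Rightarrow> 'q)) set) \<tau>. finite J \<and> J \<noteq> {} \<and>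
       (\<forall>g\<in>finitary_autos. bij_betw (\<tau> g) J J) \<and> (\<forall>j\<in>J. \<tau> \<one>\<^bsub>A\<^esub> j = j) \<and>
       (\<forall>g\<in>F. \<forall>h\<in>F. \<forall>j\<in>J. g \<otimes>\<^bsub>A\<^esub> h \<in> F \<longrightarrow> \<tau> (g \<otimes>\<^bsub>A\<^esub> h) j = \<tau> g (\<tau> h j)) \<and>
       (\<forall>g\<in>F. \<forall>j\<in>J. g \<noteq> \<one>\<^bsub>A\<^esub> \<longrightarrow> \<tau> g j \<noteq> j)"
proof -
  interpret A: group A by (rule group_A)
  obtain Y where Y: "Y \<subseteq> X" "finite Y" "\<forall>\<beta>\<in>F. supp \<beta> Y"
    using finitary_autos_common_supp[OF F(2,1)] by blast
  obtain S where S: "S \<subseteq> H Y" "finite S" "generate G S = H Y" using fg[OF Y(1,2)] by blast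
  note HY = H_subgroup[OF Y(1)]
  define K where "K = G\<lparr>carrier := H Y\<rparr>"
  have K: "group K" unfolding K_def by (rule subgroup.subgroup_is_group[OF HY is_group])
  have carrK: "carrier K = H Y" and multK: "x \<otimes>\<^bsub>K\<^esub> y = x \<otimes>\<^bsub>G\<^esub> y" for x y by (simp_all add: K_def)
  have genK: "generate K S = carrier K"
    using generate_consistent[OF S(1) HY] S(3) by (simp add: K_def)
  \<comment> \<open>M is a group containing F. It may be infinite, but its image in the permutations
    of a finite set of homomorphisms is finite.\<close>
  define M where "M = {\<beta> \<in> finitary_autos. supp \<beta> Y}"
  have M_auto: "\<beta> \<in> auto G" "\<beta> \<in> carrier A" if "\<beta> \<in> M" for \<beta>
    using that by (auto simp: M_def finitary_autos_def carrier_AutoGroup)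
  have M_in: "\<beta> a \<in> H Y" if "\<beta> \<in> M" "a \<in> H Y" for \<beta> a
    using that supp_in by (auto simp: M_def)
  have M_mult: "\<beta> \<otimes>\<^bsub>A\<^esub> \<gamma> \<in> M" if "\<beta> \<in> M" "\<gamma> \<in> M" for \<beta> \<gamma>
    using that supp_mult[OF M_auto(1)[OF that(1)] M_auto(1)[OF that(2)] _ _ Y(1)]
      subgroup.m_closed[OF subgroup_finitary_autos] by (auto simp: M_def)
  have M_inv: "inv\<^bsub>A\<^esub> \<beta> \<in> M" if "\<beta> \<in> M" for \<beta>
    using that supp_inv[OF M_auto(1)[OF that] _ Y(1)]
      subgroup.m_inv_closed[OF subgroup_finitary_autos] by (auto simp: M_def)
  have M_one: "\<one>\<^bsub>A\<^esub> \<in> M"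
    using one_finitary H_carrier[OF Y(1)] H_carrier[of "X - Y"]
    by (auto simp: M_def supp_def AutoGroup_one subset_iff image_iff)
  have FM: "F \<subseteq> M" using F(1) Y(3) by (auto simp: M_def)
  have Y_carr: "a \<in> carrier G" if "a \<in> H Y" for a using H_carrier[OF Y(1)] that by blast
  have M_hom: "\<beta> (a \<otimes>\<^bsub>G\<^esub> b) = \<beta> a \<otimes>\<^bsub>G\<^esub> \<beta> b" if "\<beta> \<in> M" "a \<in> H Y" "b \<in> H Y" for \<beta> a b
    using M_auto(1)[OF that(1)] Y_carr that by (simp add: auto_def hom_def)
  have M_app: "(\<beta> \<otimes>\<^bsub>A\<^esub> \<gamma>) a = \<beta> (\<gamma> a)" if "\<beta> \<in> M" "\<gamma> \<in> M" "a \<in> H Y" for \<beta> \<gamma> a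
    by (rule AutoGroup_apply[OF M_auto(1)[OF that(1)] M_auto(1)[OF that(2)] Y_carr[OF that(3)]])

  have "\<exists>(Q :: 'q monoid) p. group Q \<and> finite (carrier Q) \<and> p \<in> hom K Q \<and> (\<exists>a\<in>H Y. p (\<beta> a) \<noteq> p a)"
    if \<beta>F: "\<beta> \<in> F" "\<beta> \<noteq> \<one>\<^bsub>A\<^esub>" for \<beta>
  proof -
    have \<beta>: "\<beta> \<in> M" using \<beta>F FM by blast
    obtain a where a: "a \<in> H Y" "\<beta> a \<noteq> a"
      using auto_eq_one_if_supp[OF M_auto(1)[OF \<beta>] _ Y(1)] \<beta>F Y(3) by blast
    have ba: "\<beta> a \<in> H Y" using M_in[OF \<beta> a(1)] .
    \<comment> \<open>If \<beta> moves a, then \<beta>(a) times the inverse of a is a nontrivial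
      element of L(Y); a finite quotient that detects it separates \<beta>(a) from a.\<close>
    define b where "b = \<beta> a \<otimes>\<^bsub>G\<^esub> inv\<^bsub>G\<^esub> a"
    have b: "b \<in> H Y" using HY a ba by (simp add: b_def subgroup.m_closed subgroup.m_inv_closed)
    have ab: "b \<otimes>\<^bsub>G\<^esub> a = \<beta> a" using a ba Y_carr by (simp add: b_def m_assoc)
    have "b \<noteq> \<one>\<^bsub>G\<^esub>" using ab a Y_carr by auto
    then obtain Q :: "'q monoid" and p where Q: "group Q" "finite (carrier Q)" "p \<in> hom K Q" "p b \<noteq> \<one>\<^bsub>Q\<^esub>"
      using rf[OF Y(1,2) b] unfolding K_def by blast
    interpret Q: group Q by (rule Q(1))
    have "p (\<beta> a) = p b \<otimes>\<^bsub>Q\<^esub> p a" using hom_mult[OF Q(3), of b a] a b ab by (simp add: carrK multK)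
    moreover have "p a \<in> carrier Q" "p b \<in> carrier Q"
      using hom_in_carrier[OF Q(3)] a b by (simp_all add: carrK)
    ultimately have "p (\<beta> a) \<noteq> p a" using Q(4) by (metis Q.r_cancel_one)
    then show ?thesis using Q a(1) by blast
  qed
  then obtain Q :: "('g \<Rightarrow> 'g) \<Rightarrow> 'q monoid" and p where Q: "\<And>\<beta>. \<beta> \<in> F \<Longrightarrow> \<beta> \<noteq> \<one>\<^bsub>A\<^esub> \<Longrightarrow>
      group (Q \<beta>) \<and> finite (carrier (Q \<beta>)) \<and> p \<beta> \<in> hom K (Q \<beta>) \<and> (\<exists>a\<in>H Y. p \<beta> (\<beta> a) \<noteq> p \<beta> a)"
    by metis
  \<comment> \<open>All targets belonging to elements of F are used together, so that one finite set
    on which M acts detects every nontrivial element of F.\<close>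
  define \<Omega> where "\<Omega> = (\<Union>\<beta>\<in>F - {\<one>\<^bsub>A\<^esub>}. {h \<in> extensional (carrier K). h \<in> hom K (Q \<beta>)})"
  have fin\<Omega>: "finite \<Omega>"
    unfolding \<Omega>_def
  proof (rule finite_UN_I)
    fix \<beta> assume "\<beta> \<in> F - {\<one>\<^bsub>A\<^esub>}"
    then have "group (Q \<beta>)" "finite (carrier (Q \<beta>))" using Q[of \<beta>] by auto
    then show "finite {h \<in> extensional (carrier K). h \<in> hom K (Q \<beta>)}"
      using S genK by (intro finite_extensional_homs[OF K]) (simp_all add: carrK)
  qed (use F in simp)
  have \<Omega>_ext: "h \<in> extensional (H Y)" if "h \<in> \<Omega>" for h using that by (auto simp: \<Omega>_def carrK)
  \<comment> \<open>Precomposition with the inverse of \<gamma> makes this a left action; the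
    restrictions keep its values extensional.\<close>
  define \<Phi> where "\<Phi> \<gamma> = (\<lambda>h\<in>\<Omega>. \<lambda>a\<in>H Y. h ((inv\<^bsub>A\<^esub> \<gamma>) a))" for \<gamma>
  have \<Phi>_in: "\<Phi> \<gamma> h \<in> \<Omega>" if "\<gamma> \<in> M" "h \<in> \<Omega>" for \<gamma> h
  proof -
    obtain \<beta> where \<beta>: "\<beta> \<in> F - {\<one>\<^bsub>A\<^esub>}" "h \<in> hom K (Q \<beta>)" using \<open>h \<in> \<Omega>\<close> by (auto simp: \<Omega>_def)
    have "\<Phi> \<gamma> h \<in> hom K (Q \<beta>)"
    proof (rule homI)
      fix a assume "a \<in> carrier K"
      then show "\<Phi> \<gamma> h a \<in> carrier (Q \<beta>)"
        using that hom_in_carrier[OF \<beta>(2)] M_in[OF M_inv[OF that(1)]] by (simp add: \<Phi>_def carrK)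
    next
      fix a b assume "a \<in> carrier K" "b \<in> carrier K"
      then show "\<Phi> \<gamma> h (a \<otimes>\<^bsub>K\<^esub> b) = \<Phi> \<gamma> h a \<otimes>\<^bsub>Q \<beta>\<^esub> \<Phi> \<gamma> h b"
        using that M_hom[OF M_inv[OF that(1)]] M_in[OF M_inv[OF that(1)]] subgroup.m_closed[OF HY]
          hom_mult[OF \<beta>(2)] by (simp add: \<Phi>_def carrK multK)
    qed
    moreover have "\<Phi> \<gamma> h \<in> extensional (carrier K)" using that by (simp add: \<Phi>_def carrK)
    ultimately show ?thesis using \<beta>(1) by (auto simp: \<Omega>_def)
  qed
  have \<Phi>_mult: "\<Phi> (\<gamma> \<otimes>\<^bsub>A\<^esub> \<delta>) = compose \<Omega> (\<Phi> \<gamma>) (\<Phi> \<delta>)" if "\<gamma> \<in> M" "\<delta> \<in> M" for \<gamma> \<delta>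
  proof
    fix h
    show "\<Phi> (\<gamma> \<otimes>\<^bsub>A\<^esub> \<delta>) h = compose \<Omega> (\<Phi> \<gamma>) (\<Phi> \<delta>) h"
    proof (cases "h \<in> \<Omega>")
      case True
      have inv: "inv\<^bsub>A\<^esub> (\<gamma> \<otimes>\<^bsub>A\<^esub> \<delta>) = inv\<^bsub>A\<^esub> \<delta> \<otimes>\<^bsub>A\<^esub> inv\<^bsub>A\<^esub> \<gamma>"
        by (rule A.inv_mult_group[OF M_auto(2)[OF that(1)] M_auto(2)[OF that(2)]])
      have "\<Phi> (\<gamma> \<otimes>\<^bsub>A\<^esub> \<delta>) h = (\<lambda>a\<in>H Y. h ((inv\<^bsub>A\<^esub> \<delta>) ((inv\<^bsub>A\<^esub> \<gamma>) a)))"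
        using True M_app[OF M_inv[OF that(2)] M_inv[OF that(1)]]
        by (auto simp: \<Phi>_def inv intro!: restrict_ext)
      also have "\<dots> = (\<lambda>a\<in>H Y. (\<Phi> \<delta> h) ((inv\<^bsub>A\<^esub> \<gamma>) a))"
        using True M_in[OF M_inv[OF that(1)]] by (auto simp: \<Phi>_def intro!: restrict_ext)
      also have "\<dots> = \<Phi> \<gamma> (\<Phi> \<delta> h)" using \<Phi>_in[OF that(2) True] by (simp add: \<Phi>_def[of \<gamma>])
      finally show ?thesis using True by (simp add: compose_def)
    qed (simp add: \<Phi>_def compose_def)
  qed
  have \<Phi>_one: "\<Phi> \<one>\<^bsub>A\<^esub> h = h" if "h \<in> \<Omega>" for h
  proof (rule extensionalityI[OF _ \<Omega>_ext[OF that]])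
    show "\<Phi> \<one>\<^bsub>A\<^esub> h \<in> extensional (H Y)" using that by (simp add: \<Phi>_def)
    fix a assume "a \<in> H Y"
    then show "\<Phi> \<one>\<^bsub>A\<^esub> h a = h a" using that Y_carr by (simp add: \<Phi>_def AutoGroup_one[symmetric]) (simp add: AutoGroup_one)
  qed
  \<comment> \<open>J is the finite image group itself. Left multiplication on it has no fixed
    points for elements with nontrivial image, whereas the action on \<Omega> may have some.\<close>
  define J where "J = \<Phi> ` M"
  \<comment> \<open>A bijection of J is required for every finitary automorphism; outside M the
    identity serves as default.\<close>
  define \<tau> where "\<tau> \<gamma> j = (if \<gamma> \<in> M then compose \<Omega> (\<Phi> \<gamma>) j else j)" for \<gamma> j
  have "J \<subseteq> \<Omega> \<rightarrow>\<^sub>E \<Omega>" using \<Phi>_in by (auto simp: J_def PiE_iff) (simp add: \<Phi>_def)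
  then have finJ: "finite J" using fin\<Omega> finite_subset finite_PiE by (metis (no_types, lifting))
  have \<tau>_\<Phi>: "\<tau> \<gamma> (\<Phi> \<delta>) = \<Phi> (\<gamma> \<otimes>\<^bsub>A\<^esub> \<delta>)" if "\<gamma> \<in> M" "\<delta> \<in> M" for \<gamma> \<delta>
    using that by (simp add: \<tau>_def \<Phi>_mult)
  have \<tau>_in: "\<tau> \<gamma> j \<in> J" if "j \<in> J" for \<gamma> j
    using that M_mult \<tau>_\<Phi> by (cases "\<gamma> \<in> M") (auto simp: J_def \<tau>_def \<Phi>_mult[symmetric])
  have \<tau>_cancel: "\<tau> (inv\<^bsub>A\<^esub> \<gamma>) (\<tau> \<gamma> j) = j" if \<gamma>: "\<gamma> \<in> M" and jJ: "j \<in> J" for \<gamma> j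
  proof -
    obtain \<delta> where \<delta>: "\<delta> \<in> M" "j = \<Phi> \<delta>" using jJ by (auto simp: J_def)
    have "inv\<^bsub>A\<^esub> \<gamma> \<otimes>\<^bsub>A\<^esub> (\<gamma> \<otimes>\<^bsub>A\<^esub> \<delta>) = \<delta>"
      using M_auto(2)[OF \<gamma>] M_auto(2)[OF \<delta>(1)] by (simp flip: A.m_assoc)
    then show ?thesis using \<tau>_\<Phi>[OF \<gamma> \<delta>(1)] \<tau>_\<Phi>[OF M_inv[OF \<gamma>] M_mult[OF \<gamma> \<delta>(1)]] by (simp add: \<delta>(2))
  qed
  have \<tau>_bij: "bij_betw (\<tau> \<gamma>) J J" for \<gamma>
  proof (cases "\<gamma> \<in> M")
    case True
    have "inj_on (\<tau> \<gamma>) J" by (rule inj_on_inverseI[where g = "\<tau> (inv\<^bsub>A\<^esub> \<gamma>)"]) (rule \<tau>_cancel[OF True])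
    moreover have "\<tau> \<gamma> ` J \<subseteq> J" using \<tau>_in by blast
    ultimately show ?thesis using finJ by (simp add: bij_betw_def endo_inj_surj)
  next
    case False
    then have "\<tau> \<gamma> = id" by (auto simp: \<tau>_def)
    then show ?thesis by simp
  qed
  have \<tau>_one: "\<tau> \<one>\<^bsub>A\<^esub> j = j" if jJ: "j \<in> J" for j
  proof -
    obtain \<delta> where \<delta>: "\<delta> \<in> M" "j = \<Phi> \<delta>" using jJ by (auto simp: J_def)
    then show ?thesis using \<tau>_\<Phi>[OF M_one \<delta>(1)] M_auto(2)[OF \<delta>(1)] by simp
  qed
  have \<tau>_mult: "\<tau> (\<beta> \<otimes>\<^bsub>A\<^esub> \<gamma>) j = \<tau> \<beta> (\<tau> \<gamma> j)" if \<beta>: "\<beta> \<in> M" and \<gamma>: "\<gamma> \<in> M" and jJ: "j \<in> J" for \<beta> \<gamma> j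
  proof -
    obtain \<delta> where \<delta>: "\<delta> \<in> M" "j = \<Phi> \<delta>" using jJ by (auto simp: J_def)
    show ?thesis
      unfolding \<delta>(2) \<tau>_\<Phi>[OF \<gamma> \<delta>(1)] \<tau>_\<Phi>[OF M_mult[OF \<beta> \<gamma>] \<delta>(1)] \<tau>_\<Phi>[OF \<beta> M_mult[OF \<gamma> \<delta>(1)]]
      by (simp add: A.m_assoc M_auto(2)[OF \<beta>] M_auto(2)[OF \<gamma>] M_auto(2)[OF \<delta>(1)])
  qed
  have free: "\<tau> \<gamma> j \<noteq> j" if \<gamma>: "\<gamma> \<in> F" "\<gamma> \<noteq> \<one>\<^bsub>A\<^esub>" and jJ: "j \<in> J" for \<gamma> j
  proof
    assume eq: "\<tau> \<gamma> j = j"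
    have \<gamma>M: "\<gamma> \<in> M" using \<gamma> FM by blast
    obtain \<delta> where \<delta>: "\<delta> \<in> M" "j = \<Phi> \<delta>" using jJ by (auto simp: J_def)
    \<comment> \<open>Every h in \<Omega> is of the form \<Phi> \<delta> k, so a fixed point of left
      multiplication forces \<Phi> \<gamma> to be the identity on \<Omega>.\<close>
    have fixed: "\<Phi> \<gamma> h = h" if h: "h \<in> \<Omega>" for h
    proof -
      define k where "k = \<Phi> (inv\<^bsub>A\<^esub> \<delta>) h"
      have k: "k \<in> \<Omega>" using \<Phi>_in[OF M_inv[OF \<delta>(1)] h] by (simp add: k_def)
      have "\<Phi> \<delta> k = \<Phi> (\<delta> \<otimes>\<^bsub>A\<^esub> inv\<^bsub>A\<^esub> \<delta>) h"
        using h by (simp add: \<Phi>_mult[OF \<delta>(1) M_inv[OF \<delta>(1)]] compose_def k_def)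
      then have "\<Phi> \<delta> k = h" using M_auto(2)[OF \<delta>(1)] \<Phi>_one[OF h] by simp
      moreover have "\<Phi> \<gamma> (\<Phi> \<delta> k) = \<Phi> \<delta> k"
        using fun_cong[OF eq, of k] k \<gamma>M by (simp add: \<tau>_def \<delta>(2) compose_def)
      ultimately show ?thesis by simp
    qed
    \<comment> \<open>The separating homomorphism of \<gamma> is itself a point of \<Omega>, and
      \<Phi> \<gamma> moves it.\<close>
    define h where "h = restrict (p \<gamma>) (H Y)"
    have Q\<gamma>: "p \<gamma> \<in> hom K (Q \<gamma>)" using Q[OF \<gamma>] by blast
    obtain a where a: "a \<in> H Y" "p \<gamma> (\<gamma> a) \<noteq> p \<gamma> a" using Q[OF \<gamma>] by blast
    have "h \<in> hom K (Q \<gamma>)"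
      using Q\<gamma> subgroup.m_closed[OF HY] by (auto simp: h_def hom_def carrK multK Pi_iff)
    then have h: "h \<in> \<Omega>" using \<gamma> by (auto simp: \<Omega>_def h_def carrK)
    have \<gamma>a: "\<gamma> a \<in> H Y" by (rule M_in[OF \<gamma>M a(1)])
    have "\<Phi> \<gamma> h (\<gamma> a) = h a"
      using h \<gamma>a inv_AutoGroup_apply(1)[OF M_auto(1)[OF \<gamma>M] Y_carr[OF a(1)]] by (simp add: \<Phi>_def)
    then have "h (\<gamma> a) = h a" using fixed[OF h] by simp
    then show False using a \<gamma>a by (simp add: h_def)
  qed
  show ?thesis
  proof (rule exI[of _ J], rule exI[of _ \<tau>], intro conjI ballI impI)
    show "J \<noteq> {}" using M_one by (auto simp: J_def)
    show "\<tau> (g \<otimes>\<^bsub>A\<^esub> h) j = \<tau> g (\<tau> h j)" if "g \<in> F" "h \<in> F" "j \<in> J" for g h j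
      using \<tau>_mult that FM by blast
  qed (use finJ \<tau>_bij \<tau>_one free in auto)
qed

end

section \<open>Haloes over sets and graphs\<close>

text \<open>The closure properties that sets and graphs share. Every map out of a single vertex is
  an embedding since graphs have no loops, and the swap of two vertices is one since edges are
  symmetric.\<close>

definition subset_closed_category :: "('o, 'x) concrete_category \<Rightarrow> bool" where
  "subset_closed_category C \<longleftrightarrow> (\<forall>X\<in>objs C. id \<in> embs C X X \<and>
     (\<forall>f\<in>embs C X X. \<forall>g\<in>embs C X X. f \<circ> g \<in> embs C X X) \<and>
     (\<forall>Y\<subseteq>points C X. subobj C X Y \<in> objs C \<and> points C (subobj C X Y) = Y \<and>
        id \<in> embs C (subobj C X Y) X \<and>
        (\<forall>Z\<subseteq>Y. id \<in> embs C (subobj C X Z) (subobj C X Y)) \<and>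
        (\<forall>v\<in>points C X. \<forall>f. f v \<in> Y \<longrightarrow> f \<in> embs C (subobj C X {v}) (subobj C X Y))) \<and>
     (\<forall>v\<in>points C X. \<forall>f. f v \<in> points C X \<longrightarrow> f \<in> embs C (subobj C X {v}) X) \<and>
     (\<forall>u\<in>points C X. \<forall>w\<in>points C X.
        Transposition.transpose u w \<in> embs C (subobj C X {u, w}) (subobj C X {u, w})))"

lemma subset_closed_categoryD:
  assumes "subset_closed_category C" "X \<in> objs C"
  shows "id \<in> embs C X X"
    and "f \<in> embs C X X \<Longrightarrow> g \<in> embs C X X \<Longrightarrow> f \<circ> g \<in> embs C X X"
    and "Y \<subseteq> points C X \<Longrightarrow> subobj C X Y \<in> objs C"
    and "Y \<subseteq> points C X \<Longrightarrow> points C (subobj C X Y) = Y"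
    and "Y \<subseteq> points C X \<Longrightarrow> id \<in> embs C (subobj C X Y) X"
    and "Z \<subseteq> Y \<Longrightarrow> Y \<subseteq> points C X \<Longrightarrow> id \<in> embs C (subobj C X Z) (subobj C X Y)"
    and "v \<in> points C X \<Longrightarrow> Y \<subseteq> points C X \<Longrightarrow> f v \<in> Y \<Longrightarrow> f \<in> embs C (subobj C X {v}) (subobj C X Y)"
    and "v \<in> points C X \<Longrightarrow> f v \<in> points C X \<Longrightarrow> f \<in> embs C (subobj C X {v}) X"
    and "u \<in> points C X \<Longrightarrow> w \<in> points C X \<Longrightarrow>
      Transposition.transpose u w \<in> embs C (subobj C X {u, w}) (subobj C X {u, w})"
  using assms(1)[unfolded subset_closed_category_def, THEN bspec, OF assms(2)] by simp_all

lemma injections_comp: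
  assumes "f \<in> injections Y Z" "g \<in> injections X Y"
  shows "f \<circ> g \<in> injections X Z"
proof -
  have fg: "inj_on f Y" "inj_on g X" "g \<in> X \<rightarrow> Y" "f \<in> Y \<rightarrow> Z" using assms by (simp_all add: injections_def)
  have "inj_on f (g ` X)" using fg(1) by (rule inj_on_subset) (use fg(3) in auto)
  with fg(2) have "inj_on (f \<circ> g) X" by (rule comp_inj_on)
  then show ?thesis using fg(3,4) by (simp add: injections_def Pi_iff)
qed

lemma subset_closed_Sets: "subset_closed_category Sets"
proof -
  have "Transposition.transpose u w \<in> injections {u, w} {u, w}" for u w :: 'x
    by (auto simp: injections_def inj_on_def Transposition.transpose_def)
  then show ?thesis
    by (auto simp: subset_closed_category_def Sets_def Int_absorb1 injections_comp)
      (auto simp: injections_def)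
qed

lemma subset_closed_Graphs: "subset_closed_category Graphs"
proof -
  have verts: "verts (induced_subgraph X Y) = Y" if "Y \<subseteq> verts X" for X :: "'x graph" and Y
    using that by (auto simp: induced_subgraph_def)
  have edges: "(u, v) \<in> edges (induced_subgraph X Y) \<longleftrightarrow> (u, v) \<in> edges X \<and> u \<in> Y \<and> v \<in> Y"
    for X :: "'x graph" and Y u v by (auto simp: induced_subgraph_def)
  show ?thesis
    unfolding subset_closed_category_def
  proof (intro ballI conjI allI impI)
    fix X :: "'x graph" assume "X \<in> objs Graphs"
    then have X: "edges X \<subseteq> verts X \<times> verts X" "sym (edges X)" "irrefl (edges X)"
      by (simp_all add: Graphs_def simple_graph_def)
    have irr: "(v, v) \<notin> edges X" for v using X(3) by (simp add: irrefl_def)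
    have sym: "(u, v) \<in> edges X \<longleftrightarrow> (v, u) \<in> edges X" for u v using X(2) by (meson symD)
    show "id \<in> embs Graphs X X" by (simp add: Graphs_def graph_embeddings_def injections_def)
    show "f \<circ> g \<in> embs Graphs X X" if "f \<in> embs Graphs X X" "g \<in> embs Graphs X X" for f g
    proof -
      have fg: "f \<in> injections (verts X) (verts X)" "g \<in> injections (verts X) (verts X)"
        "\<forall>u\<in>verts X. \<forall>v\<in>verts X. (f u, f v) \<in> edges X \<longleftrightarrow> (u, v) \<in> edges X"
        "\<forall>u\<in>verts X. \<forall>v\<in>verts X. (g u, g v) \<in> edges X \<longleftrightarrow> (u, v) \<in> edges X"
        using that by (simp_all add: Graphs_def graph_embeddings_def)
      have "g v \<in> verts X" if "v \<in> verts X" for v using fg(2) that by (auto simp: injections_def)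
      then show ?thesis
        using fg(3,4) injections_comp[OF fg(1,2)] by (simp add: Graphs_def graph_embeddings_def)
    qed
    show "f \<in> embs Graphs (subobj Graphs X {v}) X" if "v \<in> points Graphs X" "f v \<in> points Graphs X" for f v
      using that irr verts[of "{v}" X]
      by (simp add: Graphs_def graph_embeddings_def injections_def edges)
    show "Transposition.transpose u w \<in> embs Graphs (subobj Graphs X {u, w}) (subobj Graphs X {u, w})"
      if "u \<in> points Graphs X" "w \<in> points Graphs X" for u w
      using that irr sym[of u w] verts[of "{u, w}" X]
      by (auto simp: Graphs_def graph_embeddings_def injections_def edges Transposition.transpose_def inj_on_def)
    fix Y assume Y: "Y \<subseteq> points Graphs X"
    then have Y': "Y \<subseteq> verts X" by (simp add: Graphs_def)
    show "subobj Graphs X Y \<in> objs Graphs"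
      using X by (auto simp: Graphs_def simple_graph_def induced_subgraph_def sym_def irrefl_def)
    show "points Graphs (subobj Graphs X Y) = Y" using verts[OF Y'] by (simp add: Graphs_def)
    show "id \<in> embs Graphs (subobj Graphs X Y) X"
      using Y' by (auto simp: Graphs_def graph_embeddings_def injections_def edges verts)
    show "id \<in> embs Graphs (subobj Graphs X Z) (subobj Graphs X Y)" if "Z \<subseteq> Y" for Z
      using that Y' by (auto simp: Graphs_def graph_embeddings_def injections_def edges verts)
    show "f \<in> embs Graphs (subobj Graphs X {v}) (subobj Graphs X Y)" if "v \<in> points Graphs X" "f v \<in> Y" for f v
      using that Y' irr verts[of "{v}" X] verts[OF Y']
      by (simp add: Graphs_def graph_embeddings_def injections_def edges)
  qed
qed

text \<open>The concrete choice of \<open>c\<close> in \<open>monomial_halo\<close>; the constant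
  function represents the only map from {v} to {w}, and the inverse of the inclusion undoes the
  identification of L({v}) with its image.\<close>

definition point_transport ::
  "('o, 'x) concrete_category \<Rightarrow> ('o \<Rightarrow> 'g monoid) \<Rightarrow> ('o \<Rightarrow> 'o \<Rightarrow> ('x \<Rightarrow> 'x) \<Rightarrow> 'g \<Rightarrow> 'g) \<Rightarrow>
     'o \<Rightarrow> 'x \<Rightarrow> 'x \<Rightarrow> 'g \<Rightarrow> 'g" where
  "point_transport C L Lm X v w a =
     Lm (subobj C X {w}) X id (Lm (subobj C X {v}) (subobj C X {w}) (\<lambda>_. w)
       (inv_into (carrier (L (subobj C X {v}))) (Lm (subobj C X {v}) X id) a))"

text \<open>By \<open>c_eq\<close>, transport from v to w amounts to applying the functor to the map
  that sends v to w. Every axiom then compares two maps out of a single vertex, which agree as soon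
  as they have the same value there.\<close>

lemma monomial_action_of_halo:
  assumes C: "subset_closed_category C" and X: "X \<in> objs C" and act: "acts_on C \<Gamma> X \<alpha>"
    and halo: "halo_functor C L Lm" and joins: "halo_joins C L Lm" and ext: "halo_extends_autos C L Lm"
  shows "monomial_action (points C X) (L X) (sub_image C L Lm X) (point_transport C L Lm X) \<Gamma> \<alpha>
    (induced_auto L Lm X \<alpha>)"
proof -
  let ?P = "points C X" and ?H = "sub_image C L Lm X" and ?c = "point_transport C L Lm X"
  let ?S = "subobj C X"
  note cat = subset_closed_categoryD[OF C X]
  have F: "group_functor C L Lm" and hX: "halo_over ?P (L X) ?H"
    using halo X by (simp_all add: halo_functor_def)
  have mon: "Lm Y Z f \<in> mon (L Y) (L Z)" if "Y \<in> objs C" "Z \<in> objs C" "f \<in> embs C Y Z" for Y Z f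
    using F that by (simp add: group_functor_def)
  have cong: "Lm Y Z f a = Lm Y Z g a" if "Y \<in> objs C" "Z \<in> objs C" "f \<in> embs C Y Z" "g \<in> embs C Y Z"
    "\<And>x. x \<in> points C Y \<Longrightarrow> f x = g x" "a \<in> carrier (L Y)" for Y Z f g a
    using F that unfolding group_functor_def by blast
  have Lm_id: "Lm Y Y id a = a" if "Y \<in> objs C" "a \<in> carrier (L Y)" for Y a
    using F that by (simp add: group_functor_def)
  have comp: "Lm Y' Z' g (Lm Y Y' f a) = Lm Y Z' (g \<circ> f) a"
    if "Y \<in> objs C" "Y' \<in> objs C" "Z' \<in> objs C" "f \<in> embs C Y Y'" "g \<in> embs C Y' Z'" "a \<in> carrier (L Y)" for Y Y' Z' f g a
  proof -
    from F have "\<forall>X\<in>objs C. \<forall>Y\<in>objs C. \<forall>Z\<in>objs C. \<forall>\<pi>\<in>embs C X Y. \<forall>\<rho>\<in>embs C Y Z. \<forall>a\<in>carrier (L X).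
        Lm X Z (\<rho> \<circ> \<pi>) a = Lm Y Z \<rho> (Lm X Y \<pi> a)"
      unfolding group_functor_def by (elim conjE)
    from this[rule_format, OF that] show ?thesis by (rule sym)
  qed
  have S: "?S {v} \<in> objs C" if "v \<in> ?P" for v using cat(3)[of "{v}"] that by simp
  have pS: "points C (?S {v}) = {v}" if "v \<in> ?P" for v using cat(4)[of "{v}"] that by simp
  have iota: "id \<in> embs C (?S {v}) X" if "v \<in> ?P" for v using cat(5)[of "{v}"] that by simp
  have const: "(\<lambda>_. w) \<in> embs C (?S {v}) (?S {w})" if "v \<in> ?P" "w \<in> ?P" for v w
    using cat(7)[of v "{w}" "\<lambda>_. w"] that by simp
  have in_carrier: "Lm Y Z f a \<in> carrier (L Z)"
    if "Y \<in> objs C" "Z \<in> objs C" "f \<in> embs C Y Z" "a \<in> carrier (L Y)" for Y Z f a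
    using mon[OF that(1-3)] that(4) by (auto simp: mon_def hom_def)
  have c_eq: "?c v w (Lm (?S {v}) X id b) = Lm (?S {v}) X (\<lambda>_. w) b"
    if "v \<in> ?P" "w \<in> ?P" "b \<in> carrier (L (?S {v}))" for v w b
  proof -
    have "inj_on (Lm (?S {v}) X id) (carrier (L (?S {v})))"
      using mon[OF S[OF that(1)] X iota[OF that(1)]] by (simp add: mon_def)
    then have "?c v w (Lm (?S {v}) X id b) = Lm (?S {w}) X id (Lm (?S {v}) (?S {w}) (\<lambda>_. w) b)"
      using that(3) by (simp add: point_transport_def)
    also have "\<dots> = Lm (?S {v}) X (id \<circ> (\<lambda>_. w)) b"
      by (rule comp[OF S[OF that(1)] S[OF that(2)] X const[OF that(1,2)] iota[OF that(2)] that(3)])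
    finally show ?thesis by (simp add: comp_def)
  qed
  have const_X: "Lm (?S {v}) X (\<lambda>_. w) b = Lm (?S {w}) X id (Lm (?S {v}) (?S {w}) (\<lambda>_. w) b)"
    if "v \<in> ?P" "w \<in> ?P" "b \<in> carrier (L (?S {v}))" for v w b
    using comp[OF S[OF that(1)] S[OF that(2)] X const[OF that(1,2)] iota[OF that(2)] that(3)]
    by (simp add: comp_def)
  have const_in: "Lm (?S {v}) (?S {w}) (\<lambda>_. w) b \<in> carrier (L (?S {w}))"
    if "v \<in> ?P" "w \<in> ?P" "b \<in> carrier (L (?S {v}))" for v w b
    by (rule in_carrier[OF S[OF that(1)] S[OF that(2)] const[OF that(1,2)] that(3)])
  have H_point: "\<exists>b\<in>carrier (L (?S {v})). a = Lm (?S {v}) X id b" if "a \<in> ?H {v}" for a v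
    using that by (auto simp: sub_image_def)
  interpret H: monomial_halo ?P "L X" ?H ?c
  proof
    show "halo_over ?P (L X) ?H" by (rule hX)
    show "?H (Y \<union> Z) = generate (L X) (?H Y \<union> ?H Z)" if "Y \<subseteq> ?P" "Z \<subseteq> ?P" for Y Z
      using joins X that by (simp add: halo_joins_def)
    show "?c v v a = a" if v: "v \<in> ?P" "a \<in> ?H {v}" for v a
    proof -
      obtain b where b: "b \<in> carrier (L (?S {v}))" "a = Lm (?S {v}) X id b" using H_point[OF v(2)] by blast
      have "Lm (?S {v}) X (\<lambda>_. v) b = Lm (?S {v}) X id b"
        by (rule cong[OF S[OF v(1)] X cat(8) iota[OF v(1)]]) (use v b pS in auto)
      then show ?thesis using c_eq[OF v(1) v(1) b(1)] by (simp add: b(2))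
    qed
    show "?c v w a \<in> ?H {w}" if v: "v \<in> ?P" "w \<in> ?P" "a \<in> ?H {v}" for v w a
    proof -
      obtain b where b: "b \<in> carrier (L (?S {v}))" "a = Lm (?S {v}) X id b" using H_point[OF v(3)] by blast
      show ?thesis
        unfolding b(2) c_eq[OF v(1,2) b(1)] const_X[OF v(1,2) b(1)] sub_image_def
        using const_in[OF v(1,2) b(1)] by (rule imageI)
    qed
    show "?c v w (?c u v a) = ?c u w a" if u: "u \<in> ?P" "v \<in> ?P" "w \<in> ?P" "a \<in> ?H {u}" for u v w a
    proof -
      obtain b where b: "b \<in> carrier (L (?S {u}))" "a = Lm (?S {u}) X id b" using H_point[OF u(4)] by blast
      have "?c v w (?c u v a) = Lm (?S {v}) X (\<lambda>_. w) (Lm (?S {u}) (?S {v}) (\<lambda>_. v) b)"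
        unfolding b(2) c_eq[OF u(1,2) b(1)] const_X[OF u(1,2) b(1)]
        by (rule c_eq[OF u(2,3) const_in[OF u(1,2) b(1)]])
      also have "\<dots> = Lm (?S {u}) X ((\<lambda>_. w) \<circ> (\<lambda>_. v)) b"
        by (rule comp[OF S[OF u(1)] S[OF u(2)] X const[OF u(1,2)] cat(8) b(1)]) (use u in auto)
      finally show ?thesis by (simp add: b(2) c_eq[OF u(1,3) b(1)] comp_def)
    qed
    fix u w assume uw: "u \<in> ?P" "w \<in> ?P" "u \<noteq> w"
    let ?Y = "{u, w}" and ?t = "Transposition.transpose u w"
    have Y: "?Y \<subseteq> ?P" using uw by simp
    note SY = cat(3)[OF Y] and t = cat(9)[OF uw(1,2)]
    \<comment> \<open>The functor applied to the swap; the swap is an involution, so \<beta> is its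
      own inverse and hence an automorphism of L({u, w}).\<close>
    define \<beta> where "\<beta> = restrict (Lm (?S ?Y) (?S ?Y) ?t) (carrier (L (?S ?Y)))"
    have tt: "Lm (?S ?Y) (?S ?Y) ?t (Lm (?S ?Y) (?S ?Y) ?t b) = b" if "b \<in> carrier (L (?S ?Y))" for b
      using comp[OF SY SY SY t t that] Lm_id[OF SY that] by simp
    note t_in = in_carrier[OF SY SY t]
    have "\<beta> \<in> auto (L (?S ?Y))"
      unfolding auto_def Bij_def
    proof (intro IntI CollectI)
      have "group (L (?S ?Y))" using F SY by (simp add: group_functor_def)
      then show "\<beta> \<in> hom (L (?S ?Y)) (L (?S ?Y))"
        using mon[OF SY SY t] by (auto simp: \<beta>_def mon_def hom_def Pi_iff group.is_monoid monoid.m_closed)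
      show "bij_betw \<beta> (carrier (L (?S ?Y))) (carrier (L (?S ?Y)))"
        by (rule bij_betw_byWitness[where f' = \<beta>]) (use tt t_in in \<open>auto simp: \<beta>_def\<close>)
    qed (simp add: \<beta>_def)
    then obtain \<gamma> where \<gamma>: "\<gamma> \<in> ALf_at C L Lm X ?Y"
      and \<gamma>\<beta>: "\<forall>a\<in>carrier (L (?S ?Y)). \<gamma> (Lm (?S ?Y) X id a) = Lm (?S ?Y) X id (\<beta> a)"
      using ext[unfolded halo_extends_autos_def, rule_format, OF X, of ?Y] Y by blast
    have swaps: "\<gamma> a = ?c v (?t v) a" if v: "v \<in> ?Y" and a: "a \<in> ?H {v}" for v a
    proof -
      have vP: "v \<in> ?P" "?t v \<in> ?P" "?t v \<in> ?Y" using v uw by (auto simp: Transposition.transpose_def)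
      obtain b where b: "b \<in> carrier (L (?S {v}))" "a = Lm (?S {v}) X id b" using H_point[OF a] by blast
      have iY: "id \<in> embs C (?S {v}) (?S ?Y)" using cat(6)[of "{v}" ?Y] v Y by blast
      have idY: "id \<in> embs C (?S ?Y) X" by (rule cat(5)[OF Y])
      define b' where "b' = Lm (?S {v}) (?S ?Y) id b"
      have b': "b' \<in> carrier (L (?S ?Y))" unfolding b'_def by (rule in_carrier[OF S[OF vP(1)] SY iY b(1)])
      have "a = Lm (?S ?Y) X id b'"
        unfolding b(2) b'_def using comp[OF S[OF vP(1)] SY X iY idY b(1)] by simp
      then have "\<gamma> a = Lm (?S ?Y) X id (Lm (?S ?Y) (?S ?Y) ?t b')" using \<gamma>\<beta> b' by (simp add: \<beta>_def)
      also have "Lm (?S ?Y) (?S ?Y) ?t b' = Lm (?S {v}) (?S ?Y) ?t b"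
        unfolding b'_def using comp[OF S[OF vP(1)] SY SY iY t b(1)] by simp
      also have "Lm (?S ?Y) X id (Lm (?S {v}) (?S ?Y) ?t b) = Lm (?S {v}) X ?t b"
        using comp[OF S[OF vP(1)] SY X cat(7)[OF vP(1) Y, of ?t] idY b(1)] vP by simp
      \<comment> \<open>The swap and the constant map agree on the only point v.\<close>
      also have "\<dots> = Lm (?S {v}) X (\<lambda>_. ?t v) b"
        by (rule cong[OF S[OF vP(1)] X cat(8) cat(8) _ b(1)]) (use vP pS[OF vP(1)] in auto)
      finally show ?thesis by (simp add: b(2) c_eq[OF vP(1,2) b(1)])
    qed
    show "\<exists>\<gamma>\<in>auto (L X). \<gamma> ` ?H ?Y = ?H ?Y \<and> (\<forall>a\<in>?H (?P - ?Y). \<gamma> a = a) \<and>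
        (\<forall>a\<in>?H {u}. \<gamma> a = ?c u w a) \<and> (\<forall>a\<in>?H {w}. \<gamma> a = ?c w u a)"
      using \<gamma> swaps[of u] swaps[of w]
      by (intro bexI[of _ \<gamma>]) (auto simp: ALf_at_def ALf_def supported_in_def)
  qed
  have act': "group_action \<Gamma> ?P \<alpha>" and \<alpha>: "\<And>g. g \<in> carrier \<Gamma> \<Longrightarrow> \<alpha> g \<in> embs C X X"
    using act by (simp_all add: acts_on_def)
  interpret act: group_action \<Gamma> ?P \<alpha> by (rule act')
  have group\<Gamma>: "group \<Gamma>" using act.group_hom by (simp add: group_hom_def)
  interpret \<Gamma>: group \<Gamma> by (rule group\<Gamma>)
  \<comment> \<open>The composite of \<alpha>(g) and \<alpha>(h) is known to be the identity only on
    the points of X, which is where the congruence clause of the functor is needed.\<close>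
  have inv: "Lm X X (\<alpha> g) (Lm X X (\<alpha> h) a) = a"
    if "g \<in> carrier \<Gamma>" "h \<in> carrier \<Gamma>" "g \<otimes>\<^bsub>\<Gamma>\<^esub> h = \<one>\<^bsub>\<Gamma>\<^esub>" "a \<in> carrier (L X)" for g h a
  proof -
    have "(\<alpha> g \<circ> \<alpha> h) x = id x" if "x \<in> ?P" for x
      using act.composition_rule[OF that \<open>g \<in> carrier \<Gamma>\<close> \<open>h \<in> carrier \<Gamma>\<close>] act.id_eq_one that
        \<open>g \<otimes>\<^bsub>\<Gamma>\<^esub> h = \<one>\<^bsub>\<Gamma>\<^esub>\<close> by (metis comp_apply id_apply restrict_apply')
    then have "Lm X X (\<alpha> g \<circ> \<alpha> h) a = Lm X X id a"
      using that \<alpha> by (intro cong X cat(1,2)) auto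
    then show ?thesis using comp[OF X X X \<alpha>[OF that(2)] \<alpha>[OF that(1)] that(4)] Lm_id[OF X that(4)] by simp
  qed
  show ?thesis
  proof (unfold_locales)
    fix g assume g: "g \<in> carrier \<Gamma>"
    let ?U = "induced_auto L Lm X \<alpha> g"
    show "H.monomial ?U (\<alpha> g)"
      unfolding H.monomial_def
    proof (intro conjI ballI)
      show "bij_betw (\<alpha> g) ?P ?P" using act.bij_prop0[OF g] by (simp add: Bij_def)
      show "?U \<in> auto (L X)"
        unfolding auto_def Bij_def
      proof (intro IntI CollectI)
        note U_in = in_carrier[OF X X \<alpha>[OF g]] in_carrier[OF X X \<alpha>[OF \<Gamma>.inv_closed[OF g]]]
        show "?U \<in> hom (L X) (L X)"
          using mon[OF X X \<alpha>[OF g]] by (auto simp: induced_auto_def mon_def hom_def Pi_iff)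
        show "bij_betw ?U (carrier (L X)) (carrier (L X))"
          by (rule bij_betw_byWitness[where f' = "Lm X X (\<alpha> (inv\<^bsub>\<Gamma>\<^esub> g))"])
            (use inv g U_in in \<open>auto simp: induced_auto_def\<close>)
      qed (simp add: induced_auto_def)
      fix v a assume v: "v \<in> ?P" and a: "a \<in> ?H {v}"
      obtain b where b: "b \<in> carrier (L (?S {v}))" "a = Lm (?S {v}) X id b" using H_point[OF a] by blast
      have gv: "\<alpha> g v \<in> ?P" using act.element_image[OF g v] by blast
      have "?U a = Lm X X (\<alpha> g) a" using H.H_point_carrier[OF v a] by (simp add: induced_auto_def)
      also have "\<dots> = Lm (?S {v}) X (\<alpha> g) b"
        using comp[OF S[OF v] X X iota[OF v] \<alpha>[OF g] b(1)] by (simp add: b(2))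
      also have "\<dots> = Lm (?S {v}) X (\<lambda>_. \<alpha> g v) b"
        by (rule cong[OF S[OF v] X cat(8) cat(8) _ b(1)]) (use v gv pS[OF v] in auto)
      finally show "?U a = ?c v (\<alpha> g v) a" by (simp add: b(2) c_eq[OF v gv b(1)])
    qed
  qed
qed

text \<open>The two instances of \<open>wreath_closed\<close> match the two cases: natural numbers
  index the orbit approximations for infinite X, permutations of X do so for finite X, and the
  factor \<open>bool\<close> comes from the doubled blocks.\<close>

lemma AL_group_approximable:
  fixes \<G> :: "('h monoid \<times> 'h metric) set" and \<Gamma> :: "'a monoid" and \<alpha> :: "'a \<Rightarrow> 'x \<Rightarrow> 'x"
  assumes C: "subset_closed_category C" and X: "X \<in> objs C" and act: "acts_on C \<Gamma> X \<alpha>"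
    and halo: "halo_functor C L Lm" "halo_joins C L Lm" "halo_extends_autos C L Lm"
    and sofic: "orbit_approximable \<Gamma> (points C X) \<alpha>"
    and groups: "\<And>G d. (G, d) \<in> \<G> \<Longrightarrow> group G"
    and wreath: "wreath_closed TYPE(nat \<times> bool) \<G>" "wreath_closed TYPE(('x \<Rightarrow> 'x) \<times> bool) \<G>"
    and joint: "jointly_embeddable \<G>"
    and app: "approximable \<G> \<Gamma>" "approximable \<G> (ALf_group C L Lm X)"
  shows "approximable \<G> (AL_group C L Lm \<Gamma> X \<alpha>)"
proof -
  interpret M: monomial_action "points C X" "L X" "sub_image C L Lm X" "point_transport C L Lm X" \<Gamma> \<alpha>
    "induced_auto L Lm X \<alpha>"
    by (rule monomial_action_of_halo[OF C X act halo])
  have "M.finitary_autos = ALf C L Lm X"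
    by (auto simp: M.finitary_autos_def M.supp_def ALf_def supported_in_def)
  then have N: "M.N = ALf_group C L Lm X" by (simp add: ALf_group_def)
  have AL: "AL_group C L Lm \<Gamma> X \<alpha> = semidirect_product M.N \<Gamma> M.\<theta>" by (simp add: AL_group_def N)
  note criterion = approximable_semidirect_product[OF app(2)[folded N] app(1) M.group_semidirect _ _ groups]
  show ?thesis
  proof (cases "finite (points C X)")
    case True
    show ?thesis
      unfolding AL using M.\<theta>_finitary
      by (intro criterion[OF _ M.sofically_inner_finite[OF True] _ wreath(2) joint]) auto
  next
    case False
    show ?thesis
      unfolding AL using M.\<theta>_finitary
      by (intro criterion[OF _ M.sofically_inner_infinite[OF False sofic] _ wreath(1) joint]) auto
  qed
qed

section \<open>The case of finitely generated, residually finite L(Y)\<close>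

lemma finitely_generated_sub_image:
  assumes C: "subset_closed_category C" and X: "X \<in> objs C" and F: "group_functor C L Lm"
    and Y: "Y \<subseteq> points C X" and fg: "finitely_generated (L (subobj C X Y))"
  shows "\<exists>S\<subseteq>sub_image C L Lm X Y. finite S \<and> generate (L X) S = sub_image C L Lm X Y"
proof -
  let ?K = "L (subobj C X Y)" and ?i = "Lm (subobj C X Y) X id"
  note cat = subset_closed_categoryD[OF C X]
  obtain S where S: "S \<subseteq> carrier ?K" "finite S" "generate ?K S = carrier ?K"
    using fg by (auto simp: finitely_generated_def)
  have "group ?K" "group (L X)" "?i \<in> mon ?K (L X)"
    using F X cat(3,5)[OF Y] by (simp_all add: group_functor_def)
  then have "group_hom ?K (L X) ?i" by (simp add: group_hom_def group_hom_axioms_def mon_def)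
  then have "generate (L X) (?i ` S) = ?i ` carrier ?K"
    using group_hom.generate_img[OF _ S(1)] S(3) by metis
  then show ?thesis
    using S by (intro exI[of _ "?i ` S"]) (auto simp: sub_image_def)
qed

text \<open>Pulled back along the injective inclusion, a is a nontrivial element of the original
  group, and the finite quotient that detects it consists of cosets, whence the type of Q.\<close>

lemma residually_finite_sub_image:
  assumes C: "subset_closed_category C" and X: "X \<in> objs C" and F: "group_functor C L Lm"
    and Y: "Y \<subseteq> points C X" and rf: "residually_finite (L (subobj C X Y))"
    and a: "a \<in> sub_image C L Lm X Y" "a \<noteq> \<one>\<^bsub>L X\<^esub>"
  shows "\<exists>(Q :: 'g set monoid) p. group Q \<and> finite (carrier Q) \<and>
    p \<in> hom ((L X :: 'g monoid)\<lparr>carrier := sub_image C L Lm X Y\<rparr>) Q \<and> p a \<noteq> \<one>\<^bsub>Q\<^esub>"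
proof -
  let ?K = "L (subobj C X Y)" and ?i = "Lm (subobj C X Y) X id"
  note cat = subset_closed_categoryD[OF C X]
  have K: "group ?K" "group (L X)" "?i \<in> mon ?K (L X)"
    using F X cat(3,5)[OF Y] by (simp_all add: group_functor_def)
  interpret i: group_hom ?K "L X" ?i using K by (simp add: group_hom_def group_hom_axioms_def mon_def)
  have inj: "inj_on ?i (carrier ?K)" using K(3) by (simp add: mon_def)
  obtain b where b: "b \<in> carrier ?K" "a = ?i b" using a(1) by (auto simp: sub_image_def)
  have "b \<noteq> \<one>\<^bsub>?K\<^esub>" using a(2) b by auto
  then obtain M where M: "M \<lhd> ?K" "finite (rcosets\<^bsub>?K\<^esub> M)" "b \<notin> M"
    using rf b(1) by (auto simp: residually_finite_def)
  define j where "j = inv_into (carrier ?K) ?i"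
  define p where "p x = M #>\<^bsub>?K\<^esub> (j x)" for x
  have j: "j (?i x) = x" if "x \<in> carrier ?K" for x using inj that by (simp add: j_def)
  have "group (?K Mod M)" by (rule normal.factorgroup_is_group[OF M(1)])
  moreover have "finite (carrier (?K Mod M))" using M(2) by (simp add: FactGroup_def)
  moreover have "p \<in> hom ((L X)\<lparr>carrier := sub_image C L Lm X Y\<rparr>) (?K Mod M)"
  proof (rule homI)
    fix x assume "x \<in> carrier ((L X)\<lparr>carrier := sub_image C L Lm X Y\<rparr>)"
    then obtain u where "u \<in> carrier ?K" "x = ?i u" by (auto simp: sub_image_def)
    then show "p x \<in> carrier (?K Mod M)" by (auto simp: p_def j FactGroup_def RCOSETS_def)
  next
    fix x y assume "x \<in> carrier ((L X)\<lparr>carrier := sub_image C L Lm X Y\<rparr>)"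
      "y \<in> carrier ((L X)\<lparr>carrier := sub_image C L Lm X Y\<rparr>)"
    then obtain u v where uv: "u \<in> carrier ?K" "x = ?i u" "v \<in> carrier ?K" "y = ?i v"
      by (auto simp: sub_image_def)
    have "j (?i u \<otimes>\<^bsub>L X\<^esub> ?i v) = u \<otimes>\<^bsub>?K\<^esub> v" using j[of "u \<otimes>\<^bsub>?K\<^esub> v"] uv by simp
    then show "p (x \<otimes>\<^bsub>(L X)\<lparr>carrier := sub_image C L Lm X Y\<rparr>\<^esub> y) = p x \<otimes>\<^bsub>?K Mod M\<^esub> p y"
      using uv by (simp add: p_def j FactGroup_def normal.rcos_sum[OF M(1)])
  qed
  moreover have "p a \<noteq> \<one>\<^bsub>?K Mod M\<^esub>"
    using M(3) b group.rcos_self[OF K(1) b(1) normal_imp_subgroup[OF M(1)]]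
    by (auto simp: p_def j FactGroup_def)
  ultimately show ?thesis by blast
qed

text \<open>The index type is that of maps between sets of homomorphisms into coset groups, as
  produced by \<open>finitary_autos_locally_residually_finite\<close>.\<close>

lemma ALf_group_approximable:
  fixes \<G> :: "('h monoid \<times> 'h metric) set" and L :: "'o \<Rightarrow> 'g monoid"
  assumes C: "subset_closed_category C" and X: "X \<in> objs C" and act: "acts_on C \<Gamma> X \<alpha>"
    and halo: "halo_functor C L Lm" "halo_joins C L Lm" "halo_extends_autos C L Lm"
    and fin: "\<And>Y. Y \<subseteq> points C X \<Longrightarrow> finite Y \<Longrightarrow>
       finitely_generated (L (subobj C X Y)) \<and> residually_finite (L (subobj C X Y))"
    and wreath: "wreath_closed TYPE(('g \<Rightarrow> 'g set) \<Rightarrow> ('g \<Rightarrow> 'g set)) \<G>"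
    and Gd: "(G, d) \<in> \<G>" "group G" "d \<one>\<^bsub>G\<^esub> \<one>\<^bsub>G\<^esub> \<le> 0"
  shows "approximable \<G> (ALf_group C L Lm X)"
proof -
  interpret M: monomial_action "points C X" "L X" "sub_image C L Lm X" "point_transport C L Lm X" \<Gamma> \<alpha>
    "induced_auto L Lm X \<alpha>"
    by (rule monomial_action_of_halo[OF C X act halo])
  have F: "group_functor C L Lm" using halo by (simp add: halo_functor_def)
  have "M.finitary_autos = ALf C L Lm X"
    by (auto simp: M.finitary_autos_def M.supp_def ALf_def supported_in_def)
  then have N: "M.N = ALf_group C L Lm X" by (simp add: ALf_group_def)
  have "approximable \<G> M.N"
  proof (rule approximable_locally_residually_finite[OF M.group_N wreath Gd(1,2) _ Gd(3)], goal_cases)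
    case E: (1 E)
    have fg: "\<exists>S\<subseteq>sub_image C L Lm X Y. finite S \<and> generate (L X) S = sub_image C L Lm X Y"
      if "Y \<subseteq> points C X" "finite Y" for Y
      using finitely_generated_sub_image[OF C X F that(1)] fin[OF that] by blast
    have rf: "\<exists>(Q :: 'g set monoid) p. group Q \<and> finite (carrier Q) \<and>
        p \<in> hom ((L X)\<lparr>carrier := sub_image C L Lm X Y\<rparr>) Q \<and> p a \<noteq> \<one>\<^bsub>Q\<^esub>"
      if "Y \<subseteq> points C X" "finite Y" "a \<in> sub_image C L Lm X Y" "a \<noteq> \<one>\<^bsub>L X\<^esub>" for Y a
      using residually_finite_sub_image[OF C X F that(1) _ that(3,4)] fin[OF that(1,2)] by blast
    from M.finitary_autos_locally_residually_finite[OF fg rf, of E] E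
    show ?case
      by simp
  qed
  then show ?thesis by (simp add: N)
qed

lemma set_orbit_approx_if_graph_orbit_approx:
  assumes "graph_orbit_approx \<Gamma> X \<alpha> F E \<epsilon> A \<phi>" "E \<subseteq> verts X"
  shows "set_orbit_approx \<Gamma> \<alpha> F E \<epsilon> A \<phi>"
proof -
  have "verts (induced_subgraph X E) = E" using assms(2) by (auto simp: induced_subgraph_def)
  then show ?thesis
    using assms(1) unfolding graph_orbit_approx_def set_orbit_approx_def graph_embeddings_def by fastforce
qed

lemma AL_group_approximable_criteria:
  fixes \<G> :: "('h monoid \<times> 'h metric) set" and \<Gamma> :: "'a monoid" and \<alpha> :: "'a \<Rightarrow> 'x \<Rightarrow> 'x"
    and L :: "'o \<Rightarrow> 'g monoid"
  assumes C: "subset_closed_category C" and X: "X \<in> objs C" and act: "acts_on C \<Gamma> X \<alpha>"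
    and halo: "halo_functor C L Lm" "halo_joins C L Lm" "halo_extends_autos C L Lm"
    and sofic: "orbit_approximable \<Gamma> (points C X) \<alpha>"
    and groups: "\<And>G d. (G, d) \<in> \<G> \<Longrightarrow> group G \<and> d \<one>\<^bsub>G\<^esub> \<one>\<^bsub>G\<^esub> \<le> 0"
    and wreath: "wreath_closed TYPE(nat \<times> bool) \<G>" "wreath_closed TYPE(('x \<Rightarrow> 'x) \<times> bool) \<G>"
      "wreath_closed TYPE(('g \<Rightarrow> 'g set) \<Rightarrow> ('g \<Rightarrow> 'g set)) \<G>"
    and joint: "jointly_embeddable \<G>"
  shows "(approximable \<G> \<Gamma> \<and> approximable \<G> (ALf_group C L Lm X) \<longrightarrow> approximable \<G> (AL_group C L Lm \<Gamma> X \<alpha>)) \<and>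
    ((\<forall>Y\<subseteq>points C X. finite Y \<longrightarrow>
        finitely_generated (L (subobj C X Y)) \<and> residually_finite (L (subobj C X Y))) \<longrightarrow>
      approximable \<G> \<Gamma> \<longrightarrow> approximable \<G> (AL_group C L Lm \<Gamma> X \<alpha>))"
proof -
  have main: "approximable \<G> (AL_group C L Lm \<Gamma> X \<alpha>)"
    if "approximable \<G> \<Gamma>" "approximable \<G> (ALf_group C L Lm X)"
    by (rule AL_group_approximable[OF C X act halo sofic _ wreath(1,2) joint that]) (use groups in auto)
  have "approximable \<G> (ALf_group C L Lm X)"
    if fin: "\<forall>Y\<subseteq>points C X. finite Y \<longrightarrow>
        finitely_generated (L (subobj C X Y)) \<and> residually_finite (L (subobj C X Y))"
      and app: "approximable \<G> \<Gamma>"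
  proof -
    \<comment> \<open>A member of the class is needed to supply trivial blocks; approximability of
      \<Gamma> on the empty set provides one.\<close>
    have "\<G> \<noteq> {}"
    proof
      assume "\<G> = {}"
      with app show False
        unfolding approximable_def by (auto dest!: spec[of _ "{}"] spec[of _ "1 :: real"])
    qed
    then obtain z where "z \<in> \<G>" by blast
    then obtain G d where Gd: "(G, d) \<in> \<G>" by (cases z) blast
    show ?thesis
      by (rule ALf_group_approximable[OF C X act halo _ wreath(3) Gd]) (use fin groups[OF Gd] in auto)
  qed
  then show ?thesis using main by blast
qed

section \<open>Specialisation to the four classes and to sets and graphs\<close>

lemma hamming_self: "finite A \<Longrightarrow> A \<noteq> {} \<Longrightarrow> hamming A f f = 0"
  by (simp add: hamming_def)

lemma rank_dist_self: "A \<in> carrier_mat n n \<Longrightarrow> rank_dist n A A = 0"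
  by (simp add: rank_dist_def vec_space.rank_0I)

lemma hilbert_schmidt_dist_self: "A \<in> carrier_mat n n \<Longrightarrow> hilbert_schmidt_dist n A A = 0"
  by (simp add: hilbert_schmidt_dist_eq entry_dist2_def)

lemma AL_group_inherits_approximation:
  fixes \<Gamma> :: "'a monoid" and \<alpha> :: "'a \<Rightarrow> 'x \<Rightarrow> 'x" and L :: "'o \<Rightarrow> 'g monoid"
  assumes C: "subset_closed_category C" and X: "X \<in> objs C" and act: "acts_on C \<Gamma> X \<alpha>"
    and halo: "halo_functor C L Lm" "halo_joins C L Lm" "halo_extends_autos C L Lm"
    and sofic: "orbit_approximable \<Gamma> (points C X) \<alpha>"
  defines "fin \<equiv> \<forall>Y\<subseteq>points C X. finite Y \<longrightarrow>
      finitely_generated (L (subobj C X Y)) \<and> residually_finite (L (subobj C X Y))"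
    and "AL \<equiv> AL_group C L Lm \<Gamma> X \<alpha>" and "N \<equiv> ALf_group C L Lm X"
  shows "(sofic \<Gamma> \<and> sofic N \<longrightarrow> sofic AL) \<and> (fin \<longrightarrow> sofic \<Gamma> \<longrightarrow> sofic AL)"
    and "(linear_sofic TYPE('k :: field) \<Gamma> \<and> linear_sofic TYPE('k) N \<longrightarrow> linear_sofic TYPE('k) AL) \<and>
      (fin \<longrightarrow> linear_sofic TYPE('k) \<Gamma> \<longrightarrow> linear_sofic TYPE('k) AL)"
    and "(hyperlinear \<Gamma> \<and> hyperlinear N \<longrightarrow> hyperlinear AL) \<and> (fin \<longrightarrow> hyperlinear \<Gamma> \<longrightarrow> hyperlinear AL)"
    and "(weakly_sofic \<Gamma> \<and> weakly_sofic N \<longrightarrow> weakly_sofic AL) \<and> (fin \<longrightarrow> weakly_sofic \<Gamma> \<longrightarrow> weakly_sofic AL)"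
proof -
  note criterion = AL_group_approximable_criteria[OF C X act halo sofic, folded fin_def AL_def N_def]
  show "(sofic \<Gamma> \<and> sofic N \<longrightarrow> sofic AL) \<and> (fin \<longrightarrow> sofic \<Gamma> \<longrightarrow> sofic AL)"
    unfolding sofic_def
  proof (rule criterion)
    show "jointly_embeddable {(BijGroup {1..n}, hamming {1..n}) | n :: nat. n \<ge> 1}"
      by (rule jointly_embeddable_indexed[OF group_BijGroup BijGroup_wreath_embeds])
    show "group G \<and> d \<one>\<^bsub>G\<^esub> \<one>\<^bsub>G\<^esub> \<le> 0"
      if "(G, d) \<in> {(BijGroup {1..n}, hamming {1..n}) | n :: nat. n \<ge> 1}" for G d
      using that by (auto simp: group_BijGroup hamming_self)
  qed (rule wreath_closed_indexed[OF BijGroup_wreath_embeds]; assumption)+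
  show "(linear_sofic TYPE('k) \<Gamma> \<and> linear_sofic TYPE('k) N \<longrightarrow> linear_sofic TYPE('k) AL) \<and>
      (fin \<longrightarrow> linear_sofic TYPE('k) \<Gamma> \<longrightarrow> linear_sofic TYPE('k) AL)"
    unfolding linear_sofic_def
  proof (rule criterion)
    show "jointly_embeddable {(GL TYPE('k) n, rank_dist n) | n. n \<ge> 1}"
      by (rule jointly_embeddable_indexed[OF group_GL GL_wreath_embeds])
    show "group G \<and> d \<one>\<^bsub>G\<^esub> \<one>\<^bsub>G\<^esub> \<le> 0" if "(G, d) \<in> {(GL TYPE('k) n, rank_dist n) | n. n \<ge> 1}" for G d
      using that by (auto simp: group_GL one_GL rank_dist_self)
  qed (rule wreath_closed_indexed[OF GL_wreath_embeds]; assumption)+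
  show "(hyperlinear \<Gamma> \<and> hyperlinear N \<longrightarrow> hyperlinear AL) \<and> (fin \<longrightarrow> hyperlinear \<Gamma> \<longrightarrow> hyperlinear AL)"
    unfolding hyperlinear_def
  proof (rule criterion)
    show "jointly_embeddable {(unitary_group n, hilbert_schmidt_dist n) | n. n \<ge> 1}"
      by (rule jointly_embeddable_indexed[OF group_unitary_group unitary_group_wreath_embeds])
    show "group G \<and> d \<one>\<^bsub>G\<^esub> \<one>\<^bsub>G\<^esub> \<le> 0"
      if "(G, d) \<in> {(unitary_group n, hilbert_schmidt_dist n) | n. n \<ge> 1}" for G d
      using that by (auto simp: group_unitary_group unitary_group_simps(3) hilbert_schmidt_dist_self)
  qed (rule wreath_closed_indexed[OF unitary_group_wreath_embeds]; assumption)+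
  show "(weakly_sofic \<Gamma> \<and> weakly_sofic N \<longrightarrow> weakly_sofic AL) \<and> (fin \<longrightarrow> weakly_sofic \<Gamma> \<longrightarrow> weakly_sofic AL)"
    unfolding weakly_sofic_def finite_metric_groups_def[symmetric]
  proof (rule criterion)
    show "group G \<and> d \<one>\<^bsub>G\<^esub> \<one>\<^bsub>G\<^esub> \<le> 0" if "(G, d) \<in> finite_metric_groups" for G d
    proof -
      note G = finite_metric_groupsD[OF that]
      have "d \<one>\<^bsub>G\<^esub> \<one>\<^bsub>G\<^esub> = 0"
        using G(1) by (intro Metric_space.mdist_zero[OF G(3)]) (simp add: group.is_monoid)
      then show ?thesis using G(1) by simp
    qed
  qed (rule jointly_embeddable_finite_metric_groups wreath_closed_finite_metric_groups)+
qed

theorem theorem6p37: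
  fixes \<Gamma> :: "'a monoid"
    and X :: "'x set" and \<alpha> :: "'a \<Rightarrow> 'x \<Rightarrow> 'x"
    and L :: "'x set \<Rightarrow> 'g monoid" and Lm :: "'x set \<Rightarrow> 'x set \<Rightarrow> ('x \<Rightarrow> 'x) \<Rightarrow> 'g \<Rightarrow> 'g"
    and X' :: "'x graph" and \<alpha>' :: "'a \<Rightarrow> 'x \<Rightarrow> 'x"
    and L' :: "'x graph \<Rightarrow> 'g monoid"
    and Lm' :: "'x graph \<Rightarrow> 'x graph \<Rightarrow> ('x \<Rightarrow> 'x) \<Rightarrow> 'g \<Rightarrow> 'g"
  assumes "group \<Gamma>" and "infinite (UNIV :: 'x set)"
  shows
    "(sofic_set_action \<Gamma> X \<alpha> \<and> halo_functor Sets L Lm \<and>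
      halo_joins Sets L Lm \<and> halo_extends_autos Sets L Lm \<longrightarrow>
        (sofic \<Gamma> \<and> sofic (ALf_group Sets L Lm X) \<longrightarrow> sofic (AL_group Sets L Lm \<Gamma> X \<alpha>)) \<and>
        (linear_sofic TYPE('k :: field) \<Gamma> \<and> linear_sofic TYPE('k) (ALf_group Sets L Lm X) \<longrightarrow>
           linear_sofic TYPE('k) (AL_group Sets L Lm \<Gamma> X \<alpha>)) \<and>
        (hyperlinear \<Gamma> \<and> hyperlinear (ALf_group Sets L Lm X) \<longrightarrow>
           hyperlinear (AL_group Sets L Lm \<Gamma> X \<alpha>)) \<and>
        (weakly_sofic \<Gamma> \<and> weakly_sofic (ALf_group Sets L Lm X) \<longrightarrow>
           weakly_sofic (AL_group Sets L Lm \<Gamma> X \<alpha>)) \<and>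
        ((\<forall>Y\<subseteq>X. finite Y \<longrightarrow> finitely_generated (L Y) \<and> residually_finite (L Y)) \<longrightarrow>
           (sofic \<Gamma> \<longrightarrow> sofic (AL_group Sets L Lm \<Gamma> X \<alpha>)) \<and>
           (linear_sofic TYPE('k) \<Gamma> \<longrightarrow> linear_sofic TYPE('k) (AL_group Sets L Lm \<Gamma> X \<alpha>)) \<and>
           (hyperlinear \<Gamma> \<longrightarrow> hyperlinear (AL_group Sets L Lm \<Gamma> X \<alpha>)) \<and>
           (weakly_sofic \<Gamma> \<longrightarrow> weakly_sofic (AL_group Sets L Lm \<Gamma> X \<alpha>)))) \<and>
     (simple_graph X' \<and> sofic_graph_action \<Gamma> X' \<alpha>' \<and> halo_functor Graphs L' Lm' \<and>
      halo_joins Graphs L' Lm' \<and> halo_extends_autos Graphs L' Lm' \<longrightarrow>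
        (sofic \<Gamma> \<and> sofic (ALf_group Graphs L' Lm' X') \<longrightarrow>
           sofic (AL_group Graphs L' Lm' \<Gamma> X' \<alpha>')) \<and>
        (linear_sofic TYPE('k) \<Gamma> \<and> linear_sofic TYPE('k) (ALf_group Graphs L' Lm' X') \<longrightarrow>
           linear_sofic TYPE('k) (AL_group Graphs L' Lm' \<Gamma> X' \<alpha>')) \<and>
        (hyperlinear \<Gamma> \<and> hyperlinear (ALf_group Graphs L' Lm' X') \<longrightarrow>
           hyperlinear (AL_group Graphs L' Lm' \<Gamma> X' \<alpha>')) \<and>
        (weakly_sofic \<Gamma> \<and> weakly_sofic (ALf_group Graphs L' Lm' X') \<longrightarrow>
           weakly_sofic (AL_group Graphs L' Lm' \<Gamma> X' \<alpha>')) \<and>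
        ((\<forall>Y\<subseteq>verts X'. finite Y \<longrightarrow>
            finitely_generated (L' (induced_subgraph X' Y)) \<and>
            residually_finite (L' (induced_subgraph X' Y))) \<longrightarrow>
           (sofic \<Gamma> \<longrightarrow> sofic (AL_group Graphs L' Lm' \<Gamma> X' \<alpha>')) \<and>
           (linear_sofic TYPE('k) \<Gamma> \<longrightarrow> linear_sofic TYPE('k) (AL_group Graphs L' Lm' \<Gamma> X' \<alpha>')) \<and>
           (hyperlinear \<Gamma> \<longrightarrow> hyperlinear (AL_group Graphs L' Lm' \<Gamma> X' \<alpha>')) \<and>
           (weakly_sofic \<Gamma> \<longrightarrow> weakly_sofic (AL_group Graphs L' Lm' \<Gamma> X' \<alpha>'))))"
proof (rule conjI, goal_cases)
  case 1
  show ?case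
  proof (rule impI, goal_cases)
    case 1
    have X: "X \<in> objs Sets" and points: "points Sets X = X" by (simp_all add: Sets_def)
    have sub: "subobj Sets X Y = Y" if "Y \<subseteq> X" for Y using that by (auto simp: Sets_def)
    have act: "acts_on Sets \<Gamma> X \<alpha>" using 1 by (simp add: sofic_set_action_def)
    have sofic: "orbit_approximable \<Gamma> (points Sets X) \<alpha>"
      using 1 unfolding sofic_set_action_def orbit_approximable_def points by simp
    have "halo_functor Sets L Lm" "halo_joins Sets L Lm" "halo_extends_autos Sets L Lm" using 1 by simp_all
    note res = AL_group_inherits_approximation[OF subset_closed_Sets X act this sofic, unfolded points]
    have "(\<forall>Y\<subseteq>X. finite Y \<longrightarrow> finitely_generated (L Y) \<and> residually_finite (L Y)) \<longrightarrow>
        (\<forall>Y\<subseteq>X. finite Y \<longrightarrow> finitely_generated (L (subobj Sets X Y)) \<and> residually_finite (L (subobj Sets X Y)))"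
      by (simp add: sub)
    then show ?case using res(1,3,4) res(2)[where 'k = 'k] by argo
  qed
next
  case 2
  show ?case
  proof (rule impI, goal_cases)
    case 1
    have X: "X' \<in> objs Graphs" and points: "points Graphs X' = verts X'"
      and sub: "subobj Graphs X' = induced_subgraph X'" using 1 by (simp_all add: Graphs_def)
    have act: "acts_on Graphs \<Gamma> X' \<alpha>'" using 1 by (simp add: sofic_graph_action_def)
    have sofic: "orbit_approximable \<Gamma> (points Graphs X') \<alpha>'"
      unfolding orbit_approximable_def points
    proof (intro allI impI, goal_cases)
      case E: (1 F E \<epsilon>)
      with 1 obtain A \<phi> where "finite A" "\<phi> \<in> carrier \<Gamma> \<rightarrow> carrier (BijGroup A)" "unital \<Gamma> (BijGroup A) \<phi>"
        "almost_multiplicative \<Gamma> (BijGroup A) (hamming A) F \<epsilon> \<phi>" "graph_orbit_approx \<Gamma> X' \<alpha>' F E \<epsilon> A \<phi>"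
        unfolding sofic_graph_action_def by blast
      moreover from this have "set_orbit_approx \<Gamma> \<alpha>' F E \<epsilon> A \<phi>"
        using E by (intro set_orbit_approx_if_graph_orbit_approx) auto
      ultimately show ?case
        by blast
    qed
    have "halo_functor Graphs L' Lm'" "halo_joins Graphs L' Lm'" "halo_extends_autos Graphs L' Lm'" using 1 by simp_all
    note res = AL_group_inherits_approximation[OF subset_closed_Graphs X act this sofic, unfolded points sub]
    show ?case using res(1,3,4) res(2)[where 'k = 'k] by argo
  qed
qed

end
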